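(* Let $K$ be a commutative ring and $n\ge4$. Then $\Gamma/\Sigma=\{\sigma\Sigma\mid\sigma\in\Gamma\}$ is an affine variety. 1. If $n$ is odd then the Jacobian map $\Gamma/\Sigma\to E_n'$, $\sigma\Sigma\mapsto\mathcal J(\sigma)$, is an isomorphism of affine varieties over $K$, and $\dim(\Gamma/\Sigma)=2^{n-1}-1$. 2. If $n$ is even then the Jacobian map $\Gamma/\Sigma\to E_n'/E'_{n,n}$, $\sigma\Sigma\mapsto\mathcal J(\sigma)E'_{n,n}$, is an isomorphism of affine varieties over $K$ (where $E'_{n,n}=1+Kx_1\cdots x_n$), and $\dim(\Gamma/\Sigma)=2^{n-1}-2$.
   Context: $\Lambda_n=\Lambda_n(K)$ is the Grassmann $K$-algebra generated freely over $K$ by $x_1,\dots,x_n$ subject to $x_i^2=0$, $x_ix_j=-x_jx_i$ ($i\ne j$); it is free over $K$ with basis $x^\alpha=x_{i_1}\cdots x_{i_k}$, $\alpha=\{i_1<\dots<i_k\}\subseteq\{1,\dots,n\}$, graded by $|\alpha|$, with components $\Lambda_{n,d}$; $\mathfrak m=\bigoplus_{d\ge1}\Lambda_{n,d}$; $\Lambda_n^{od}$ is the sum of the odd degree components. $\Gamma$ is the group of $K$-algebra automorphisms $\sigma$ of $\Lambda_n$ with $\sigma(x_i)-x_i\in\Lambda_n^{od}\cap\mathfrak m^3$ for all $i$. The left skew derivation $\partial/\partial x_j$ is the $K$-linear map with $\frac{\partial x_k}{\partial x_j}=\delta_{jk}$ and $\frac{\partial (ab)}{\partial x_j}=\frac{\partial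 a}{\partial x_j}b+(-1)^i a\frac{\partial b}{\partial x_j}$ for $a\in\Lambda_{n,i}$. For $\sigma\in\Gamma$, $\mathcal J(\sigma)=\det(\partial\sigma(x_i)/\partial x_j)\in E_n':=1+\sum_{m\ge1}\Lambda_{n,2m}$ (a multiplicative abelian group). $\Sigma=\{\sigma\in\Gamma\mid\mathcal J(\sigma)=1\}$ is the Jacobian group. Variety structures. A variety over $K$ is called affine of dimension $d$ if its algebra of regular functions is a polynomial algebra over $K$ in $d$ variables. $E_n'$ has as coordinates the coefficients of the monomials $x^\alpha$, $|\alpha|\ge2$ even; for $n$ even, $E_n'/E'_{n,n}$ has as coordinates the coefficients of $x^\alpha$, $2\le|\alpha|<n$ even. For $1\le s\le[\frac{n-1}2]$, each $a\in\Lambda_{n,2s}$ is a unique sum $a=a_{n-2s}+\dots+a_n$ with $a_i$ a $K$-combination of monomials $x^\alpha$ with $|\alpha|=2s$, $i\notin\alpha$, $\{i+1,\dots,n\}\subseteq\alpha$; let $\phi'_a\in\Gamma$ be given by $\phi'_a(x_k)=x_k$ for $k<n-2s$ and $\phi'_a(x_i)=x_i(1+a_i)$ for $n-2s\le i\le n$. Every $\sigma\in\Gamma$ is a unique product $\phi'_{a(2)}\phi'_{a(4)}\cdots\phi'_{a(2[\frac{n-1}2])}\gamma$ with $a(2s)\in\Lambda_{n,2s}$ and $\gamma\in\Sigma$; the coordinate functions on $\Gamma/\Sigma$ are the coefficients of the elements $a(2),a(4),\dots,a(2[\frac{n-1}2])$. $[\cdot]$ is the integer part. *)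

theory Defs
  imports
    "HOL-Library.Poly_Mapping"
    "HOL-Combinatorics.Permutations"
    "HOL-Algebra.Bij"
    "HOL-Algebra.Left_Coset"
    "HOL-Algebra.Ideal_Product"
    "HOL-Algebra.QuotRing"
begin

section \<open>The Grassmann algebra\<close>

text \<open>
  The coefficient ring is a type \<open>'r\<close> of class \<open>comm_ring_1\<close>. An element of
  \<open>\<Lambda>\<^sub>n\<close> is the family of its coefficients in the basis \<open>x\<^sup>\<alpha>\<close>, i.e. a function on
  sets \<open>\<alpha>\<close> of natural numbers that vanishes unless \<open>\<alpha> \<subseteq> {1..n}\<close>.
\<close>

type_synonym 'r grass = "nat set \<Rightarrow> 'r"

text \<open>
  For disjoint \<open>A\<close> and \<open>B\<close>, sorting the product \<open>x\<^sup>A x\<^sup>B\<close> gives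
  \<open>inv_sign A B\<close> times the monomial of \<open>A \<union> B\<close>.
\<close>

definition inv_sign :: "nat set \<Rightarrow> nat set \<Rightarrow> 'r::comm_ring_1" where
  "inv_sign A B = (-1) ^ card {(a, b). a \<in> A \<and> b \<in> B \<and> b < a}"

definition xmon :: "nat set \<Rightarrow> 'r::comm_ring_1 grass" where
  "xmon A = (\<lambda>S. if S = A then 1 else 0)"

definition scale :: "'r::comm_ring_1 \<Rightarrow> 'r grass \<Rightarrow> 'r grass" where
  "scale c f = (\<lambda>S. c * f S)"

definition Grassmann :: "nat \<Rightarrow> 'r::comm_ring_1 grass ring" where
  "Grassmann n =
    \<lparr>carrier = {f. \<forall>S. f S \<noteq> 0 \<longrightarrow> S \<subseteq> {1..n}},
     mult = (\<lambda>f g S. \<Sum>A\<in>Pow S. inv_sign A (S - A) * f A * g (S - A)),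
     one = xmon {},
     zero = (\<lambda>S. 0),
     add = (\<lambda>f g S. f S + g S)\<rparr>"

definition gen :: "nat \<Rightarrow> 'r::comm_ring_1 grass" where
  "gen i = xmon {i}"

definition degrees :: "nat \<Rightarrow> (nat \<Rightarrow> bool) \<Rightarrow> 'r::comm_ring_1 grass set" where
  \<comment> \<open>the sum of the homogeneous components whose degree satisfies \<open>P\<close>\<close>
  "degrees n P = {f \<in> carrier (Grassmann n). \<forall>S. f S \<noteq> 0 \<longrightarrow> P (card S)}"

abbreviation max_ideal :: "nat \<Rightarrow> 'r::comm_ring_1 grass set" where
  "max_ideal n \<equiv> degrees n (\<lambda>d. 1 \<le> d)"

text \<open>
  The left skew derivation with respect to \<open>x\<^sub>j\<close>: it sends \<open>x\<^sub>j x\<^sup>T\<close> to \<open>x\<^sup>T\<close>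
  for \<open>j \<notin> T\<close>, and a monomial not involving \<open>x\<^sub>j\<close> to \<open>0\<close>. The lemmas \<open>skew_deriv_gen\<close>,
  \<open>skew_deriv_linear\<close> and \<open>skew_deriv_mult\<close> below are its defining properties.
\<close>

definition skew_deriv :: "nat \<Rightarrow> 'r::comm_ring_1 grass \<Rightarrow> 'r grass" where
  "skew_deriv j f = (\<lambda>T. if j \<in> T then 0 else inv_sign {j} T * f (insert j T))"

lemma inv_sign_square [simp]: "inv_sign A B * inv_sign A B = (1::'r::comm_ring_1)"
  by (simp add: inv_sign_def flip: power_add)

lemma inv_sign_Un:
  assumes "finite A" "finite B" "finite C"
  shows "A \<inter> B = {} \<Longrightarrow> inv_sign (A \<union> B) C = (inv_sign A C * inv_sign B C :: 'r::comm_ring_1)"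
    and "B \<inter> C = {} \<Longrightarrow> inv_sign A (B \<union> C) = (inv_sign A B * inv_sign A C :: 'r::comm_ring_1)"
proof -
  have fin: "finite {(a, b). a \<in> X \<and> b \<in> Y \<and> b < a}" if "finite X" "finite Y" for X Y :: "nat set"
    by (rule finite_subset[of _ "X \<times> Y"]) (use that in auto)
  show "inv_sign (A \<union> B) C = (inv_sign A C * inv_sign B C :: 'r)" if "A \<inter> B = {}"
  proof -
    have "{(a, b). a \<in> A \<union> B \<and> b \<in> C \<and> b < a} =
      {(a, b). a \<in> A \<and> b \<in> C \<and> b < a} \<union> {(a, b). a \<in> B \<and> b \<in> C \<and> b < a}" by auto
    moreover have "{(a, b). a \<in> A \<and> b \<in> C \<and> b < a} \<inter> {(a, b). a \<in> B \<and> b \<in> C \<and> b < a} = {}"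
      using that by auto
    ultimately show ?thesis
      using fin[of A C] fin[of B C] assms by (simp add: inv_sign_def card_Un_disjoint power_add)
  qed
  show "inv_sign A (B \<union> C) = (inv_sign A B * inv_sign A C :: 'r)" if "B \<inter> C = {}"
  proof -
    have "{(a, b). a \<in> A \<and> b \<in> B \<union> C \<and> b < a} =
      {(a, b). a \<in> A \<and> b \<in> B \<and> b < a} \<union> {(a, b). a \<in> A \<and> b \<in> C \<and> b < a}" by auto
    moreover have "{(a, b). a \<in> A \<and> b \<in> B \<and> b < a} \<inter> {(a, b). a \<in> A \<and> b \<in> C \<and> b < a} = {}"
      using that by auto
    ultimately show ?thesis
      using fin[of A B] fin[of A C] assms by (simp add: inv_sign_def card_Un_disjoint power_add)
  qed
qed

lemma inv_sign_swap:
  assumes "finite V" "j \<notin> V"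
  shows "inv_sign V {j} = ((-1) ^ card V * inv_sign {j} V :: 'r::comm_ring_1)"
proof -
  let ?G = "{a \<in> V. j < a}" and ?L = "{a \<in> V. a < j}"
  have "{(a, b). a \<in> V \<and> b \<in> {j} \<and> b < a} = (\<lambda>a. (a, j)) ` ?G" by auto
  then have G: "card {(a, b). a \<in> V \<and> b \<in> {j} \<and> b < a} = card ?G"
    by (simp add: card_image inj_on_def)
  have "{(a, b). a \<in> {j} \<and> b \<in> V \<and> b < a} = (\<lambda>a. (j, a)) ` ?L" by auto
  then have L: "card {(a, b). a \<in> {j} \<and> b \<in> V \<and> b < a} = card ?L"
    by (simp add: card_image inj_on_def)
  have V: "V = ?G \<union> ?L" using assms(2) by (force simp: not_less_iff_gr_or_eq)
  have "card (?G \<union> ?L) = card ?G + card ?L" by (rule card_Un_disjoint) (use assms(1) in auto)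
  then have "card V = card ?G + card ?L" using V by simp
  then show ?thesis unfolding inv_sign_def G L by (simp add: power_add mult.assoc flip: power_mult_distrib)
qed

lemma xmon_mult:
  assumes "finite A" "finite B"
  shows "xmon A \<otimes>\<^bsub>Grassmann n\<^esub> xmon B =
    (if A \<inter> B = {} then scale (inv_sign A B) (xmon (A \<union> B)) else (\<lambda>S. 0 :: 'r::comm_ring_1))"
proof
  fix S
  have eq: "(xmon A \<otimes>\<^bsub>Grassmann n\<^esub> xmon B) S =
    (\<Sum>C\<in>Pow S. if C = A then (if S - A = B then inv_sign A B else 0) else (0::'r))"
    unfolding Grassmann_def xmon_def monoid.simps by (intro sum.cong) auto
  show "(xmon A \<otimes>\<^bsub>Grassmann n\<^esub> xmon B) S = (if A \<inter> B = {} then scale (inv_sign A B)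
    (xmon (A \<union> B)) else (\<lambda>S. 0 :: 'r)) S"
  proof (cases "finite S")
    case True
    have "A \<subseteq> S \<and> S - A = B \<longleftrightarrow> A \<inter> B = {} \<and> S = A \<union> B" by blast
    then show ?thesis unfolding eq using True
      by (auto simp: scale_def xmon_def)
  next
    case False
    then show ?thesis unfolding eq using assms
      by (auto simp: scale_def xmon_def)
  qed
qed

lemma skew_deriv_gen: "skew_deriv j (gen k) = (if j = k then \<one>\<^bsub>Grassmann n\<^esub> else (\<lambda>S. 0 :: 'r::comm_ring_1))"
  by (rule ext) (auto simp: skew_deriv_def gen_def xmon_def Grassmann_def inv_sign_def)

lemma skew_deriv_linear:
  "skew_deriv j (f \<oplus>\<^bsub>Grassmann n\<^esub> g) = skew_deriv j f \<oplus>\<^bsub>Grassmann n\<^esub> skew_deriv j g"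
  "skew_deriv j (scale c f) = scale c (skew_deriv j f)"
  by (rule ext, simp add: skew_deriv_def Grassmann_def scale_def algebra_simps)+

lemma skew_deriv_mult:
  fixes f g :: "'r::comm_ring_1 grass"
  assumes f: "f \<in> degrees n (\<lambda>k. k = d)"
  shows "skew_deriv j (f \<otimes>\<^bsub>Grassmann n\<^esub> g) =
    (skew_deriv j f \<otimes>\<^bsub>Grassmann n\<^esub> g) \<oplus>\<^bsub>Grassmann n\<^esub> scale ((-1) ^ d) (f \<otimes>\<^bsub>Grassmann n\<^esub> skew_deriv j g)"
proof
  fix T :: "nat set"
  have deg: "card S = d" if "f S \<noteq> 0" for S using f that by (auto simp: degrees_def)
  have split: "(\<Sum>U\<in>Pow (insert j R). h U) = (\<Sum>V\<in>Pow R. h V + h (insert j V))"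
    if "finite R" "j \<notin> R" for R and h :: "nat set \<Rightarrow> 'r"
  proof -
    have "inj_on (insert j) (Pow R)" using that(2) by (auto simp: inj_on_def)
    moreover have "Pow R \<inter> insert j ` Pow R = {}" using that(2) by auto
    ultimately show ?thesis using that(1)
      by (simp add: Pow_insert sum.union_disjoint sum.reindex sum.distrib)
  qed
  show "skew_deriv j (f \<otimes>\<^bsub>Grassmann n\<^esub> g) T = ((skew_deriv j f \<otimes>\<^bsub>Grassmann n\<^esub> g)
    \<oplus>\<^bsub>Grassmann n\<^esub> scale ((-1) ^ d) (f \<otimes>\<^bsub>Grassmann n\<^esub> skew_deriv j g)) T"
  proof (cases "finite T")
    case False
    then show ?thesis by (simp add: skew_deriv_def Grassmann_def scale_def)
  next
    case fin: True
    show ?thesis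
    proof (cases "j \<in> T")
      case False
      have term_eq: "inv_sign {j} T * (inv_sign V (insert j T - V) * f V * g (insert j T - V) +
            inv_sign (insert j V) (insert j T - insert j V) * f (insert j V) * g (insert j T - insert j V))
          = inv_sign V (T - V) * skew_deriv j f V * g (T - V) +
            (-1) ^ d * (inv_sign V (T - V) * f V * skew_deriv j g (T - V))" if "V \<subseteq> T" for V
      proof -
        define W where "W = T - V"
        have T: "T = V \<union> W" "V \<inter> W = {}" and j: "j \<notin> V" "j \<notin> W" and fi: "finite V" "finite W"
          using that False fin by (auto simp: W_def finite_subset)
        have 1: "insert j T - V = insert j W" "insert j T - insert j V = W" using T j by auto
        have s: "inv_sign {j} T = (inv_sign {j} V * inv_sign {j} W :: 'r)"
          "inv_sign V (insert j W) = ((-1) ^ card V * inv_sign {j} V * inv_sign V W :: 'r)"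
          "inv_sign (insert j V) W = (inv_sign {j} W * inv_sign V W :: 'r)"
          using inv_sign_Un(2)[of "{j}" V W, where 'r = 'r] inv_sign_Un(2)[of V "{j}" W, where 'r = 'r]
            inv_sign_Un(1)[of "{j}" V W, where 'r = 'r] inv_sign_swap[of V j, where 'r = 'r] T j fi by simp_all
        have q: "inv_sign {j} X * (inv_sign {j} X * y) = (y::'r)" for X y
          by (simp flip: mult.assoc)
        have c: "(-1) ^ card V * f V = (-1) ^ d * f V" using deg[of V] by (cases "f V = 0") auto
        have "inv_sign {j} T * (inv_sign V (insert j W) * f V * g (insert j W)) =
          inv_sign {j} V * (inv_sign {j} V * (inv_sign {j} W * inv_sign V W * ((-1) ^ card V * f V) * g (insert j W)))"
          unfolding s by (simp add: mult_ac)
        also have "\<dots> = (-1) ^ d * (inv_sign V W * f V * (inv_sign {j} W * g (insert j W)))"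
          unfolding q c by (simp add: mult_ac)
        finally have A: "inv_sign {j} T * (inv_sign V (insert j W) * f V * g (insert j W)) =
          (-1) ^ d * (inv_sign V W * f V * (inv_sign {j} W * g (insert j W)))" .
        have "inv_sign {j} T * (inv_sign (insert j V) W * f (insert j V) * g W) =
          inv_sign {j} W * (inv_sign {j} W * (inv_sign V W * (inv_sign {j} V * f (insert j V)) * g W))"
          unfolding s by (simp add: mult_ac)
        then have B: "inv_sign {j} T * (inv_sign (insert j V) W * f (insert j V) * g W) =
          inv_sign V W * (inv_sign {j} V * f (insert j V)) * g W" unfolding q .
        show ?thesis unfolding 1 distrib_left A B using j by (simp add: skew_deriv_def flip: W_def)
      qed
      have "skew_deriv j (f \<otimes>\<^bsub>Grassmann n\<^esub> g) T = (\<Sum>V\<in>Pow T. inv_sign {j} T *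
        (inv_sign V (insert j T - V) * f V * g (insert j T - V) +
         inv_sign (insert j V) (insert j T - insert j V) * f (insert j V) * g (insert j T - insert j V)))"
        using False by (simp add: skew_deriv_def Grassmann_def split[OF fin] sum_distrib_left)
      also have "\<dots> = (\<Sum>V\<in>Pow T. inv_sign V (T - V) * skew_deriv j f V * g (T - V) +
            (-1) ^ d * (inv_sign V (T - V) * f V * skew_deriv j g (T - V)))"
        by (intro sum.cong refl term_eq) auto
      finally show ?thesis
        by (simp add: Grassmann_def scale_def sum.distrib sum_distrib_left)
    next
      case True
      define R where "R = T - {j}"
      have T: "T = insert j R" "j \<notin> R" "finite R" using True fin by (auto simp: R_def)
      let ?h = "\<lambda>U. inv_sign U (T - U) * skew_deriv j f U * g (T - U) +
            (-1) ^ d * (inv_sign U (T - U) * f U * skew_deriv j g (T - U))"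
      have zero: "?h V + ?h (insert j V) = 0" if "V \<subseteq> R" for V
      proof -
        define W where "W = R - V"
        have j: "j \<notin> V" "j \<notin> W" and fi: "finite V" "finite W" and VW: "V \<inter> W = {}"
          using that T by (auto simp: W_def finite_subset)
        have 1: "T - V = insert j W" "T - insert j V = W" using T j by (auto simp: W_def)
        have s: "inv_sign V (insert j W) = ((-1) ^ card V * inv_sign {j} V * inv_sign V W :: 'r)"
          "inv_sign (insert j V) W = (inv_sign {j} W * inv_sign V W :: 'r)"
          using inv_sign_Un(2)[of V "{j}" W, where 'r = 'r]
            inv_sign_Un(1)[of "{j}" V W, where 'r = 'r] inv_sign_swap[of V j, where 'r = 'r] j fi VW by simp_all
        have q: "inv_sign {j} X * (inv_sign {j} X * y) = (y::'r)" for X y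
          by (simp flip: mult.assoc)
        have c: "(-1) ^ d * f (insert j V) = - ((-1) ^ card V * f (insert j V))"
          using deg[of "insert j V"] j fi by (cases "f (insert j V) = 0") auto
        have "?h V + ?h (insert j V) =
          inv_sign {j} V * (inv_sign {j} V * ((-1) ^ card V * inv_sign V W * f (insert j V) * g (insert j W)))
          + inv_sign {j} W * (inv_sign {j} W * (inv_sign V W * ((-1) ^ d * f (insert j V)) * g (insert j W)))"
          using j unfolding 1 s by (simp add: skew_deriv_def mult_ac)
        also have "\<dots> = 0" unfolding q c by (simp add: mult_ac)
        finally show ?thesis .
      qed
      have "(\<Sum>U\<in>Pow T. ?h U) = (\<Sum>V\<in>Pow R. ?h V + ?h (insert j V))"
        using split[of R ?h] T by simp
      also have "\<dots> = 0" by (intro sum.neutral ballI zero) auto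
      finally show ?thesis
        using True by (simp add: skew_deriv_def[of j "f \<otimes>\<^bsub>Grassmann n\<^esub> g"])
          (simp add: Grassmann_def scale_def sum.distrib sum_distrib_left)
    qed
  qed
qed


section \<open>The groups \<open>\<Gamma>\<close>, \<open>\<Sigma>\<close> and \<open>E'\<^sub>n\<close>, and the Jacobian\<close>

type_synonym 'r endo = "'r grass \<Rightarrow> 'r grass"

definition Gamma :: "nat \<Rightarrow> 'r::comm_ring_1 endo set" where
  "Gamma n = {\<sigma> \<in> ring_iso (Grassmann n) (Grassmann n) \<inter> Bij (carrier (Grassmann n)).
     (\<forall>c. \<forall>a \<in> carrier (Grassmann n). \<sigma> (scale c a) = scale c (\<sigma> a)) \<and>
     (\<forall>i \<in> {1..n}. \<sigma> (gen i) \<ominus>\<^bsub>Grassmann n\<^esub> gen i \<in>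
        degrees n odd \<inter> (max_ideal n \<cdot>\<^bsub>Grassmann n\<^esub> max_ideal n \<cdot>\<^bsub>Grassmann n\<^esub> max_ideal n))}"

definition Gamma_group :: "nat \<Rightarrow> 'r::comm_ring_1 endo monoid" where
  "Gamma_group n = BijGroup (carrier (Grassmann n)) \<lparr>carrier := Gamma n\<rparr>"

text \<open>
  The Leibniz formula for \<open>det (\<skew_deriv>\<sigma>(x\<^sub>i)/\<skew_deriv>x\<^sub>j)\<close>. For \<open>\<sigma> \<in> \<Gamma>\<close> the entries are even, hence
  central, so the order of the factors (here increasing \<open>i\<close>) does not matter.
\<close>

definition jacobian :: "nat \<Rightarrow> 'r::comm_ring_1 endo \<Rightarrow> 'r grass" where
  "jacobian n \<sigma> = (\<lambda>S. \<Sum>p | p permutes {1..n}. of_int (sign p) *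
     foldr (\<lambda>i. (\<otimes>\<^bsub>Grassmann n\<^esub>) (skew_deriv (p i) (\<sigma> (gen i)))) [1..<n+1] \<one>\<^bsub>Grassmann n\<^esub> S)"

definition Sigma_group :: "nat \<Rightarrow> 'r::comm_ring_1 endo set" where
  "Sigma_group n = {\<sigma> \<in> Gamma n. jacobian n \<sigma> = \<one>\<^bsub>Grassmann n\<^esub>}"

definition E_group :: "nat \<Rightarrow> 'r::comm_ring_1 grass ring" where
  "E_group n = (Grassmann n) \<lparr>carrier :=
     {\<one>\<^bsub>Grassmann n\<^esub> \<oplus>\<^bsub>Grassmann n\<^esub> g | g. g \<in> degrees n (\<lambda>d. even d \<and> 2 \<le> d)}\<rparr>"

definition E_top :: "nat \<Rightarrow> 'r::comm_ring_1 grass set" where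
  "E_top n = {\<one>\<^bsub>Grassmann n\<^esub> \<oplus>\<^bsub>Grassmann n\<^esub> scale c (xmon {1..n}) | c. True}"

text \<open>
  \<open>a_part n i a\<close> is the sum of the terms of \<open>a\<close> in which \<open>i\<close> is the largest missing index.
\<close>

definition a_part :: "nat \<Rightarrow> nat \<Rightarrow> 'r::comm_ring_1 grass \<Rightarrow> 'r grass" where
  "a_part n i a = (\<lambda>S. if i \<notin> S \<and> {i+1..n} \<subseteq> S then a S else 0)"

definition phi :: "nat \<Rightarrow> nat \<Rightarrow> 'r::comm_ring_1 grass \<Rightarrow> 'r endo" where
  \<comment> \<open>\<open>\<phi>'\<^sub>a\<close> for \<open>a\<close> homogeneous of degree \<open>2s\<close>\<close>
  "phi n s a = (THE \<sigma>. \<sigma> \<in> Gamma n \<and> (\<forall>i \<in> {1..n}. \<sigma> (gen i) =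
     (if i < n - 2 * s then gen i
      else gen i \<otimes>\<^bsub>Grassmann n\<^esub> (\<one>\<^bsub>Grassmann n\<^esub> \<oplus>\<^bsub>Grassmann n\<^esub> a_part n i a))))"


section \<open>Affine varieties\<close>

text \<open>
  Multivariate polynomials over \<open>'k\<close> with variables indexed by \<open>'i\<close>, and the polynomial
  algebra in the variables from \<open>I\<close>.
\<close>

type_synonym ('i, 'k) mpol = "('i \<Rightarrow>\<^sub>0 nat) \<Rightarrow>\<^sub>0 'k"

definition pvar :: "'i \<Rightarrow> ('i, 'k::comm_ring_1) mpol" where
  "pvar i = Poly_Mapping.single (Poly_Mapping.single i 1) 1"

definition pconst :: "'k::comm_ring_1 \<Rightarrow> ('i, 'k) mpol" where
  "pconst c = Poly_Mapping.single 0 c"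

definition poly_alg :: "'i set \<Rightarrow> ('i, 'k::comm_ring_1) mpol ring" where
  "poly_alg I = \<lparr>carrier = {p. \<forall>m \<in> Poly_Mapping.keys p. Poly_Mapping.keys m \<subseteq> I},
     mult = (*), one = 1, zero = 0, add = (+)\<rparr>"

text \<open>Evaluation at a point \<open>v\<close> over a \<open>'k\<close>-algebra \<open>'r\<close> with structure map \<open>h\<close>.\<close>

definition peval :: "('k::comm_ring_1 \<Rightarrow> 'r::comm_ring_1) \<Rightarrow> ('i \<Rightarrow> 'r) \<Rightarrow> ('i, 'k) mpol \<Rightarrow> 'r" where
  "peval h v p = (\<Sum>m \<in> Poly_Mapping.keys p. h (Poly_Mapping.lookup p m) *
     (\<Prod>i \<in> Poly_Mapping.keys m. v i ^ Poly_Mapping.lookup m i))"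

definition alg_isos :: "('i, 'k::comm_ring_1) mpol ring \<Rightarrow> ('j, 'k) mpol ring \<Rightarrow>
    (('i, 'k) mpol \<Rightarrow> ('j, 'k) mpol) set" where
  "alg_isos A B = {F \<in> ring_iso A B. \<forall>c. F (pconst c) = pconst c}"

text \<open>
  A variety is presented by its set of points over the ring \<open>'r\<close> together with coordinate
  functions indexed by \<open>coord_index\<close>. The field \<open>point\<close> is the inverse of the coordinate
  system: \<open>point V c\<close> is the point with coordinates \<open>c\<close>, for \<open>c\<close> in \<open>coord_space\<close>.
\<close>

record ('p, 'i, 'r) variety =
  points :: "'p set"
  coord_index :: "'i set"
  point :: "('i \<Rightarrow> 'r) \<Rightarrow> 'p"

definition coord_space :: "('p, 'i, 'r) variety \<Rightarrow> ('i \<Rightarrow> 'r) set" where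
  "coord_space V = coord_index V \<rightarrow>\<^sub>E UNIV"

definition coordinates :: "('p, 'i, 'r) variety \<Rightarrow> 'p \<Rightarrow> 'i \<Rightarrow> 'r" where
  "coordinates V = inv_into (coord_space V) (point V)"

definition has_coordinates :: "('p, 'i, 'r) variety \<Rightarrow> bool" where
  "has_coordinates V \<longleftrightarrow> bij_betw (point V) (coord_space V) (points V)"

text \<open>
  The algebra of regular functions consists of the polynomials in the coordinate functions.
  These are formal polynomials, because over a general commutative ring a polynomial is not
  determined by the function it induces on points.
\<close>

definition regular_functions ::
  "('p, 'i, 'k::comm_ring_1) variety \<Rightarrow> ('i, 'k) mpol ring" where
  "regular_functions V = poly_alg (coord_index V)"

definition affine_of_dim :: "('p, 'i, 'k::comm_ring_1) variety \<Rightarrow> nat \<Rightarrow> bool" where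
  "affine_of_dim V d \<longleftrightarrow> has_coordinates V \<and>
     alg_isos (regular_functions V) (poly_alg {..<d}) \<noteq> {}"

text \<open>
  \<open>comorphism_of h X Y f F\<close>: the map \<open>f\<close> between points over the \<open>'k\<close>-algebra \<open>'r\<close> (with
  structure map \<open>h\<close>) is given in coordinates by the polynomials \<open>F (pvar j)\<close> over \<open>'k\<close>.
\<close>

definition comorphism_of ::
  "('k::comm_ring_1 \<Rightarrow> 'r::comm_ring_1) \<Rightarrow> ('p, 'i, 'r) variety \<Rightarrow> ('q, 'j, 'r) variety \<Rightarrow>
   ('p \<Rightarrow> 'q) \<Rightarrow> (('j, 'k) mpol \<Rightarrow> ('i, 'k) mpol) \<Rightarrow> bool" where
  "comorphism_of h X Y f F \<longleftrightarrow> f \<in> points X \<rightarrow> points Y \<and>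
     (\<forall>x \<in> points X. \<forall>j \<in> coord_index Y.
        coordinates Y (f x) j = peval h (coordinates X x) (F (pvar j)))"

text \<open>
  \<open>f\<close> is an isomorphism of affine varieties over \<open>'k\<close>: it is bijective on points, and its
  comorphism is an isomorphism of the algebras of regular functions.

  If \<open>'k\<close> is for instance a finite field, the map on points over \<open>'k\<close> does not determine the
  comorphism. Therefore the same varieties and the same map are also given over the polynomial
  algebra \<open>('i, 'k) mpol\<close> (as \<open>X'\<close>, \<open>Y'\<close>, \<open>f'\<close>), and \<open>F\<close> has to describe both maps. By
  evaluation at the point of \<open>X'\<close> whose coordinates are the variables, this determines \<open>F\<close>.
\<close>

definition variety_iso ::
  "('p, 'i, 'k::comm_ring_1) variety \<Rightarrow> ('q, 'j, 'k) variety \<Rightarrow> ('p \<Rightarrow> 'q) \<Rightarrow>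
   ('p2, 'i, ('i, 'k) mpol) variety \<Rightarrow> ('q2, 'j, ('i, 'k) mpol) variety \<Rightarrow> ('p2 \<Rightarrow> 'q2) \<Rightarrow> bool" where
  "variety_iso X Y f X' Y' f' \<longleftrightarrow>
     has_coordinates X \<and> has_coordinates Y \<and> has_coordinates X' \<and> has_coordinates Y' \<and>
     bij_betw f (points X) (points Y) \<and>
     (\<exists>F \<in> alg_isos (regular_functions Y) (regular_functions X).
        comorphism_of id X Y f F \<and> comorphism_of pconst X' Y' f' F)"


section \<open>The varieties \<open>\<Gamma>/\<Sigma>\<close>, \<open>E'\<^sub>n\<close> and \<open>E'\<^sub>n/E'\<^sub>n\<^sub>,\<^sub>n\<close>\<close>

definition phi_product :: "nat \<Rightarrow> (nat \<Rightarrow> 'r::comm_ring_1 grass) \<Rightarrow> 'r endo" where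
  \<comment> \<open>\<open>\<phi>'\<^sub>a\<^sub>(\<^sub>2\<^sub>) \<phi>'\<^sub>a\<^sub>(\<^sub>4\<^sub>) \<cdots>\<close>\<close>
  "phi_product n a = foldr (\<lambda>s. (\<otimes>\<^bsub>Gamma_group n\<^esub>) (phi n s (a (2 * s))))
     [1..<(n - 1) div 2 + 1] \<one>\<^bsub>Gamma_group n\<^esub>"

text \<open>The coordinates of \<open>\<sigma>\<Sigma>\<close> are the coefficients of \<open>a(2), a(4), \<dots>\<close>
  in \<open>\<sigma> = \<phi>'\<^sub>a\<^sub>(\<^sub>2\<^sub>) \<phi>'\<^sub>a\<^sub>(\<^sub>4\<^sub>) \<cdots> \<gamma>\<close> with \<open>\<gamma> \<in> \<Sigma>\<close>.\<close>

definition Gamma_mod_Sigma :: "nat \<Rightarrow> ('r::comm_ring_1 endo set, nat set, 'r) variety" where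
  "Gamma_mod_Sigma n =
    \<lparr>points = lcosets\<^bsub>Gamma_group n\<^esub> (Sigma_group n),
     coord_index = {S. S \<subseteq> {1..n} \<and> (\<exists>s \<in> {1..(n - 1) div 2}. card S = 2 * s)},
     point = (\<lambda>c. phi_product n (\<lambda>d S. if S \<subseteq> {1..n} \<and> card S = d then c S else 0)
                <#\<^bsub>Gamma_group n\<^esub> Sigma_group n)\<rparr>"

definition E_point :: "nat set set \<Rightarrow> (nat set \<Rightarrow> 'r::comm_ring_1) \<Rightarrow> 'r grass" where
  "E_point I c = (\<lambda>S. if S \<in> I then c S else xmon {} S)"

definition E_variety :: "nat \<Rightarrow> ('r::comm_ring_1 grass, nat set, 'r) variety" where
  "E_variety n = (let I = {S. S \<subseteq> {1..n} \<and> even (card S) \<and> 2 \<le> card S} in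
    \<lparr>points = carrier (E_group n), coord_index = I, point = E_point I\<rparr>)"

definition E_mod_top :: "nat \<Rightarrow> ('r::comm_ring_1 grass set, nat set, 'r) variety" where
  "E_mod_top n = (let I = {S. S \<subseteq> {1..n} \<and> even (card S) \<and> 2 \<le> card S \<and> card S < n} in
    \<lparr>points = lcosets\<^bsub>E_group n\<^esub> (E_top n), coord_index = I,
     point = (\<lambda>c. E_point I c <#\<^bsub>E_group n\<^esub> E_top n)\<rparr>)"

text \<open>
  The map on cosets induced by a map \<open>g\<close> that is constant on each of them.
\<close>

definition coset_map :: "('a \<Rightarrow> 'b) \<Rightarrow> 'a set \<Rightarrow> 'b" where
  "coset_map g C = the_elem (g ` C)"

definition jac_odd :: "nat \<Rightarrow> 'r::comm_ring_1 endo set \<Rightarrow> 'r grass" where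
  "jac_odd n = coset_map (jacobian n)"

definition jac_even :: "nat \<Rightarrow> 'r::comm_ring_1 endo set \<Rightarrow> 'r grass set" where
  "jac_even n = coset_map (\<lambda>\<sigma>. jacobian n \<sigma> <#\<^bsub>E_group n\<^esub> E_top n)"

end

theory Submission
  imports Defs "Jordan_Normal_Form.Determinant"
begin

text \<open>
  The Jacobian is a cocycle, \<open>J(\<sigma>\<tau>) = J(\<sigma>) \<sigma>(J(\<tau>))\<close>, so the cosets of \<open>\<Sigma>\<close> are exactly its fibres. In terms of
  the coordinates \<open>a(2), a(4), \<dots>\<close>, the component of \<open>J(\<sigma>)\<close> of degree \<open>2s\<close> is \<open>a(2s)\<close> plus an expression in
  \<open>a(2), \<dots>, a(2s - 2)\<close>; this triangularity makes the Jacobian bijective on coordinates in all degrees below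
  \<open>n\<close>, over every commutative ring. A component of degree \<open>n\<close> carries no information: the change of variables
  formula for the Berezin integral forces \<open>J(\<sigma>) = 1\<close> as soon as \<open>J(\<sigma>) = 1 + c x\<^sub>1 \<cdots> x\<^sub>n\<close>. Finally, the
  bijection on coordinates commutes with base change, and by evaluation at the generic point a natural
  bijection of affine spaces is an isomorphism of varieties.
\<close>

section \<open>The Grassmann algebra as a type\<close>

text \<open>The part a_i of a does not involve x_i, so the Jacobian matrix of \<phi>'_a has diagonal
  entries 1 + a_i. Their first-order contributions add up to a, and everything else is of second
  order in entries of degree at least 2s. Hence a(2s) enters the component of degree 2s with
  coefficient exactly 1, and no division occurs. The obstacle is the top degree for even n: the
  parameters stop below n, so the lower components of a Jacobian have to determine the top one.
  Counting degrees cannot show this; an invariant is required. The integral of J(\<sigma>)^(-1)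
  \<sigma>(f) equals that of f, with the inverse because the variables anticommute, and since every
  automorphism is composed of substitutions x_k -> x_k + a, only such a substitution has to be
  computed. The entries of the Jacobian matrix are even and so lie in a commutative ring, where the
  usual determinant is available. One type carries the union of all \<Lambda>_n, so that it is a
  ring in the sense of the type classes; the rank n survives as the submodule
  \<open>Lam n\<close>.\<close>

typedef (overloaded) 'r exterior = "{f :: 'r::comm_ring_1 grass. \<exists>n. f \<in> carrier (Grassmann n)}"
  morphisms ecoeff Exterior
  by (rule exI[of _ "\<lambda>S. 0"]) (simp add: Grassmann_def)

setup_lifting type_definition_exterior

lemma carrier_Grassmann_iff: "f \<in> carrier (Grassmann n) \<longleftrightarrow> (\<forall>S. f S \<noteq> 0 \<longrightarrow> S \<subseteq> {1..n})"
  by (simp add: Grassmann_def)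

lemma carrier_Grassmann_mono: "m \<le> n \<Longrightarrow> f \<in> carrier (Grassmann m) \<Longrightarrow> f \<in> carrier (Grassmann n)"
  unfolding carrier_Grassmann_iff by (metis atLeastatMost_subset_iff le_refl subset_trans)

lemma Grassmann_mult_carrier:
  assumes "f \<in> carrier (Grassmann m)" "g \<in> carrier (Grassmann n)"
  shows "(\<lambda>S. \<Sum>A\<in>Pow S. inv_sign A (S - A) * f A * g (S - A)) \<in> carrier (Grassmann (max m n))"
proof -
  have "S \<subseteq> {1..max m n}" if nz: "(\<Sum>A\<in>Pow S. inv_sign A (S - A) * f A * g (S - A)) \<noteq> 0" for S
  proof -
    obtain A where A: "A \<in> Pow S" "inv_sign A (S - A) * f A * g (S - A) \<noteq> 0"
      by (rule sum.not_neutral_contains_not_neutral[OF nz])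
    then have "f A \<noteq> 0" "g (S - A) \<noteq> 0" by auto
    then have "A \<subseteq> {1..m}" "S - A \<subseteq> {1..n}" using assms by (auto simp: Grassmann_def)
    moreover have "{1..m} \<union> {1..n} \<subseteq> {1..max m n}" by auto
    ultimately show ?thesis by blast
  qed
  then show ?thesis by (simp add: carrier_Grassmann_iff)
qed

instantiation exterior :: (comm_ring_1) "{zero, one, plus, minus, uminus, times}"
begin

lift_definition zero_exterior :: "'a exterior" is "\<lambda>S. 0"
  by (simp add: Grassmann_def)

lift_definition one_exterior :: "'a exterior" is "xmon {}"
  by (simp add: Grassmann_def xmon_def)

lift_definition plus_exterior :: "'a exterior \<Rightarrow> 'a exterior \<Rightarrow> 'a exterior" is "\<lambda>f g S. f S + g S"
proof -
  fix f g :: "'a grass"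
  assume "\<exists>n. f \<in> carrier (Grassmann n)" "\<exists>n. g \<in> carrier (Grassmann n)"
  then obtain m n where mn: "f \<in> carrier (Grassmann (max m n))" "g \<in> carrier (Grassmann (max m n))"
    by (meson carrier_Grassmann_mono max.cobounded1 max.cobounded2)
  have "f S \<noteq> 0 \<or> g S \<noteq> 0" if "f S + g S \<noteq> 0" for S using that by auto
  then show "\<exists>n. (\<lambda>S. f S + g S) \<in> carrier (Grassmann n)"
    using mn unfolding carrier_Grassmann_iff by blast
qed

lift_definition minus_exterior :: "'a exterior \<Rightarrow> 'a exterior \<Rightarrow> 'a exterior" is "\<lambda>f g S. f S - g S"
proof -
  fix f g :: "'a grass"
  assume "\<exists>n. f \<in> carrier (Grassmann n)" "\<exists>n. g \<in> carrier (Grassmann n)"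
  then obtain m n where mn: "f \<in> carrier (Grassmann (max m n))" "g \<in> carrier (Grassmann (max m n))"
    by (meson carrier_Grassmann_mono max.cobounded1 max.cobounded2)
  have "f S \<noteq> 0 \<or> g S \<noteq> 0" if "f S - g S \<noteq> 0" for S using that by auto
  then show "\<exists>n. (\<lambda>S. f S - g S) \<in> carrier (Grassmann n)"
    using mn unfolding carrier_Grassmann_iff by blast
qed

lift_definition uminus_exterior :: "'a exterior \<Rightarrow> 'a exterior" is "\<lambda>f S. - f S"
  by (simp add: Grassmann_def)

lift_definition times_exterior :: "'a exterior \<Rightarrow> 'a exterior \<Rightarrow> 'a exterior" is
  "\<lambda>f g S. \<Sum>A\<in>Pow S. inv_sign A (S - A) * f A * g (S - A)"
  by (blast intro: Grassmann_mult_carrier)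

instance ..

end

lemma ecoeff_zero [simp]: "ecoeff 0 S = 0"
  by transfer simp

lemma ecoeff_one: "ecoeff 1 S = (if S = {} then 1 else 0)"
  by transfer (simp add: xmon_def)

lemma ecoeff_add [simp]: "ecoeff (f + g) S = ecoeff f S + ecoeff g S"
  by transfer simp

lemma ecoeff_diff [simp]: "ecoeff (f - g) S = ecoeff f S - ecoeff g S"
  by transfer simp

lemma ecoeff_uminus [simp]: "ecoeff (- f) S = - ecoeff f S"
  by transfer simp

lemma ecoeff_mult: "ecoeff (f * g) S = (\<Sum>A\<in>Pow S. inv_sign A (S - A) * ecoeff f A * ecoeff g (S - A))"
  by transfer simp

lemma exterior_eqI: "(\<And>S. ecoeff f S = ecoeff g S) \<Longrightarrow> f = g"
  by (metis ecoeff_inject ext)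

lemma ecoeff_support: "\<exists>n. \<forall>S. ecoeff f S \<noteq> 0 \<longrightarrow> S \<subseteq> {1..n}"
  using ecoeff[of f] by (auto simp: Grassmann_def)

lemma ecoeff_infinite [simp]: "infinite S \<Longrightarrow> ecoeff f S = 0"
  using ecoeff_support[of f] finite_subset by blast

lemma inv_sign_empty [simp]: "inv_sign {} A = 1" "inv_sign A {} = 1"
  by (simp_all add: inv_sign_def)

text \<open>Both sides count the inversions between the three blocks B, A - B and S - A, pair of
  blocks by pair of blocks. This cocycle identity of signs is what associativity of the product
  amounts to.\<close>

lemma inv_sign_assoc:
  assumes "finite S" "B \<subseteq> A" "A \<subseteq> S"
  shows "inv_sign A (S - A) * inv_sign B (A - B) =
    (inv_sign B (S - B) * inv_sign (A - B) (S - A) :: 'r::comm_ring_1)"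
proof -
  define C E where "C = A - B" and "E = S - A"
  have A: "A = B \<union> C" and SB: "S - B = C \<union> E" using assms by (auto simp: C_def E_def)
  have "finite B" "finite C" "finite E" "B \<inter> C = {}" "C \<inter> E = {}"
    using assms by (auto simp: C_def E_def intro: finite_subset)
  then show ?thesis
    using inv_sign_Un(1)[of B C E, where 'r = 'r] inv_sign_Un(2)[of B C E, where 'r = 'r]
    unfolding C_def[symmetric] E_def[symmetric] SB unfolding A
    by (simp add: mult_ac)
qed

lemma exterior_mult_assoc: "(f * g) * h = f * (g * h)" for f g h :: "'r::comm_ring_1 exterior"
proof (rule exterior_eqI)
  fix S
  show "ecoeff ((f * g) * h) S = ecoeff (f * (g * h)) S"
  proof (cases "finite S")
    case True
    then have fin: "finite A" if "A \<subseteq> S" for A using that finite_subset by blast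
    have "ecoeff ((f * g) * h) S = (\<Sum>A\<in>Pow S. \<Sum>B\<in>Pow A.
        inv_sign A (S - A) * inv_sign B (A - B) * (ecoeff f B * ecoeff g (A - B) * ecoeff h (S - A)))"
      unfolding ecoeff_mult[of "f * g"] ecoeff_mult[of f] sum_distrib_left sum_distrib_right
      by (simp add: mult_ac)
    also have "\<dots> = (\<Sum>(A, B)\<in>Sigma (Pow S) Pow.
        inv_sign A (S - A) * inv_sign B (A - B) * (ecoeff f B * ecoeff g (A - B) * ecoeff h (S - A)))"
      by (rule sum.Sigma) (use True fin in auto)
    \<comment> \<open>A chain B \<subseteq> A \<subseteq> S is the same as a set B together with C =
      A - B inside S - B.\<close>
    also have "\<dots> = (\<Sum>(B, C)\<in>Sigma (Pow S) (\<lambda>B. Pow (S - B)).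
        inv_sign B (S - B) * inv_sign C (S - B - C) * (ecoeff f B * ecoeff g C * ecoeff h (S - B - C)))"
    proof (rule sum.reindex_bij_witness[of _ "\<lambda>(B, C). (B \<union> C, B)" "\<lambda>(A, B). (B, A - B)"])
      fix p assume "p \<in> Sigma (Pow S) Pow"
      then obtain A B where p: "p = (A, B)" "B \<subseteq> A" "A \<subseteq> S" by auto
      then have "S - B - (A - B) = S - A" by auto
      then show "(case (case p of (A, B) \<Rightarrow> (B, A - B)) of (B, C) \<Rightarrow>
            inv_sign B (S - B) * inv_sign C (S - B - C) * (ecoeff f B * ecoeff g C * ecoeff h (S - B - C)))
          = (case p of (A, B) \<Rightarrow> inv_sign A (S - A) * inv_sign B (A - B) *
            (ecoeff f B * ecoeff g (A - B) * ecoeff h (S - A)))"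
        using inv_sign_assoc[OF True p(2,3), where 'r = 'r] p(1) by simp
    qed auto
    also have "\<dots> = (\<Sum>B\<in>Pow S. \<Sum>C\<in>Pow (S - B).
        inv_sign B (S - B) * inv_sign C (S - B - C) * (ecoeff f B * ecoeff g C * ecoeff h (S - B - C)))"
      by (rule sum.Sigma[symmetric]) (use True in auto)
    also have "\<dots> = ecoeff (f * (g * h)) S"
      unfolding ecoeff_mult[of f] ecoeff_mult[of g] sum_distrib_left by (simp add: mult_ac)
    finally show ?thesis .
  qed simp
qed

instance exterior :: (comm_ring_1) ring_1
proof
  fix f g h :: "'a exterior"
  show "f * g * h = f * (g * h)" by (rule exterior_mult_assoc)
  show "1 * f = f"
  proof (rule exterior_eqI)
    fix S
    show "ecoeff (1 * f) S = ecoeff f S"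
    proof (cases "finite S")
      case True
      have "ecoeff (1 * f) S = (\<Sum>A\<in>Pow S. if A = {} then ecoeff f S else 0)"
        unfolding ecoeff_mult by (rule sum.cong) (auto simp: ecoeff_one)
      then show ?thesis using True by simp
    qed simp
  qed
  show "f * 1 = f"
  proof (rule exterior_eqI)
    fix S
    show "ecoeff (f * 1) S = ecoeff f S"
    proof (cases "finite S")
      case True
      have "ecoeff (f * 1) S = (\<Sum>A\<in>Pow S. if A = S then ecoeff f S else 0)"
        unfolding ecoeff_mult by (rule sum.cong) (auto simp: ecoeff_one)
      then show ?thesis using True by simp
    qed simp
  qed
  show "(f + g) * h = f * h + g * h"
    by (rule exterior_eqI) (simp add: ecoeff_mult algebra_simps sum.distrib)
  show "f * (g + h) = f * g + f * h"
    by (rule exterior_eqI) (simp add: ecoeff_mult algebra_simps sum.distrib)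
  have "ecoeff 0 {} \<noteq> ecoeff (1 :: 'a exterior) {}" by (simp add: ecoeff_one)
  then show "(0 :: 'a exterior) \<noteq> 1" by metis
qed (rule exterior_eqI; simp add: algebra_simps)+

lemma ecoeff_sum [simp]: "ecoeff (sum f A) S = (\<Sum>x\<in>A. ecoeff (f x) S)"
  by (induction A rule: infinite_finite_induct) auto

text \<open>Scalars enter as central elements of degree 0, so that K-linearity becomes compatibility
  with multiplication by \<open>econst c\<close>.\<close>

lift_definition econst :: "'r::comm_ring_1 \<Rightarrow> 'r exterior" is "\<lambda>c. scale c (xmon {})"
  by (simp add: Grassmann_def xmon_def scale_def)

lemma subset_Max:
  fixes S :: "nat set"
  assumes "finite S" "0 \<notin> S"
  shows "S \<subseteq> {1..Max (insert 0 S)}"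
proof
  fix x assume "x \<in> S"
  moreover then have "x \<noteq> 0" using assms(2) by metis
  ultimately show "x \<in> {1..Max (insert 0 S)}" using assms(1) by simp
qed

text \<open>Sets that are not the index set of a monomial in x_1, x_2, ... are sent to 0. This makes
  the function total and explains the side conditions \<open>finite S\<close> and
  \<open>0 \<notin> S\<close> below.\<close>

lift_definition emon :: "nat set \<Rightarrow> 'r::comm_ring_1 exterior" is
  "\<lambda>S. if finite S \<and> 0 \<notin> S then xmon S else (\<lambda>_. 0)"
proof -
  fix S :: "nat set"
  show "\<exists>n. (if finite S \<and> 0 \<notin> S then xmon S else (\<lambda>_. 0)) \<in> carrier (Grassmann n)"
  proof (cases "finite S \<and> 0 \<notin> S")
    case True
    then have "S \<subseteq> {1..Max (insert 0 S)}" by (intro subset_Max) auto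
    then show ?thesis using True by (intro exI[of _ "Max (insert 0 S)"]) (auto simp: Grassmann_def xmon_def)
  next
    case False
    then show ?thesis by (simp only: if_False) (simp add: Grassmann_def)
  qed
qed

lift_definition ederiv :: "nat \<Rightarrow> 'r::comm_ring_1 exterior \<Rightarrow> 'r exterior" is skew_deriv
proof -
  fix j and f :: "'r grass"
  assume "\<exists>n. f \<in> carrier (Grassmann n)"
  then obtain n where n: "f \<in> carrier (Grassmann n)" ..
  have "S \<subseteq> {1..n}" if "skew_deriv j f S \<noteq> 0" for S
  proof -
    have "f (insert j S) \<noteq> 0" using that by (auto simp: skew_deriv_def split: if_splits)
    then have "insert j S \<subseteq> {1..n}" using n unfolding Grassmann_def by auto
    then show ?thesis by auto
  qed
  then show "\<exists>n. skew_deriv j f \<in> carrier (Grassmann n)" by (auto simp: Grassmann_def)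
qed

text \<open>The grading involution. It carries the sign of the skew Leibniz rule and of commutation
  with odd elements, which lets both be stated for elements that are not homogeneous.\<close>

lift_definition ebar :: "'r::comm_ring_1 exterior \<Rightarrow> 'r exterior" is "\<lambda>f S. (-1) ^ card S * f S"
  unfolding carrier_Grassmann_iff by (metis mult_zero_right)

lemma ecoeff_econst: "ecoeff (econst c) S = (if S = {} then c else 0)"
  by transfer (simp add: scale_def xmon_def)

lemma ecoeff_emon: "finite T \<Longrightarrow> 0 \<notin> T \<Longrightarrow> ecoeff (emon T) S = (if S = T then 1 else 0)"
  by transfer (simp add: xmon_def)

lemma ecoeff_ederiv: "ecoeff (ederiv j f) S = (if j \<in> S then 0 else inv_sign {j} S * ecoeff f (insert j S))"
  by transfer (simp add: skew_deriv_def)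

lemma ecoeff_ebar: "ecoeff (ebar f) S = (-1) ^ card S * ecoeff f S"
  by transfer simp

lemma ecoeff_econst_mult [simp]: "ecoeff (econst c * f) S = c * ecoeff f S"
proof (cases "finite S")
  case True
  have "ecoeff (econst c * f) S = (\<Sum>A\<in>Pow S. if A = {} then c * ecoeff f S else 0)"
    unfolding ecoeff_mult by (rule sum.cong) (auto simp: ecoeff_econst)
  then show ?thesis using True by simp
qed simp

lemma ecoeff_mult_econst [simp]: "ecoeff (f * econst c) S = c * ecoeff f S"
proof (cases "finite S")
  case True
  have "ecoeff (f * econst c) S = (\<Sum>A\<in>Pow S. if A = S then c * ecoeff f S else 0)"
    unfolding ecoeff_mult by (rule sum.cong) (auto simp: ecoeff_econst)
  then show ?thesis using True by simp
qed simp

lemma econst_commute: "f * econst c = econst c * f"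
  by (rule exterior_eqI) simp

lemma econst_hom [simp]: "econst 0 = 0" "econst 1 = 1"
  by (auto intro!: exterior_eqI simp: ecoeff_econst ecoeff_one)

lemma econst_mult: "econst (a * b) = econst a * econst b"
  by (auto intro!: exterior_eqI simp: ecoeff_econst)

lemma econst_mult_left_commute: "f * (econst c * g) = econst c * (f * g)"
  by (metis econst_commute mult.assoc)

text \<open>Rank, parity, degree bounds and the absence of a variable are all expressed as
  membership in the span of a set of monomials, so one collection of closure rules serves for all of
  them.\<close>

definition espan :: "nat set set \<Rightarrow> 'r::comm_ring_1 exterior set" where
  "espan A = {f. \<forall>S. ecoeff f S \<noteq> 0 \<longrightarrow> S \<in> A}"

lemma espanI: "(\<And>S. ecoeff f S \<noteq> 0 \<Longrightarrow> S \<in> A) \<Longrightarrow> f \<in> espan A"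
  and espanD: "f \<in> espan A \<Longrightarrow> S \<notin> A \<Longrightarrow> ecoeff f S = 0"
  by (auto simp: espan_def)

lemma espan_iff: "f \<in> espan A \<longleftrightarrow> (\<forall>S. S \<notin> A \<longrightarrow> ecoeff f S = 0)"
  by (auto simp: espan_def)

lemma espan_zero [simp, intro]: "0 \<in> espan A"
  and espan_add [intro]: "f \<in> espan A \<Longrightarrow> g \<in> espan A \<Longrightarrow> f + g \<in> espan A"
  and espan_diff [intro]: "f \<in> espan A \<Longrightarrow> g \<in> espan A \<Longrightarrow> f - g \<in> espan A"
  and espan_uminus: "f \<in> espan A \<Longrightarrow> - f \<in> espan A"
  and espan_econst_mult [intro]: "f \<in> espan A \<Longrightarrow> econst c * f \<in> espan A"
  and espan_mono: "f \<in> espan A \<Longrightarrow> A \<subseteq> B \<Longrightarrow> f \<in> espan B"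
  and espan_one: "{} \<in> A \<Longrightarrow> 1 \<in> espan A"
  by (auto simp: espan_iff ecoeff_one)

lemma espan_emon: "T \<in> A \<Longrightarrow> emon T \<in> espan A"
  unfolding espan_iff by transfer (auto simp: xmon_def)

lemma espan_sum [intro]: "(\<And>x. x \<in> I \<Longrightarrow> f x \<in> espan A) \<Longrightarrow> sum f I \<in> espan A"
  by (induction I rule: infinite_finite_induct) auto

lemma espan_mult:
  assumes "f \<in> espan A" "g \<in> espan B"
    and "\<And>S T. S \<in> A \<Longrightarrow> T \<in> B \<Longrightarrow> finite S \<Longrightarrow> finite T \<Longrightarrow> S \<inter> T = {} \<Longrightarrow> S \<union> T \<in> C"
  shows "f * g \<in> espan C"
proof -
  have "S \<in> C" if nz: "ecoeff (f * g) S \<noteq> 0" for S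
  proof -
    have "finite S" using nz by (metis ecoeff_infinite)
    obtain X where X: "X \<in> Pow S" "inv_sign X (S - X) * ecoeff f X * ecoeff g (S - X) \<noteq> 0"
      using nz unfolding ecoeff_mult by (rule sum.not_neutral_contains_not_neutral)
    then have "ecoeff f X \<noteq> 0" "ecoeff g (S - X) \<noteq> 0" by auto
    then have "X \<in> A" "S - X \<in> B" using assms(1,2) by (auto simp: espan_def)
    moreover have "finite X" "finite (S - X)"
      using \<open>finite S\<close> X(1) by (simp_all add: finite_subset[of X S])
    ultimately have "X \<union> (S - X) \<in> C" using assms(3) by blast
    then show ?thesis using X by (simp add: Un_absorb1)
  qed
  then show ?thesis by (simp add: espan_def)
qed

lemma espan_expand:
  assumes "f \<in> espan A" "finite A" "\<And>S. S \<in> A \<Longrightarrow> finite S \<and> 0 \<notin> S"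
  shows "f = (\<Sum>S\<in>A. econst (ecoeff f S) * emon S)"
proof (rule exterior_eqI)
  fix T
  have "(\<Sum>S\<in>A. ecoeff f S * ecoeff (emon S) T) = (\<Sum>S\<in>A. if S = T then ecoeff f T else 0)"
    by (rule sum.cong) (use assms(3) in \<open>auto simp: ecoeff_emon\<close>)
  also have "\<dots> = ecoeff f T" using assms(1,2) by (auto simp: espan_def)
  finally show "ecoeff f T = ecoeff (\<Sum>S\<in>A. econst (ecoeff f S) * emon S) T" by simp
qed

text \<open>Supports are finite, so an element is a finite sum of monomials from A. Identities that
  are additive and compatible with scalars thereby reduce to monomials; the case \<open>add\<close>
  also provides that both summands lie in \<open>espan A\<close>.\<close>

lemma espan_induct [consumes 1, case_names zero mon add]:
  assumes f: "f \<in> espan A" and "P 0"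
    and mon: "\<And>S c. S \<in> A \<Longrightarrow> finite S \<Longrightarrow> 0 \<notin> S \<Longrightarrow> P (econst c * emon S)"
    and add: "\<And>f g. f \<in> espan A \<Longrightarrow> g \<in> espan A \<Longrightarrow> P f \<Longrightarrow> P g \<Longrightarrow> P (f + g)"
  shows "P f"
proof -
  define X where "X = {S. ecoeff f S \<noteq> 0}"
  obtain n where "\<forall>S. ecoeff f S \<noteq> 0 \<longrightarrow> S \<subseteq> {1..n}" using ecoeff_support[of f] ..
  then have n: "S \<subseteq> {1..n}" if "S \<in> X" for S using that by (simp add: X_def)
  have S: "finite S \<and> 0 \<notin> S" if "S \<in> X" for S
  proof -
    have "S \<subseteq> {1..n}" by (rule n[OF that])
    then show ?thesis by (auto dest: finite_subset)
  qed
  have "X \<subseteq> Pow {1..n}"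
  proof
    fix S assume "S \<in> X"
    then show "S \<in> Pow {1..n}" using n by (intro PowI)
  qed
  then have fX: "finite X" by (rule finite_subset) simp
  have XA: "X \<subseteq> A"
  proof
    fix S assume "S \<in> X"
    then show "S \<in> A" using f by (simp add: X_def espan_def)
  qed
  have eq: "f = (\<Sum>S\<in>X. econst (ecoeff f S) * emon S)"
  proof (rule espan_expand[OF _ fX])
    show "f \<in> espan X" by (simp add: espan_def X_def)
  qed (rule S)
  have "P (\<Sum>S\<in>Y. econst (ecoeff f S) * emon S)" if "finite Y" "Y \<subseteq> X" for Y
    using that
  proof (induction Y)
    case empty
    then show ?case using assms(2) by simp
  next
    case (insert S Y)
    then have "S \<in> X" "Y \<subseteq> X" by auto
    then have *: "S \<in> A" "finite S" "0 \<notin> S" "Y \<subseteq> A" using S[of S] XA by auto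
    then have "(\<Sum>S\<in>Y. econst (ecoeff f S) * emon S) \<in> espan A"
      by (intro espan_sum espan_econst_mult espan_emon) auto
    then have "P (econst (ecoeff f S) * emon S + (\<Sum>S\<in>Y. econst (ecoeff f S) * emon S))"
      using * insert by (intro add mon espan_econst_mult espan_emon) auto
    then show ?case using insert by simp
  qed
  then have "P (\<Sum>S\<in>X. econst (ecoeff f S) * emon S)" using fX by blast
  then show ?thesis by (subst eq)
qed

lemma espan_UNIV [simp]: "f \<in> espan UNIV"
  by (simp add: espan_def)

lemma emon_empty [simp]: "emon {} = 1"
  by (rule exterior_eqI) (simp add: ecoeff_emon ecoeff_one)

section \<open>Skew derivations and the grading involution\<close>

lemma ederiv_add [simp]: "ederiv j (f + g) = ederiv j f + ederiv j g"
  and ederiv_diff [simp]: "ederiv j (f - g) = ederiv j f - ederiv j g"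
  and ederiv_zero [simp]: "ederiv j 0 = 0"
  and ederiv_one [simp]: "ederiv j 1 = 0"
  and ederiv_econst_mult [simp]: "ederiv j (econst c * f) = econst c * ederiv j f"
  by (auto intro!: exterior_eqI simp: ecoeff_ederiv ecoeff_one algebra_simps)

lemma ebar_add [simp]: "ebar (f + g) = ebar f + ebar g"
  and ebar_zero [simp]: "ebar 0 = 0"
  and ebar_econst_mult [simp]: "ebar (econst c * f) = econst c * ebar f"
  by (auto intro!: exterior_eqI simp: ecoeff_ebar algebra_simps)

lemma ebar_odd:
  assumes "f \<in> espan {S. odd (card S)}"
  shows "ebar f = - f"
proof (rule exterior_eqI)
  fix S
  show "ecoeff (ebar f) S = ecoeff (- f) S"
    using assms by (cases "ecoeff f S = 0") (auto simp: ecoeff_ebar espan_def)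
qed

lemma Grassmann_ecoeff:
  "ecoeff u \<otimes>\<^bsub>Grassmann n\<^esub> ecoeff v = ecoeff (u * v)"
  "ecoeff u \<oplus>\<^bsub>Grassmann n\<^esub> ecoeff v = ecoeff (u + v)"
  "\<one>\<^bsub>Grassmann n\<^esub> = ecoeff 1"
  "\<zero>\<^bsub>Grassmann n\<^esub> = ecoeff 0"
  by (transfer, simp add: Grassmann_def)+

lemma scale_ecoeff: "scale c (ecoeff u) = ecoeff (econst c * u)"
  by (rule ext) (simp add: scale_def)

lemma skew_deriv_ecoeff: "skew_deriv j (ecoeff u) = ecoeff (ederiv j u)"
  by transfer simp

lemma xmon_ecoeff: "finite S \<Longrightarrow> 0 \<notin> S \<Longrightarrow> xmon S = ecoeff (emon S)"
  by transfer simp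

lemma emon_mult:
  assumes "finite A" "finite B" "0 \<notin> A" "0 \<notin> B"
  shows "emon A * emon B = (if A \<inter> B = {} then econst (inv_sign A B) * emon (A \<union> B) else 0 :: 'r::comm_ring_1 exterior)"
proof -
  have "ecoeff (emon A * emon B :: 'r exterior) =
    ecoeff (if A \<inter> B = {} then econst (inv_sign A B) * emon (A \<union> B) else 0)"
    using xmon_mult[OF assms(1,2), of 0, where 'r = 'r] assms
    by (auto simp: Grassmann_ecoeff scale_ecoeff xmon_ecoeff simp del: ecoeff_econst_mult)
  then show ?thesis by (simp only: ecoeff_inject)
qed

text \<open>On a monomial the sign (-1)^d of the homogeneous rule \<open>skew_deriv_mult\<close> is
  the effect of \<open>ebar\<close>; both sides are additive in f.\<close>

lemma ederiv_mult: "ederiv j (f * g) = ederiv j f * g + ebar f * ederiv j g"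
proof -
  have "f \<in> espan UNIV" by simp
  then show ?thesis
  proof (induction rule: espan_induct)
    case (mon S c)
    \<comment> \<open>The homogeneous rule is stated for a fixed rank; any n with S \<subseteq>
      {1..n} will do.\<close>
    define n where "n = Max (insert 0 S)"
    have n: "S \<subseteq> {1..n}" unfolding n_def by (rule subset_Max) (use mon in auto)
    have X: "xmon S \<in> degrees n (\<lambda>k. k = card S)"
      using n by (auto simp: degrees_def Grassmann_def xmon_def)
    have "ecoeff (ederiv j (emon S * g)) =
      ecoeff (ederiv j (emon S) * g + econst ((-1) ^ card S) * (emon S * ederiv j g))"
      using skew_deriv_mult[OF X, of j "ecoeff g"] xmon_ecoeff[OF mon(2,3), where 'a = 'a]
      by (simp only: Grassmann_ecoeff scale_ecoeff skew_deriv_ecoeff)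
    then have D: "ederiv j (emon S * g) =
      ederiv j (emon S) * g + econst ((-1) ^ card S) * (emon S * ederiv j g)"
      by (simp only: ecoeff_inject)
    have E: "ebar (emon S :: 'a exterior) = econst ((-1) ^ card S) * emon S"
      using mon by (intro exterior_eqI) (simp add: ecoeff_ebar ecoeff_emon)
    show ?case by (simp add: D E mult.assoc distrib_left)
  qed (simp_all add: algebra_simps)
qed

section \<open>Graded commutativity\<close>

lemma inv_sign_commute:
  assumes "finite A" "finite B" "A \<inter> B = {}"
  shows "inv_sign A B = ((-1) ^ (card A * card B) * inv_sign B A :: 'r::comm_ring_1)"
  using assms(1,3)
proof (induction A)
  case (insert j A)
  have "inv_sign (insert j A) B = (inv_sign {j} B * inv_sign A B :: 'r)"
    using inv_sign_Un(1)[of "{j}" A B, where 'r = 'r] insert assms(2) by simp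
  moreover have "inv_sign B (insert j A) = (inv_sign B {j} * inv_sign B A :: 'r)"
    using inv_sign_Un(2)[of B "{j}" A, where 'r = 'r] insert assms(2) by simp
  moreover have "inv_sign B {j} = ((-1) ^ card B * inv_sign {j} B :: 'r)"
    using inv_sign_swap[of B j, where 'r = 'r] insert assms(2) by simp
  ultimately show ?case using insert
    by (simp add: power_add mult_ac)
qed simp

lemma emon_commute:
  assumes "finite A" "finite B" "0 \<notin> A" "0 \<notin> B"
  shows "emon A * emon B = econst ((-1) ^ (card A * card B)) * (emon B * emon A)"
proof (cases "A \<inter> B = {}")
  case True
  then have "emon A * emon B = (econst (inv_sign A B) * emon (A \<union> B) :: 'a exterior)"
    using assms by (simp add: emon_mult)
  also have "\<dots> = econst ((-1) ^ (card A * card B)) * (econst (inv_sign B A) * emon (A \<union> B))"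
    by (subst inv_sign_commute[OF assms(1,2) True]) (simp add: econst_mult mult.assoc)
  also have "econst (inv_sign B A) * emon (A \<union> B) = (emon B * emon A :: 'a exterior)"
    using assms True by (simp add: emon_mult Int_commute Un_commute)
  finally show ?thesis .
qed (use assms in \<open>simp add: emon_mult Int_commute\<close>)

lemma even_commute:
  assumes "f \<in> espan {S. even (card S)}"
  shows "f * g = g * f"
  using assms
proof (induction rule: espan_induct)
  case (mon S c)
  have "g \<in> espan UNIV" by simp
  then show ?case
  proof (induction rule: espan_induct)
    case (mon T d)
    have "even (card S * card T)" using \<open>S \<in> {S. even (card S)}\<close> by simp
    then have "(-1 :: 'a) ^ (card S * card T) = 1" by (rule neg_one_even_power)
    then have "emon S * emon T = (emon T * emon S :: 'a exterior)"
      using emon_commute[of S T, where 'a = 'a] mon \<open>finite S\<close> \<open>0 \<notin> S\<close> by simp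
    then show ?case by (metis econst_mult_left_commute mult.assoc)
  qed (simp_all add: algebra_simps)
qed (simp_all add: algebra_simps)

text \<open>Moving an element of odd degree past a monomial of degree d costs the sign (-1)^d,
  whatever the odd degree is. This makes substitutions of odd elements multiplicative.\<close>

lemma odd_commute:
  assumes "f \<in> espan {S. odd (card S)}"
  shows "g * f = f * ebar g"
  using assms
proof (induction rule: espan_induct)
  case (mon S c)
  have "g \<in> espan UNIV" by simp
  then show ?case
  proof (induction rule: espan_induct)
    case (mon T d)
    have "odd (card S)" using \<open>S \<in> {S. odd (card S)}\<close> by simp
    then have "(-1 :: 'a) ^ (card T * card S) = (-1) ^ card T" by (simp add: uminus_power_if)
    then have "emon T * emon S = econst ((-1) ^ card T) * (emon S * emon T :: 'a exterior)"
      using emon_commute[of T S, where 'a = 'a] mon \<open>finite S\<close> \<open>0 \<notin> S\<close> by simp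
    moreover have "ebar (emon T :: 'a exterior) = econst ((-1) ^ card T) * emon T"
      using mon by (intro exterior_eqI) (simp add: ecoeff_ebar ecoeff_emon)
    ultimately show ?case
      by (metis ebar_econst_mult econst_mult_left_commute mult.assoc)
  qed (simp_all add: algebra_simps)
qed (simp_all add: algebra_simps)

text \<open>Anticommutation alone gives only f * f = - (f * f), which says little when 2 is a zero
  divisor. Hence the induction: the square of a monomial of odd degree repeats a variable and
  vanishes, and the mixed terms cancel in pairs.\<close>

lemma odd_square:
  assumes "f \<in> espan {S. odd (card S)}"
  shows "f * f = 0"
  using assms
proof (induction rule: espan_induct)
  case (mon S c)
  then have "S \<noteq> {}" by auto
  then have "emon S * emon S = (0 :: 'a exterior)" using mon by (simp add: emon_mult)
  then show ?case by (metis econst_mult_left_commute mult.assoc mult_zero_right)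
next
  case (add f g)
  then have "g * f = - (f * g)" by (simp add: odd_commute[of f g] ebar_odd)
  then show ?case using add by (simp add: algebra_simps)
qed simp

declare One_nat_def [simp del]

section \<open>Rank, parity and degree as conditions on the support\<close>

abbreviation Lam :: "nat \<Rightarrow> 'r::comm_ring_1 exterior set" where
  "Lam n \<equiv> espan (Pow {1..n})"

abbreviation evens :: "'r::comm_ring_1 exterior set" where
  "evens \<equiv> espan {S. even (card S)}"

abbreviation odds :: "'r::comm_ring_1 exterior set" where
  "odds \<equiv> espan {S. odd (card S)}"

abbreviation deg_ge :: "nat \<Rightarrow> 'r::comm_ring_1 exterior set" where
  "deg_ge d \<equiv> espan {S. d \<le> card S}"

text \<open>This is the intersection of \<Lambda>_n^od with the cube of the maximal ideal, the space
  in which an element of \<Gamma> may displace a generator.\<close>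

abbreviation pert :: "nat \<Rightarrow> 'r::comm_ring_1 exterior set" where
  "pert n \<equiv> espan {S. S \<subseteq> {1..n} \<and> odd (card S) \<and> 3 \<le> card S}"

lemma espan_Int: "f \<in> espan A \<Longrightarrow> f \<in> espan B \<Longrightarrow> f \<in> espan (A \<inter> B)"
  by (simp add: espan_def)

lemma espan_ederiv:
  assumes "f \<in> espan A"
    and "\<And>S. j \<notin> S \<Longrightarrow> finite S \<Longrightarrow> insert j S \<in> A \<Longrightarrow> S \<in> B"
  shows "ederiv j f \<in> espan B"
proof (rule espanI)
  fix S assume nz: "ecoeff (ederiv j f) S \<noteq> 0"
  then have "j \<notin> S" "ecoeff f (insert j S) \<noteq> 0" by (auto simp: ecoeff_ederiv split: if_splits)
  moreover have "finite S" using nz by (metis ecoeff_infinite)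
  ultimately show "S \<in> B" using assms by (simp add: espan_def)
qed

lemma espan_split:
  assumes "f \<in> espan A"
  shows "\<exists>g \<in> espan (A \<inter> B). f - g \<in> espan (A - B)"
  using assms
proof (induction rule: espan_induct)
  case zero
  then show ?case by (rule bexI[of _ 0]) simp_all
next
  case (mon S c)
  show ?case
  proof (cases "S \<in> B")
    case True
    then show ?thesis using mon
      by (intro bexI[of _ "econst c * emon S"] espan_econst_mult espan_emon) auto
  next
    case False
    have "econst c * emon S - 0 \<in> espan (A - B)"
      unfolding diff_zero by (intro espan_econst_mult espan_emon) (use mon False in auto)
    then show ?thesis by (intro bexI[of _ 0]) simp_all
  qed
next
  case (add f g)
  then obtain f' g' where *: "f' \<in> espan (A \<inter> B)" "f - f' \<in> espan (A - B)"
    "g' \<in> espan (A \<inter> B)" "g - g' \<in> espan (A - B)" by blast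
  have "f + g - (f' + g') = (f - f') + (g - g')" by simp
  then have "f + g - (f' + g') \<in> espan (A - B)" using espan_add[OF *(2,4)] by (simp only:)
  then show ?case using espan_add[OF *(1,3)] by blast
qed

lemma espan_disjoint: "f \<in> espan A \<Longrightarrow> f \<in> espan B \<Longrightarrow> A \<inter> B = {} \<Longrightarrow> f = 0"
  by (rule exterior_eqI) (auto simp: espan_def)

lemma Lam_mult [intro]: "f \<in> Lam n \<Longrightarrow> g \<in> Lam n \<Longrightarrow> f * g \<in> Lam n"
  by (erule espan_mult) auto

lemma Lam_one [simp, intro]: "1 \<in> Lam n"
  by (rule espan_one) simp

lemma Lam_emon [intro]: "S \<subseteq> {1..n} \<Longrightarrow> emon S \<in> Lam n"
  by (rule espan_emon) simp

lemma Lam_ederiv [intro]: "f \<in> Lam n \<Longrightarrow> ederiv j f \<in> Lam n"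
  by (erule espan_ederiv) simp

text \<open>A monomial in n variables has degree at most n. Every argument that improves something
  by raising the degree of an error term ends here.\<close>

lemma Lam_deg_gt: "f \<in> Lam n \<Longrightarrow> f \<in> deg_ge (Suc n) \<Longrightarrow> f = 0"
proof (erule espan_disjoint, assumption)
  have "card S \<le> n" if "S \<subseteq> {1..n}" for S using card_mono[OF _ that] by simp
  then show "Pow {1..n} \<inter> {S. Suc n \<le> card S} = {}"
    using not_less_eq_eq by auto
qed

lemma pert_iff: "f \<in> pert n \<longleftrightarrow> f \<in> Lam n \<and> f \<in> odds \<and> f \<in> deg_ge 3"
  by (auto simp: espan_def)

lemma deg_ge_0 [simp]: "f \<in> deg_ge 0"
  by (simp add: espan_def)

lemma deg_ge_mono: "f \<in> deg_ge d \<Longrightarrow> e \<le> d \<Longrightarrow> f \<in> deg_ge e"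
  by (erule espan_mono) auto

lemma deg_ge_mult: "f \<in> deg_ge d \<Longrightarrow> g \<in> deg_ge e \<Longrightarrow> f * g \<in> deg_ge (d + e)"
  by (erule espan_mult) (auto simp: card_Un_disjoint)

lemma evens_mult: "f \<in> evens \<Longrightarrow> g \<in> evens \<Longrightarrow> f * g \<in> evens"
  by (erule espan_mult) (auto simp: card_Un_disjoint)

lemma evens_one [simp]: "1 \<in> evens"
  by (rule espan_one) simp

lemma ederiv_odd: "f \<in> odds \<Longrightarrow> ederiv j f \<in> evens"
  by (erule espan_ederiv) simp

text \<open>A new smallest index put in front creates no inversion, so monomials can be built up
  from the left without signs; \<open>Lam_induct_mon\<close> packages this as an induction.\<close>

lemma emon_insert_min:
  assumes "finite S" "0 \<notin> S" "0 < b" "\<forall>a\<in>S. b < a"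
  shows "emon (insert b S) = emon {b} * emon S"
proof -
  have "{(a, c). a \<in> {b} \<and> c \<in> S \<and> c < a} = {}" using assms by auto
  then have "inv_sign {b} S = (1 :: 'a)" by (simp only: inv_sign_def card.empty power_0)
  moreover have "b \<notin> S" using assms(4) by auto
  ultimately show ?thesis using assms by (simp add: emon_mult)
qed

lemma Lam_induct_mon [consumes 2, case_names empty insert]:
  assumes "finite S" "S \<subseteq> {1..n}" "P {}"
    and "\<And>b S. finite S \<Longrightarrow> S \<subseteq> {1..n} \<Longrightarrow> b \<in> {1..n} \<Longrightarrow> b \<notin> S \<Longrightarrow> P S \<Longrightarrow>
      emon (insert b S) = (emon {b} * emon S :: 'r::comm_ring_1 exterior) \<Longrightarrow> P (insert b S)"
  shows "P S"
  using assms(1,2)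
proof (induction S rule: finite_linorder_min_induct)
  case empty
  show ?case by (rule assms(3))
next
  case (insert b S)
  then have "0 \<notin> S" "0 < b" "b \<in> {1..n}" "b \<notin> S" "S \<subseteq> {1..n}" by auto
  then show ?case using insert
    by (intro assms(4)) (auto intro: emon_insert_min)
qed

lemma ederiv_emon_single: "0 < i \<Longrightarrow> ederiv j (emon {i}) = (if i = j then 1 else 0)"
  by (rule exterior_eqI) (auto simp: ecoeff_ederiv ecoeff_emon ecoeff_one)

lemma ederiv_pert_Lam: "f \<in> pert n \<Longrightarrow> ederiv j f \<in> espan {S. S \<subseteq> {1..n} \<and> even (card S) \<and> 2 \<le> card S}"
  by (erule espan_ederiv) auto

section \<open>Unipotent automorphisms\<close>

text \<open>The defining conditions of \<Gamma> on the level of \<open>exterior\<close>, with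
  bijectivity replaced by its source, the unipotence expressed by \<open>gen\<close> (see
  \<open>bij\<close>). Only values on \<open>Lam n\<close> are constrained, so equality of two such
  maps is always meant on \<open>Lam n\<close>.\<close>

locale grass_aut =
  fixes n :: nat and s :: "'r::comm_ring_1 exterior \<Rightarrow> 'r exterior"
  assumes closed: "f \<in> Lam n \<Longrightarrow> s f \<in> Lam n"
    and hom_add: "f \<in> Lam n \<Longrightarrow> g \<in> Lam n \<Longrightarrow> s (f + g) = s f + s g"
    and hom_mult: "f \<in> Lam n \<Longrightarrow> g \<in> Lam n \<Longrightarrow> s (f * g) = s f * s g"
    and hom_one: "s 1 = 1"
    and hom_econst: "f \<in> Lam n \<Longrightarrow> s (econst c * f) = econst c * s f"
    and gen: "i \<in> {1..n} \<Longrightarrow> s (emon {i}) - emon {i} \<in> pert n"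
begin

lemma hom_zero: "s 0 = 0"
  using hom_econst[OF Lam_one, of 0] by simp

lemma hom_diff: "f \<in> Lam n \<Longrightarrow> g \<in> Lam n \<Longrightarrow> s (f - g) = s f - s g"
  using hom_add[of "f - g" g] by (simp add: espan_diff)

lemma hom_sum: "(\<And>x. x \<in> I \<Longrightarrow> f x \<in> Lam n) \<Longrightarrow> s (sum f I) = (\<Sum>x\<in>I. s (f x))"
  by (induction I rule: infinite_finite_induct) (auto simp: hom_zero hom_add espan_sum)

lemma gen_odd: "i \<in> {1..n} \<Longrightarrow> s (emon {i}) \<in> odds"
proof -
  assume i: "i \<in> {1..n}"
  have "s (emon {i}) - emon {i} \<in> odds" using gen[OF i] unfolding pert_iff by simp
  moreover have "emon {i} \<in> odds" by (rule espan_emon) simp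
  ultimately have "(s (emon {i}) - emon {i}) + emon {i} \<in> odds" by (rule espan_add)
  then show ?thesis by simp
qed

text \<open>Writing s(x_b) = x_b + r and s(x_S) = x_S + q, the product exceeds x_b x_S by x_b q + r
  x_S + r q. Since r is odd of degree at least 3, it replaces a factor of degree 1 by one of higher
  degree and equal parity.\<close>

lemma emon_filtration:
  assumes "finite S" "S \<subseteq> {1..n}"
  shows "s (emon S) - emon S \<in>
    espan {T. T \<subseteq> {1..n} \<and> (even (card T) \<longleftrightarrow> even (card S)) \<and> card S < card T}"
  using assms
proof (induction S rule: Lam_induct_mon[where 'r = 'r])
  case empty
  then show ?case by (simp add: hom_one)
next
  case (insert b S)
  let ?U = "\<lambda>S. espan {T. T \<subseteq> {1..n} \<and> (even (card T) \<longleftrightarrow> even (card S)) \<and> card S < card T}"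
  define r q where "r = s (emon {b}) - emon {b}" and "q = s (emon S) - emon S"
  have r: "r \<in> pert n" unfolding r_def by (rule gen) (rule insert)
  have q: "q \<in> ?U S" unfolding q_def by (rule insert)
  have b: "emon {b} \<in> espan {{b} :: nat set}" and m: "emon S \<in> espan {S}" by (simp_all add: espan_emon)
  have card: "card (insert b S) = Suc (card S)" using insert by simp
  have 1: "emon {b} * q \<in> ?U (insert b S)"
    by (rule espan_mult[OF b q]) (use insert card in auto)
  have 2: "r * emon S \<in> ?U (insert b S)"
    by (rule espan_mult[OF r m]) (use insert card in \<open>auto simp: card_Un_disjoint\<close>)
  have 3: "r * q \<in> ?U (insert b S)"
    by (rule espan_mult[OF r q]) (use insert card in \<open>auto simp: card_Un_disjoint\<close>)
  have "s (emon {b} * emon S) = s (emon {b}) * s (emon S)"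
    using insert by (intro hom_mult Lam_emon) auto
  then have "s (emon (insert b S)) - emon (insert b S) = emon {b} * q + r * emon S + r * q"
    by (simp add: insert.hyps(5) r_def q_def algebra_simps)
  then show ?case using espan_add[OF espan_add[OF 1 2] 3] by simp
qed

text \<open>Linear extension of \<open>emon_filtration\<close>. With A a degree bound it says that s
  is unipotent, with A a parity class that s respects the parity.\<close>

lemma filtration:
  assumes "f \<in> Lam n" "f \<in> espan A"
  shows "s f - f \<in> espan {T. T \<subseteq> {1..n} \<and>
    (\<exists>S\<in>A. (even (card T) \<longleftrightarrow> even (card S)) \<and> card S < card T)}" (is "_ \<in> ?B")
proof -
  let ?X = "Pow {1..n} \<inter> A"
  have f: "f = (\<Sum>S\<in>?X. econst (ecoeff f S) * emon S)"
    using assms by (intro espan_expand espan_Int) (auto dest: finite_subset)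
  have L: "econst c * emon S \<in> Lam n" if "S \<in> ?X" for S c
    using that by (intro espan_econst_mult Lam_emon) auto
  have "s f - f = (\<Sum>S\<in>?X. s (econst (ecoeff f S) * emon S)) - (\<Sum>S\<in>?X. econst (ecoeff f S) * emon S)"
    by (subst (1 2) f, subst hom_sum) (use L in auto)
  also have "\<dots> = (\<Sum>S\<in>?X. econst (ecoeff f S) * (s (emon S) - emon S))"
    unfolding sum_subtractf[symmetric] by (intro sum.cong) (auto simp: hom_econst Lam_emon right_diff_distrib)
  also have "\<dots> \<in> ?B"
  proof (intro espan_sum espan_econst_mult)
    fix S assume S: "S \<in> ?X"
    then have "finite S" "S \<subseteq> {1..n}" by (auto dest: finite_subset)
    from emon_filtration[OF this] show "s (emon S) - emon S \<in> ?B"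
      by (rule espan_mono) (use S in auto)
  qed
  finally show ?thesis .
qed

lemma deg_ge_diff:
  assumes "f \<in> Lam n" "f \<in> deg_ge d"
  shows "s f - f \<in> deg_ge (Suc d)"
  by (rule espan_mono[OF filtration[OF assms]]) auto

lemma parity_closed:
  assumes "f \<in> Lam n" "f \<in> espan {S. even (card S) = p}"
  shows "s f \<in> espan {S. even (card S) = p}"
proof -
  have "s f - f \<in> espan {S. even (card S) = p}"
    by (rule espan_mono[OF filtration[OF assms]]) auto
  from espan_add[OF this assms(2)] show ?thesis by simp
qed

lemma evens_closed: "f \<in> Lam n \<Longrightarrow> f \<in> evens \<Longrightarrow> s f \<in> evens"
  using parity_closed[of f True] by simp

lemma odds_closed: "f \<in> Lam n \<Longrightarrow> f \<in> odds \<Longrightarrow> s f \<in> odds"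
  using parity_closed[of f False] by simp

lemma deg_ge_closed:
  assumes "f \<in> Lam n" "f \<in> deg_ge d"
  shows "s f \<in> deg_ge d"
  using espan_add[OF deg_ge_mono[OF deg_ge_diff[OF assms], of d] assms(2)] by simp

lemma pert_closed: "f \<in> pert n \<Longrightarrow> s f \<in> pert n"
  unfolding pert_iff using closed odds_closed deg_ge_closed by blast

text \<open>In f = s f - (s f - f) the second term starts one degree later than f, so the degree
  bound of f climbs step by step until it reaches that of s f. Injectivity is the case of a bound
  above n.\<close>

lemma deg_ge_reflect:
  assumes f: "f \<in> Lam n" and sf: "s f \<in> deg_ge d"
  shows "f \<in> deg_ge d"
proof -
  have "e \<le> d \<Longrightarrow> f \<in> deg_ge e" for e
  proof (induction e)
    case (Suc e)
    then have "s f - (s f - f) \<in> deg_ge (Suc e)"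
      using f by (intro espan_diff deg_ge_diff deg_ge_mono[OF sf]) auto
    then show ?case by simp
  qed simp
  then show ?thesis by simp
qed

lemma kernel: "f \<in> Lam n \<Longrightarrow> s f = 0 \<Longrightarrow> f = 0"
  by (rule Lam_deg_gt[OF _ deg_ge_reflect]) auto

lemma injective: "f \<in> Lam n \<Longrightarrow> g \<in> Lam n \<Longrightarrow> s f = s g \<Longrightarrow> f = g"
  using kernel[of "f - g"] by (auto simp: hom_diff)

lemma odds_reflect:
  assumes f: "f \<in> Lam n" and sf: "s f \<in> odds"
  shows "f \<in> odds"
proof -
  obtain g where g: "g \<in> espan (Pow {1..n} \<inter> {S. even (card S)})"
    and fg: "f - g \<in> espan (Pow {1..n} - {S. even (card S)})"
    using espan_split[OF f] by blast
  have gL: "g \<in> Lam n" "f - g \<in> Lam n" and ge: "g \<in> evens" and fgo: "f - g \<in> odds"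
    by (rule espan_mono[OF g] espan_mono[OF fg]; auto)+
  \<comment> \<open>With g the even part of f, the element s g = s f - s (f - g) is odd as well as
    even, hence 0.\<close>
  have "s f - s (f - g) \<in> odds" by (intro espan_diff sf odds_closed gL fgo)
  then have "s g \<in> odds" using f gL by (simp add: hom_diff)
  then have "s g = 0" using evens_closed[OF gL(1) ge] by (auto intro: espan_disjoint)
  then have "g = 0" using kernel gL by blast
  then show ?thesis using fgo by simp
qed

lemma pert_reflect: "f \<in> Lam n \<Longrightarrow> s f \<in> pert n \<Longrightarrow> f \<in> pert n"
  unfolding pert_iff using odds_reflect deg_ge_reflect by blast

text \<open>Descending induction on the degree bound: if s g = s f - f, where the right side starts
  in higher degree, then s (f - g) = f.\<close>

lemma surjective:
  assumes "f \<in> Lam n"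
  shows "\<exists>g \<in> Lam n. s g = f"
proof -
  have "\<forall>f \<in> Lam n. f \<in> deg_ge (Suc n - k) \<longrightarrow> (\<exists>g \<in> Lam n. s g = f)" for k
  proof (induction k)
    case 0
    show ?case
    proof (intro ballI impI)
      fix f :: "'r exterior" assume f: "f \<in> Lam n" "f \<in> deg_ge (Suc n - 0)"
      then have "f = 0" using Lam_deg_gt by auto
      then show "\<exists>g \<in> Lam n. s g = f" by (intro bexI[of _ 0]) (auto simp: hom_zero)
    qed
  next
    case (Suc k)
    show ?case
    proof (intro ballI impI)
      fix f :: "'r exterior" assume f: "f \<in> Lam n" "f \<in> deg_ge (Suc n - Suc k)"
      have "s f - f \<in> deg_ge (Suc n - k)"
        by (rule deg_ge_mono[OF deg_ge_diff[OF f]]) simp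
      moreover have "s f - f \<in> Lam n" by (intro espan_diff closed f)
      ultimately obtain g where "g \<in> Lam n" "s g = s f - f" using Suc by blast
      then show "\<exists>g \<in> Lam n. s g = f" using f by (intro bexI[of _ "f - g"]) (simp_all add: hom_diff espan_diff)
    qed
  qed
  from this[of "Suc n"] assms show ?thesis by simp
qed

lemma bij: "bij_betw s (Lam n) (Lam n)"
  by (rule bij_betwI', blast intro: injective, erule closed, metis surjective)

text \<open>Both sides obey the same skew product rule when a generator is put in front of a
  monomial. For the right side this uses that the derivatives of s(x_k) are even and therefore move
  freely past s(x_b).\<close>

lemma ederiv_chain:
  assumes "f \<in> Lam n"
  shows "ederiv j (s f) = (\<Sum>k\<in>{1..n}. ederiv j (s (emon {k})) * s (ederiv k f))"
proof -
  have on_emon: "ederiv j (s (emon S)) = (\<Sum>k\<in>{1..n}. ederiv j (s (emon {k})) * s (ederiv k (emon S)))"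
    if "finite S" "S \<subseteq> {1..n}" for S
    using that
  proof (induction S rule: Lam_induct_mon[where 'r = 'r])
    case empty
    then show ?case by (simp add: hom_one hom_zero)
  next
    case (insert b S)
    have L: "(emon {b} :: 'r exterior) \<in> Lam n" "(emon S :: 'r exterior) \<in> Lam n"
      using insert by (auto intro: Lam_emon)
    have odd: "(emon {b} :: 'r exterior) \<in> odds" by (rule espan_emon) simp
    have D: "ederiv k (emon {b} * emon S :: 'r exterior) =
      (if b = k then emon S else 0) - emon {b} * ederiv k (emon S)" for k
      using insert by (simp add: ederiv_mult ebar_odd[OF odd] ederiv_emon_single)
    have sD: "s (ederiv k (emon {b} * emon S)) =
      (if b = k then s (emon S) else 0) - s (emon {b}) * s (ederiv k (emon S))" for k
      unfolding D using L
      by (subst hom_diff) (auto simp: hom_mult[OF L(1) Lam_ederiv[OF L(2)]] hom_zero)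
    have comm: "ederiv j (s (emon {k})) * (s (emon {b}) * x) =
        s (emon {b}) * (ederiv j (s (emon {k})) * x)" if k: "k \<in> {1..n}" for k x
      by (metis mult.assoc even_commute[OF ederiv_odd[OF gen_odd[OF k]]])
    have "(\<Sum>k\<in>{1..n}. ederiv j (s (emon {k})) * s (ederiv k (emon {b} * emon S))) =
      (\<Sum>k\<in>{1..n}. (if b = k then ederiv j (s (emon {b})) * s (emon S) else 0) -
        s (emon {b}) * (ederiv j (s (emon {k})) * s (ederiv k (emon S))))"
      by (intro sum.cong) (auto simp: sD right_diff_distrib comm)
    also have "\<dots> = ederiv j (s (emon {b})) * s (emon S) - s (emon {b}) * ederiv j (s (emon S))"
      unfolding insert.IH sum_subtractf sum_distrib_left[symmetric] using insert by simp
    also have "\<dots> = ederiv j (s (emon {b}) * s (emon S))"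
      using insert by (simp add: ederiv_mult ebar_odd[OF gen_odd])
    finally show ?case unfolding insert.hyps(5) using L by (simp add: hom_mult)
  qed
  from assms show ?thesis
  proof (induction rule: espan_induct)
    case zero
    then show ?case by (simp add: hom_zero)
  next
    case (mon S c)
    then have "(emon S :: 'r exterior) \<in> Lam n" by (auto intro: Lam_emon)
    then show ?case using mon(1,2) on_emon[of S]
      by (auto simp: hom_econst Lam_ederiv sum_distrib_left econst_mult_left_commute intro!: sum.cong)
  next
    case (add f g)
    then show ?case by (simp add: hom_add Lam_ederiv distrib_left sum.distrib)
  qed
qed

end

section \<open>Comparing, composing, inverting and constructing automorphisms\<close>

lemma grass_aut_eqI:
  assumes s: "grass_aut n s" and t: "grass_aut n t"
    and eq: "\<And>i. i \<in> {1..n} \<Longrightarrow> s (emon {i}) = t (emon {i})" and f: "f \<in> Lam n"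
  shows "s f = (t f :: 'r::comm_ring_1 exterior)"
proof -
  have on_emon: "s (emon S) = t (emon S)" if "finite S" "S \<subseteq> {1..n}" for S
    using that
  proof (induction S rule: Lam_induct_mon[where 'r = 'r])
    case empty
    then show ?case by (simp add: grass_aut.hom_one[OF s] grass_aut.hom_one[OF t])
  next
    case (insert b S)
    then have "(emon {b} :: 'r exterior) \<in> Lam n" "(emon S :: 'r exterior) \<in> Lam n"
      by (auto intro: Lam_emon)
    then show ?case using insert
      by (simp add: grass_aut.hom_mult[OF s] grass_aut.hom_mult[OF t] eq)
  qed
  from f show ?thesis
  proof (induction rule: espan_induct)
    case zero
    then show ?case by (simp add: grass_aut.hom_zero[OF s] grass_aut.hom_zero[OF t])
  next
    case (mon S c)
    then have "(emon S :: 'r exterior) \<in> Lam n" by (auto intro: Lam_emon)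
    then show ?case using mon(1,2) on_emon[of S]
      by (simp add: grass_aut.hom_econst[OF s] grass_aut.hom_econst[OF t])
  next
    case (add f g)
    then show ?case by (simp add: grass_aut.hom_add[OF s] grass_aut.hom_add[OF t])
  qed
qed

lemma grass_aut_id: "grass_aut n (\<lambda>f. f)"
  by unfold_locales simp_all

lemma grass_aut_comp:
  assumes "grass_aut n s" "grass_aut n t"
  shows "grass_aut n (\<lambda>f. s (t f))"
proof -
  interpret s: grass_aut n s by fact
  interpret t: grass_aut n t by fact
  show ?thesis
  proof
    fix i assume i: "i \<in> {1..n}"
    have L: "(emon {i} :: 'a exterior) \<in> Lam n" using i by (auto intro: Lam_emon)
    have "s (t (emon {i}) - emon {i}) + (s (emon {i}) - emon {i}) \<in> pert n"
      by (intro espan_add s.pert_closed t.gen s.gen i)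
    then show "s (t (emon {i})) - emon {i} \<in> pert n" by (simp add: s.hom_diff t.closed L)
  qed (auto simp: s.closed t.closed s.hom_add t.hom_add s.hom_mult t.hom_mult s.hom_one t.hom_one s.hom_econst t.hom_econst)
qed

lemma grass_aut_inverse:
  assumes "grass_aut n s"
  obtains t where "grass_aut n t" "\<And>f. f \<in> Lam n \<Longrightarrow> s (t f) = f" "\<And>f. f \<in> Lam n \<Longrightarrow> t (s f) = f"
proof -
  interpret s: grass_aut n s by fact
  define t where "t = inv_into (Lam n) s"
  have st: "s (t f) = f" and tL: "t f \<in> Lam n" if "f \<in> Lam n" for f
    unfolding t_def using bij_betw_inv_into_right[OF s.bij that]
      bij_betwE[OF bij_betw_inv_into[OF s.bij]] that by auto
  have ts: "t (s f) = f" if "f \<in> Lam n" for f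
    unfolding t_def by (rule bij_betw_inv_into_left[OF s.bij that])
  have eq: "t f = g" if "g \<in> Lam n" "f = s g" for f g using ts that by simp
  have "grass_aut n t"
  proof
    fix i assume i: "i \<in> {1..n}"
    have L: "(emon {i} :: 'a exterior) \<in> Lam n" by (rule Lam_emon) (use i in simp)
    \<comment> \<open>Applying s to t(x_i) - x_i gives x_i - s(x_i), which lies in
      \<open>pert n\<close>; and s reflects membership in \<open>pert n\<close>.\<close>
    have "- (s (emon {i}) - emon {i}) \<in> pert n" by (intro espan_uminus s.gen i)
    then have "s (t (emon {i})) - s (emon {i}) \<in> pert n" unfolding st[OF L] by simp
    then have "s (t (emon {i}) - emon {i}) \<in> pert n" unfolding s.hom_diff[OF tL[OF L] L] .
    then show "t (emon {i}) - emon {i} \<in> pert n" by (rule s.pert_reflect[OF espan_diff[OF tL[OF L] L]])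
  next
    fix f g :: "'a exterior" assume f: "f \<in> Lam n" and g: "g \<in> Lam n"
    show "t (f + g) = t f + t g" by (rule eq) (simp_all add: f g tL st s.hom_add espan_add)
    show "t (f * g) = t f * t g" by (rule eq) (simp_all add: f g tL st s.hom_mult Lam_mult)
  next
    fix f c assume f: "(f :: 'a exterior) \<in> Lam n"
    show "t (econst c * f) = econst c * t f"
      by (rule eq) (simp_all add: f tL st s.hom_econst espan_econst_mult)
  next
    show "t 1 = 1" by (rule eq) (simp_all add: s.hom_one)
  qed (rule tL)
  then show thesis using that st ts by blast
qed

text \<open>The substitution x_k -> x_k + a. As x_k occurs at most linearly in f, the Taylor
  expansion stops after the first derivative, and the formula is exact even if a itself involves
  x_k.\<close>

definition elem_aut :: "nat \<Rightarrow> 'r::comm_ring_1 exterior \<Rightarrow> 'r exterior \<Rightarrow> 'r exterior" where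
  "elem_aut k a f = f + a * ederiv k f"

lemma elem_aut_emon: "0 < i \<Longrightarrow> elem_aut k a (emon {i}) = emon {i} + (if i = k then a else 0)"
  by (simp add: elem_aut_def ederiv_emon_single)

text \<open>In the product of the two expansions, oddness of a turns f * (a * \<partial>g) into the
  second Leibniz term, and the term with two factors a vanishes because a * a = 0.\<close>

lemma grass_aut_elem:
  assumes a: "a \<in> pert n"
  shows "grass_aut n (elem_aut k a)"
proof
  have odd: "a \<in> odds" and aL: "a \<in> Lam n" using a by (simp_all add: pert_iff)
  fix f g :: "'a exterior"
  show "elem_aut k a (f * g) = elem_aut k a f * elem_aut k a g"
  proof -
    have 1: "f * (a * ederiv k g) = a * (ebar f * ederiv k g)"
      by (metis mult.assoc odd_commute[OF odd])
    have "a * ederiv k f * (a * ederiv k g) = a * a * ebar (ederiv k f) * ederiv k g"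
      by (metis mult.assoc odd_commute[OF odd])
    then have 2: "a * ederiv k f * (a * ederiv k g) = 0" by (simp add: odd_square[OF odd])
    have "elem_aut k a f * elem_aut k a g =
      f * g + f * (a * ederiv k g) + a * ederiv k f * g + a * ederiv k f * (a * ederiv k g)"
      by (simp add: elem_aut_def algebra_simps)
    then show ?thesis unfolding 1 2 by (simp add: elem_aut_def ederiv_mult algebra_simps)
  qed
  show "elem_aut k a f \<in> Lam n" if "f \<in> Lam n" unfolding elem_aut_def
    using that aL by auto
  show "elem_aut k a (econst c * f) = econst c * elem_aut k a f" for c
    by (simp add: elem_aut_def distrib_left econst_mult_left_commute)
next
  fix i assume "i \<in> {1..n}"
  then show "elem_aut k a (emon {i}) - emon {i} \<in> pert n" using a by (simp add: elem_aut_emon)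
qed (simp_all add: elem_aut_def algebra_simps)

text \<open>Change the images of the generators one at a time; each change is made by
  precomposing with an elementary automorphism.\<close>

lemma grass_aut_build:
  fixes y :: "nat \<Rightarrow> 'r::comm_ring_1 exterior"
  assumes y: "\<And>i. i \<in> {1..n} \<Longrightarrow> y i \<in> pert n"
    and "P (\<lambda>f. f)"
    and comp: "\<And>s k a. grass_aut n s \<Longrightarrow> P s \<Longrightarrow> k \<in> {1..n} \<Longrightarrow> a \<in> pert n \<Longrightarrow> P (\<lambda>f. s (elem_aut k a f))"
  shows "\<exists>s. grass_aut n s \<and> P s \<and> (\<forall>i \<in> {1..n}. s (emon {i}) = emon {i} + y i)"
proof -
  have "k \<le> n \<Longrightarrow> \<exists>s. grass_aut n s \<and> P s \<and>
      (\<forall>i \<in> {1..n}. s (emon {i}) = emon {i} + (if i \<le> k then y i else 0))" for k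
  proof (induction k)
    case 0
    show ?case using assms(2) by (intro exI[of _ "\<lambda>f. f"]) (simp add: grass_aut_id)
  next
    case (Suc k)
    then obtain s where s: "grass_aut n s" "P s"
      and si: "\<And>i. i \<in> {1..n} \<Longrightarrow> s (emon {i}) = emon {i} + (if i \<le> k then y i else 0)" by auto
    interpret s: grass_aut n s by (rule s)
    have k: "Suc k \<in> {1..n}" using Suc by simp
    have yk: "y (Suc k) \<in> Lam n" using y[OF k] by (simp add: pert_iff)
    \<comment> \<open>The elementary automorphism acts before s, so the wanted displacement is
      pulled back along s. At this stage s still fixes the generator with index
      \<open>Suc k\<close>.\<close>
    obtain a where aL: "a \<in> Lam n" and sa: "s a = y (Suc k)" using s.surjective[OF yk] by blast
    have a: "a \<in> pert n" using s.pert_reflect[OF aL] y[OF k] by (simp add: sa)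
    show ?case
    proof (intro exI[of _ "\<lambda>f. s (elem_aut (Suc k) a f)"] conjI ballI)
      show "grass_aut n (\<lambda>f. s (elem_aut (Suc k) a f))"
        by (rule grass_aut_comp[OF s(1) grass_aut_elem[OF a]])
      show "P (\<lambda>f. s (elem_aut (Suc k) a f))" by (rule comp[OF s k a])
      fix i assume i: "i \<in> {1..n}"
      then have "(emon {i} :: 'r exterior) \<in> Lam n" by (auto intro: Lam_emon)
      then show "s (elem_aut (Suc k) a (emon {i})) = emon {i} + (if i \<le> Suc k then y i else 0)"
        using i si[OF i] by (cases "i = Suc k") (auto simp: elem_aut_emon s.hom_add aL sa)
    qed
  qed
  from this[of n] show ?thesis by auto
qed

lemma grass_aut_exists:
  assumes "\<And>i. i \<in> {1..n} \<Longrightarrow> y i \<in> pert n"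
  shows "\<exists>s. grass_aut n s \<and> (\<forall>i \<in> {1..n}. s (emon {i}) = emon {i} + y i)"
  using grass_aut_build[of n y "\<lambda>s. True", OF assms] by blast

text \<open>The construction \<open>grass_aut_build\<close>, applied to the displacements of s
  itself, shows that s agrees on \<open>Lam n\<close> with a composite of elementary automorphisms.
  The case \<open>cong\<close> accounts for the arbitrary values elsewhere.\<close>

lemma grass_aut_induct [consumes 1, case_names cong id elem]:
  assumes s: "grass_aut n s"
    and cong: "\<And>s t. grass_aut n s \<Longrightarrow> (\<And>f. f \<in> Lam n \<Longrightarrow> s f = t f) \<Longrightarrow> P s \<Longrightarrow> P t"
    and id: "P (\<lambda>f. f)"
    and elem: "\<And>s k a. grass_aut n s \<Longrightarrow> P s \<Longrightarrow> k \<in> {1..n} \<Longrightarrow> a \<in> pert n \<Longrightarrow> P (\<lambda>f. s (elem_aut k a f))"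
  shows "P s"
proof -
  obtain t where t: "grass_aut n t" "P t" "\<forall>i \<in> {1..n}. t (emon {i}) = emon {i} + (s (emon {i}) - emon {i})"
    using grass_aut_build[of n "\<lambda>i. s (emon {i}) - emon {i}" P] grass_aut.gen[OF s] id elem by blast
  have "t f = s f" if "f \<in> Lam n" for f
    by (rule grass_aut_eqI[OF t(1) s _ that]) (use t(3) in simp)
  then show ?thesis using cong[OF t(1) _ t(2)] by blast
qed

section \<open>Determinants with even entries\<close>

text \<open>The even elements commute with everything. As a type of class \<open>comm_ring_1\<close>
  they admit the determinants of the matrix library, in particular multiplicativity.\<close>

typedef (overloaded) 'r even_exterior = "{f :: 'r::comm_ring_1 exterior. f \<in> evens}"
  morphisms even_val Even
  by (rule exI[of _ 0]) simp

setup_lifting type_definition_even_exterior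

instantiation even_exterior :: (comm_ring_1) comm_ring_1
begin

lift_definition zero_even_exterior :: "'a even_exterior" is 0 by simp
lift_definition one_even_exterior :: "'a even_exterior" is 1 by simp
lift_definition plus_even_exterior :: "'a even_exterior \<Rightarrow> 'a even_exterior \<Rightarrow> 'a even_exterior"
  is "(+)" by (rule espan_add)
lift_definition minus_even_exterior :: "'a even_exterior \<Rightarrow> 'a even_exterior \<Rightarrow> 'a even_exterior"
  is "(-)" by (rule espan_diff)
lift_definition uminus_even_exterior :: "'a even_exterior \<Rightarrow> 'a even_exterior"
  is uminus by (rule espan_uminus)
lift_definition times_even_exterior :: "'a even_exterior \<Rightarrow> 'a even_exterior \<Rightarrow> 'a even_exterior"
  is "(*)" by (rule evens_mult)

instance
proof
  fix a b c :: "'a even_exterior"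
  show "a * b * c = a * (b * c)" by transfer (rule mult.assoc)
  show "a * b = b * a" by transfer (rule even_commute)
  show "1 * a = a" by transfer simp
  show "a + b + c = a + (b + c)" by transfer (rule add.assoc)
  show "a + b = b + a" by transfer (rule add.commute)
  show "0 + a = a" by transfer simp
  show "- a + a = 0" by transfer simp
  show "a - b = a + - b" by transfer simp
  show "(a + b) * c = a * c + b * c" by transfer (rule distrib_right)
  show "(0 :: 'a even_exterior) \<noteq> 1" by transfer simp
qed

end

lemma even_val_sum: "even_val (sum f A) = (\<Sum>x\<in>A. even_val (f x))"
  by (induction A rule: infinite_finite_induct) (simp_all add: zero_even_exterior.rep_eq plus_even_exterior.rep_eq)

lemma even_val_sign_mult: "even_val (of_int (sign p) * x) = of_int (sign p) * even_val x"
  by (simp add: sign_def uminus_even_exterior.rep_eq)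

lemma set_upt_from_1: "set [1..<n+1] = {1..n}"
  by auto

text \<open>The Leibniz formula with the factors ordered as in \<open>jacobian\<close>, meaningful
  without commutativity. For even entries it is an ordinary determinant, by
  \<open>ext_det_bordered\<close>.\<close>

definition ext_det :: "nat \<Rightarrow> (nat \<Rightarrow> nat \<Rightarrow> 'r::comm_ring_1 exterior) \<Rightarrow> 'r exterior" where
  "ext_det n m = (\<Sum>p | p permutes {1..n}. of_int (sign p) * prod_list (map (\<lambda>i. m i (p i)) [1..<n+1]))"

text \<open>The additional row and column with index \<open>0\<close> reconcile the index range \<open>{1..n}\<close>
  with the range \<open>{0..<n+1}\<close> of the matrix library.\<close>

definition bordered :: "nat \<Rightarrow> (nat \<Rightarrow> nat \<Rightarrow> 'r::comm_ring_1 exterior) \<Rightarrow> 'r even_exterior mat" where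
  "bordered n m = mat (n + 1) (n + 1)
     (\<lambda>(i, j). if i = 0 \<or> j = 0 then (if i = j then 1 else 0) else Even (m i j))"

lemma ext_det_bordered:
  assumes even: "\<And>i j. i \<in> {1..n} \<Longrightarrow> j \<in> {1..n} \<Longrightarrow> m i j \<in> evens"
  shows "ext_det n m = even_val (det (bordered n m))"
proof -
  let ?B = "\<lambda>i j. bordered n m $$ (i, j)"
  have range: "{0..<n+1} = insert 0 {1..n}" by auto
  have "det (bordered n m) = (\<Sum>p | p permutes {0..<n+1}. signof p * (\<Prod>i = 0..<n+1. ?B i (p i)))"
    by (rule det_def') (simp add: bordered_def)
  also have "\<dots> = (\<Sum>p | p permutes {1..n}. signof p * (\<Prod>i = 0..<n+1. ?B i (p i)))"
  proof (rule sum.mono_neutral_right)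
    show "finite {p. p permutes {0..<n+1}}" by (rule finite_permutations) simp
    show "{p. p permutes {1..n}} \<subseteq> {p. p permutes {0..<n+1}}"
      by (auto intro: permutes_subset)
    show "\<forall>p \<in> {p. p permutes {0..<n+1}} - {p. p permutes {1..n}}.
      signof p * (\<Prod>i = 0..<n+1. ?B i (p i)) = 0"
    proof
      fix p assume p: "p \<in> {p. p permutes {0..<n+1}} - {p. p permutes {1..n}}"
      \<comment> \<open>A permutation that fixes 0 already permutes {1..n}; one that moves 0 picks
        an off-diagonal entry of the border, which is 0.\<close>
      have "p 0 \<noteq> 0"
      proof
        assume 0: "p 0 = 0"
        have "p permutes {1..n}"
        proof (rule permutes_superset[of p "{0..<n+1}"])
          show "p permutes {0..<n+1}" using p by simp
          fix x assume "x \<in> {0..<n+1} - {1..n}"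
          then have "x = 0" by auto
          then show "p x = x" using 0 by simp
        qed
        then show False using p by simp
      qed
      moreover have "p 0 < n + 1" using p permutes_in_image[of p "{0..<n+1}" 0] by simp
      ultimately have "?B 0 (p 0) = 0" by (simp add: bordered_def)
      then have "(\<Prod>i = 0..<n+1. ?B i (p i)) = 0" by (intro prod_zero bexI[of _ 0]) simp_all
      then show "signof p * (\<Prod>i = 0..<n+1. ?B i (p i)) = 0" by simp
    qed
  qed
  finally have D: "even_val (det (bordered n m)) =
    (\<Sum>p | p permutes {1..n}. of_int (sign p) * even_val (\<Prod>i = 0..<n+1. ?B i (p i)))"
    by (simp add: even_val_sum even_val_sign_mult)
  have P: "even_val (\<Prod>i = 0..<n+1. ?B i (p i)) = prod_list (map (\<lambda>i. m i (p i)) [1..<n+1])"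
    if p: "p permutes {1..n}" for p :: "nat \<Rightarrow> nat"
  proof -
    have "p 0 = 0" using permutes_not_in[OF p, of 0] by simp
    then have "?B 0 (p 0) = 1" by (simp add: bordered_def)
    moreover have "(\<Prod>i = 0..<n+1. ?B i (p i)) = ?B 0 (p 0) * (\<Prod>i\<in>{1..n}. ?B i (p i))"
      unfolding range by (rule prod.insert) auto
    moreover have "(\<Prod>i\<in>{1..n}. ?B i (p i)) = (\<Prod>i\<leftarrow>[1..<n+1]. ?B i (p i))"
      by (subst prod.distinct_set_conv_list[symmetric]) (simp_all only: distinct_upt set_upt_from_1)
    moreover have "even_val (\<Prod>i\<leftarrow>xs. ?B i (p i)) = prod_list (map (\<lambda>i. m i (p i)) xs)"
      if "set xs \<subseteq> {1..n}" for xs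
      using that
    proof (induction xs)
      case (Cons i xs)
      then have i: "i \<in> {1..n}" "p i \<in> {1..n}" using permutes_in_image[OF p] by auto
      then have "?B i (p i) = Even (m i (p i))" by (auto simp: bordered_def)
      then have "even_val (?B i (p i)) = m i (p i)" using even[OF i] by (simp add: Even_inverse)
      then show ?case using Cons by (simp add: times_even_exterior.rep_eq)
    qed (simp add: one_even_exterior.rep_eq)
    moreover have "set [1..<n+1] \<subseteq> {1..n}" by (simp only: set_upt_from_1 order_refl)
    ultimately show ?thesis by (simp only: mult_1_left)
  qed
  show ?thesis unfolding D ext_det_def by (intro sum.cong refl) (simp only: mem_Collect_eq P)
qed

text \<open>Bordering turns a matrix m into the block diagonal matrix diag(1, m), hence respects
  products, and \<open>det_mult\<close> applies over the commutative ring of even elements.\<close>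

lemma ext_det_mult:
  assumes a: "\<And>i j. i \<in> {1..n} \<Longrightarrow> j \<in> {1..n} \<Longrightarrow> a i j \<in> evens"
    and b: "\<And>i j. i \<in> {1..n} \<Longrightarrow> j \<in> {1..n} \<Longrightarrow> b i j \<in> evens"
  shows "ext_det n (\<lambda>i j. \<Sum>k\<in>{1..n}. a i k * b k j) = ext_det n a * ext_det n b"
proof -
  have car: "bordered n a \<in> carrier_mat (n + 1) (n + 1)" "bordered n b \<in> carrier_mat (n + 1) (n + 1)"
    by (simp_all add: bordered_def)
  have range: "{0..<n + 1} = insert 0 {1..n}" by auto
  have "bordered n (\<lambda>i j. \<Sum>k\<in>{1..n}. a i k * b k j) = bordered n a * bordered n b"
  proof (rule eq_matI)
    fix i j assume "i < dim_row (bordered n a * bordered n b)" "j < dim_col (bordered n a * bordered n b)"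
    then have ij: "i < n + 1" "j < n + 1" by (simp_all add: bordered_def)
    have "(bordered n a * bordered n b) $$ (i, j) =
      (\<Sum>k\<in>insert 0 {1..n}. bordered n a $$ (i, k) * bordered n b $$ (k, j))"
      using ij car by (simp add: scalar_prod_def range)
    also have "\<dots> = bordered n a $$ (i, 0) * bordered n b $$ (0, j) +
      (\<Sum>k\<in>{1..n}. bordered n a $$ (i, k) * bordered n b $$ (k, j))"
      by (rule sum.insert) auto
    also have "\<dots> = bordered n (\<lambda>i j. \<Sum>k\<in>{1..n}. a i k * b k j) $$ (i, j)"
    proof (cases "i = 0 \<or> j = 0")
      case True
      then have "(\<Sum>k\<in>{1..n}. bordered n a $$ (i, k) * bordered n b $$ (k, j)) = 0"
        using ij by (intro sum.neutral) (auto simp: bordered_def)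
      then show ?thesis using True ij by (auto simp: bordered_def)
    next
      case False
      then have ij': "i \<in> {1..n}" "j \<in> {1..n}" using ij by auto
      have "even_val (\<Sum>k\<in>{1..n}. bordered n a $$ (i, k) * bordered n b $$ (k, j)) =
        (\<Sum>k\<in>{1..n}. a i k * b k j)"
        unfolding even_val_sum
      proof (rule sum.cong)
        fix k assume k: "k \<in> {1..n}"
        then show "even_val (bordered n a $$ (i, k) * bordered n b $$ (k, j)) = a i k * b k j"
          using ij False a[OF ij'(1) k] b[OF k ij'(2)]
          by (simp add: bordered_def times_even_exterior.rep_eq Even_inverse)
      qed simp
      then have "(\<Sum>k\<in>{1..n}. bordered n a $$ (i, k) * bordered n b $$ (k, j)) =
        Even (\<Sum>k\<in>{1..n}. a i k * b k j)"
        by (metis even_val_inverse)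
      then show ?thesis using False ij by (simp add: bordered_def)
    qed
    finally show "bordered n (\<lambda>i j. \<Sum>k\<in>{1..n}. a i k * b k j) $$ (i, j) =
      (bordered n a * bordered n b) $$ (i, j)" ..
  qed (simp_all add: bordered_def)
  then have "det (bordered n (\<lambda>i j. \<Sum>k\<in>{1..n}. a i k * b k j)) =
    det (bordered n a) * det (bordered n b)"
    using det_mult[OF car] by simp
  moreover have "ext_det n (\<lambda>i j. \<Sum>k\<in>{1..n}. a i k * b k j) =
      even_val (det (bordered n (\<lambda>i j. \<Sum>k\<in>{1..n}. a i k * b k j)))"
    by (rule ext_det_bordered) (intro espan_sum evens_mult a b)
  moreover have "ext_det n a = even_val (det (bordered n a))"
    by (rule ext_det_bordered) (rule a)
  moreover have "ext_det n b = even_val (det (bordered n b))"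
    by (rule ext_det_bordered) (rule b)
  ultimately show ?thesis by (simp only: times_even_exterior.rep_eq)
qed

lemma ext_det_cong:
  assumes "\<And>i j. i \<in> {1..n} \<Longrightarrow> j \<in> {1..n} \<Longrightarrow> a i j = b i j"
  shows "ext_det n a = ext_det n b"
  unfolding ext_det_def
proof (intro sum.cong refl arg_cong2[of _ _ _ _ "(*)"] arg_cong[of _ _ prod_list] map_cong)
  fix p i assume "p \<in> {p. p permutes {1..n}}" "i \<in> set [1..<n+1]"
  then show "a i (p i) = b i (p i)" using permutes_in_image[of p "{1..n}" i] by (intro assms) auto
qed

lemma of_int_sign_mult: "of_int (sign p) * f = econst (of_int (sign p)) * f"
  by (rule exterior_eqI) (simp add: sign_def)

lemma ext_det_espan:
  assumes m: "\<And>i j. i \<in> {1..n} \<Longrightarrow> j \<in> {1..n} \<Longrightarrow> m i j \<in> espan A"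
    and "{} \<in> A"
    and AA: "\<And>S T. S \<in> A \<Longrightarrow> T \<in> A \<Longrightarrow> finite S \<Longrightarrow> finite T \<Longrightarrow> S \<inter> T = {} \<Longrightarrow> S \<union> T \<in> A"
  shows "ext_det n m \<in> espan A"
  unfolding ext_det_def of_int_sign_mult
proof (intro espan_sum espan_econst_mult)
  fix p assume p: "p \<in> {p. p permutes {1..n}}"
  have "set xs \<subseteq> {1..n} \<Longrightarrow> prod_list (map (\<lambda>i. m i (p i)) xs) \<in> espan A" for xs
  proof (induction xs)
    case (Cons i xs)
    then have "m i (p i) \<in> espan A" using p permutes_in_image[of p "{1..n}" i] by (intro m) auto
    then show ?case using Cons AA by (auto intro!: espan_mult[of _ A _ A])
  qed (simp add: espan_one assms(2))
  then show "prod_list (map (\<lambda>i. m i (p i)) [1..<n+1]) \<in> espan A"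
    by (simp only: set_upt_from_1 order_refl)
qed

text \<open>The expansion det(1 + N) = 1 + tr N + (second order). The identity permutation gives the
  product of the diagonal; any other permutation moves some i and also p i, and so contributes at
  least two factors of degree at least d.\<close>

lemma ext_det_near_one:
  assumes m: "\<And>i j. i \<in> {1..n} \<Longrightarrow> j \<in> {1..n} \<Longrightarrow> m i j - (if i = j then 1 else 0) \<in> deg_ge d"
  shows "ext_det n m - (1 + (\<Sum>i\<in>{1..n}. m i i - 1)) \<in> deg_ge (2 * d)"
proof -
  let ?t = "\<lambda>p. of_int (sign p) * prod_list (map (\<lambda>i. m i (p i)) [1..<n+1])"
  have "prod_list (map (\<lambda>i. m i i) xs) - (1 + sum_list (map (\<lambda>i. m i i - 1) xs)) \<in> deg_ge (2 * d) \<and>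
    sum_list (map (\<lambda>i. m i i - 1) xs) \<in> deg_ge d" if "set xs \<subseteq> {1..n}" for xs
    using that
  proof (induction xs)
    case (Cons i xs)
    define r T E where "r = m i i - 1" and "T = sum_list (map (\<lambda>i. m i i - 1) xs)"
      and "E = prod_list (map (\<lambda>i. m i i) xs) - (1 + T)"
    have r: "r \<in> deg_ge d" using Cons m[of i i] by (simp add: r_def)
    have T: "T \<in> deg_ge d" and E: "E \<in> deg_ge (2 * d)" using Cons by (simp_all add: T_def E_def)
    have mi: "m i i = 1 + r" and Q: "prod_list (map (\<lambda>i. m i i) xs) = 1 + T + E"
      by (simp_all add: r_def E_def)
    have sum: "sum_list (map (\<lambda>i. m i i - 1) (i # xs)) = r + T" by (simp add: r_def T_def)
    have prod: "prod_list (map (\<lambda>i. m i i) (i # xs)) = (1 + r) * (1 + T + E)"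
      unfolding list.map prod_list.Cons Q mi ..
    have "r * T \<in> deg_ge (2 * d)" "r * E \<in> deg_ge (2 * d)"
      using deg_ge_mult[OF r T] deg_ge_mono[OF deg_ge_mult[OF r E], of "2 * d"] by (simp_all add: mult_2)
    then have "E + r * T + r * E \<in> deg_ge (2 * d)" using E by (intro espan_add)
    moreover have "(1 + r) * (1 + T + E) - (1 + (r + T)) = E + r * T + r * E"
      by (simp add: algebra_simps)
    ultimately show ?case unfolding sum prod using espan_add[OF r T] by (simp only: simp_thms)
  qed simp
  from this[of "[1..<n+1]"] have "prod_list (map (\<lambda>i. m i i) [1..<n+1]) -
    (1 + sum_list (map (\<lambda>i. m i i - 1) [1..<n+1])) \<in> deg_ge (2 * d)"
    by (simp only: set_upt_from_1 order_refl)
  also have "sum_list (map (\<lambda>i. m i i - 1) [1..<n+1]) = (\<Sum>i\<in>{1..n}. m i i - 1)"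
    by (subst sum.distinct_set_conv_list[symmetric]) (simp_all only: distinct_upt set_upt_from_1)
  finally have id: "?t id - (1 + (\<Sum>i\<in>{1..n}. m i i - 1)) \<in> deg_ge (2 * d)" by simp
  have other: "?t p \<in> deg_ge (2 * d)" if p: "p permutes {1..n}" "p \<noteq> id" for p
  proof -
    obtain i where i: "p i \<noteq> i" using p(2) by (metis eq_id_iff)
    have i1: "i \<in> {1..n}" using i p(1) by (metis permutes_not_in)
    have pi: "p (p i) \<noteq> p i" using i permutes_inj[OF p(1)] by (metis injD)
    have pi1: "p i \<in> {1..n}" using i1 p(1) by (simp only: permutes_in_image)
    have "prod_list (map (\<lambda>i. m i (p i)) xs) \<in> deg_ge (d * length (filter (\<lambda>i. p i \<noteq> i) xs))"
      if "set xs \<subseteq> {1..n}" for xs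
      using that
    proof (induction xs)
      case (Cons j xs)
      then have j: "j \<in> {1..n}" "p j \<in> {1..n}" using permutes_in_image[OF p(1)] by auto
      have X: "prod_list (map (\<lambda>i. m i (p i)) xs) \<in> deg_ge (d * length (filter (\<lambda>i. p i \<noteq> i) xs))"
        using Cons by simp
      have "m j (p j) \<in> deg_ge (if p j \<noteq> j then d else 0)" using m[OF j] by auto
      from deg_ge_mult[OF this X] show ?case by (auto split: if_splits)
    qed simp
    then have "prod_list (map (\<lambda>i. m i (p i)) [1..<n+1]) \<in>
      deg_ge (d * length (filter (\<lambda>i. p i \<noteq> i) [1..<n+1]))"
      by (simp only: set_upt_from_1 order_refl)
    moreover have "2 \<le> length (filter (\<lambda>i. p i \<noteq> i) [1..<n+1])"
    proof -
      have "length (filter (\<lambda>i. p i \<noteq> i) [1..<n+1]) = card {i \<in> {1..n}. p i \<noteq> i}"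
        by (subst distinct_card[symmetric]) (auto intro: arg_cong[of _ _ card])
      moreover have "card {i, p i} \<le> card {i \<in> {1..n}. p i \<noteq> i}"
        by (rule card_mono) (use i i1 pi pi1 in auto)
      ultimately show ?thesis using i by simp
    qed
    then have "2 * d \<le> d * length (filter (\<lambda>i. p i \<noteq> i) [1..<n+1])" by simp
    ultimately have "prod_list (map (\<lambda>i. m i (p i)) [1..<n+1]) \<in> deg_ge (2 * d)"
      by (rule deg_ge_mono)
    then show ?thesis unfolding of_int_sign_mult by (rule espan_econst_mult)
  qed
  have "ext_det n m = ?t id + (\<Sum>p\<in>{p. p permutes {1..n}} - {id}. ?t p)"
    unfolding ext_det_def by (rule sum.remove) (auto intro: finite_permutations permutes_id)
  then have "ext_det n m - (1 + (\<Sum>i\<in>{1..n}. m i i - 1)) =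
    (?t id - (1 + (\<Sum>i\<in>{1..n}. m i i - 1))) + (\<Sum>p\<in>{p. p permutes {1..n}} - {id}. ?t p)" by simp
  also have "\<dots> \<in> deg_ge (2 * d)" by (intro espan_add espan_sum id) (use other in auto)
  finally show ?thesis .
qed

section \<open>The Jacobian\<close>

definition ejac :: "nat \<Rightarrow> ('r::comm_ring_1 exterior \<Rightarrow> 'r exterior) \<Rightarrow> 'r exterior" where
  "ejac n s = ext_det n (\<lambda>i j. ederiv j (s (emon {i})))"

lemma ejac_cong:
  assumes "\<And>i. i \<in> {1..n} \<Longrightarrow> s (emon {i}) = t (emon {i})"
  shows "ejac n s = ejac n t"
  unfolding ejac_def by (rule ext_det_cong) (simp add: assms)

lemma (in grass_aut) hom_ext_det:
  assumes m: "\<And>i j. i \<in> {1..n} \<Longrightarrow> j \<in> {1..n} \<Longrightarrow> m i j \<in> Lam n"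
  shows "s (ext_det n m) = ext_det n (\<lambda>i j. s (m i j))"
proof -
  have *: "prod_list (map (\<lambda>i. m i (p i)) xs) \<in> Lam n \<and>
      s (prod_list (map (\<lambda>i. m i (p i)) xs)) = prod_list (map (\<lambda>i. s (m i (p i))) xs)"
    if p: "p permutes {1..n}" and "set xs \<subseteq> {1..n}" for p xs
    using that(2)
  proof (induction xs)
    case (Cons i xs)
    then have "m i (p i) \<in> Lam n" using permutes_in_image[OF p, of i] by (intro m) auto
    then show ?case using Cons by (auto simp: hom_mult)
  qed (simp add: hom_one)
  have L: "prod_list (map (\<lambda>i. m i (p i)) [1..<n+1]) \<in> Lam n"
    and h: "s (prod_list (map (\<lambda>i. m i (p i)) [1..<n+1])) = prod_list (map (\<lambda>i. s (m i (p i))) [1..<n+1])"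
    if "p permutes {1..n}" for p
    using *[OF that, of "[1..<n+1]"] by (simp_all only: set_upt_from_1 order_refl)
  have "s (ext_det n m) = (\<Sum>p | p permutes {1..n}. s (econst (of_int (sign p)) *
    prod_list (map (\<lambda>i. m i (p i)) [1..<n+1])))"
    unfolding ext_det_def of_int_sign_mult
    by (rule hom_sum) (intro espan_econst_mult L, simp)
  also have "\<dots> = ext_det n (\<lambda>i j. s (m i j))"
    unfolding ext_det_def of_int_sign_mult
    by (intro sum.cong refl) (simp only: mem_Collect_eq hom_econst L h)
  finally show ?thesis .
qed

context grass_aut
begin

lemma jac_entry:
  assumes "i \<in> {1..n}"
  shows "ederiv j (s (emon {i})) \<in> evens" "ederiv j (s (emon {i})) \<in> Lam n"
    "0 < j \<Longrightarrow> ederiv j (s (emon {i})) - (if i = j then 1 else 0) \<in> deg_ge 2"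
proof -
  show "ederiv j (s (emon {i})) \<in> evens" by (rule ederiv_odd[OF gen_odd[OF assms]])
  show "ederiv j (s (emon {i})) \<in> Lam n"
    using assms by (intro Lam_ederiv closed Lam_emon) auto
  assume "0 < j"
  have "ederiv j (s (emon {i}) - emon {i}) \<in> deg_ge 2"
    by (rule espan_mono[OF ederiv_pert_Lam[OF gen[OF assms]]]) auto
  then show "ederiv j (s (emon {i})) - (if i = j then 1 else 0) \<in> deg_ge 2"
    using assms by (simp add: ederiv_emon_single)
qed

lemma ejac_Lam: "ejac n s \<in> Lam n"
  unfolding ejac_def by (rule ext_det_espan) (auto intro: jac_entry)

lemma ejac_evens: "ejac n s \<in> evens"
  unfolding ejac_def by (rule ext_det_espan) (auto intro: jac_entry simp: card_Un_disjoint)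

lemma ejac_near_one: "ejac n s - 1 \<in> deg_ge 2"
proof -
  let ?m = "\<lambda>i j. ederiv j (s (emon {i}))"
  have "ejac n s - (1 + (\<Sum>i\<in>{1..n}. ?m i i - 1)) \<in> deg_ge (2 * 2)"
    unfolding ejac_def by (rule ext_det_near_one) (rule jac_entry, auto)
  then have "ejac n s - (1 + (\<Sum>i\<in>{1..n}. ?m i i - 1)) \<in> deg_ge 2" by (rule deg_ge_mono) simp
  moreover have "(\<Sum>i\<in>{1..n}. ?m i i - 1) \<in> deg_ge 2"
  proof (rule espan_sum)
    fix i assume "i \<in> {1..n}"
    then show "?m i i - 1 \<in> deg_ge 2" using jac_entry(3)[of i i] by auto
  qed
  ultimately have "ejac n s - (1 + (\<Sum>i\<in>{1..n}. ?m i i - 1)) + (\<Sum>i\<in>{1..n}. ?m i i - 1) \<in> deg_ge 2"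
    by (rule espan_add)
  then show ?thesis by simp
qed

end

text \<open>By the chain rule the Jacobian matrix of the composite is the image under s of the
  matrix of t, times the matrix of s. Even entries allow the factors to be put in this order, and s
  commutes with the determinant.\<close>

lemma ejac_comp:
  assumes "grass_aut n s" "grass_aut n t"
  shows "ejac n (\<lambda>f. s (t f)) = ejac n s * s (ejac n t)"
proof -
  interpret s: grass_aut n s by fact
  interpret t: grass_aut n t by fact
  have "ejac n (\<lambda>f. s (t f)) =
    ext_det n (\<lambda>i j. \<Sum>k\<in>{1..n}. s (ederiv k (t (emon {i}))) * ederiv j (s (emon {k})))"
    unfolding ejac_def
  proof (rule ext_det_cong)
    fix i j assume i: "i \<in> {1..n}"
    then have "t (emon {i}) \<in> Lam n" by (intro t.closed Lam_emon) auto
    then have "ederiv j (s (t (emon {i}))) =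
      (\<Sum>k\<in>{1..n}. ederiv j (s (emon {k})) * s (ederiv k (t (emon {i}))))"
      by (rule s.ederiv_chain)
    also have "\<dots> = (\<Sum>k\<in>{1..n}. s (ederiv k (t (emon {i}))) * ederiv j (s (emon {k})))"
      by (intro sum.cong refl even_commute s.jac_entry)
    finally show "ederiv j (s (t (emon {i}))) =
      (\<Sum>k\<in>{1..n}. s (ederiv k (t (emon {i}))) * ederiv j (s (emon {k})))" .
  qed
  also have "\<dots> = ext_det n (\<lambda>i k. s (ederiv k (t (emon {i})))) * ejac n s"
    unfolding ejac_def by (rule ext_det_mult) (intro s.evens_closed t.jac_entry s.jac_entry; assumption)+
  also have "ext_det n (\<lambda>i k. s (ederiv k (t (emon {i})))) = s (ejac n t)"
    unfolding ejac_def by (rule s.hom_ext_det[symmetric]) (rule t.jac_entry)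
  also have "s (ejac n t) * ejac n s = ejac n s * s (ejac n t)"
    by (rule even_commute[OF s.ejac_evens, symmetric])
  finally show ?thesis .
qed

lemma ejac_id: "ejac n (\<lambda>f. f :: 'r::comm_ring_1 exterior) = 1"
proof -
  \<comment> \<open>Here the matrix minus the identity is 0 and so satisfies every degree bound; d =
    \<open>Suc n\<close> pushes the error beyond the top degree.\<close>
  have "ejac n (\<lambda>f. f :: 'r exterior) - (1 + (\<Sum>i\<in>{1..n}. ederiv i (emon {i}) - 1)) \<in> deg_ge (2 * Suc n)"
    unfolding ejac_def by (rule ext_det_near_one) (auto simp: ederiv_emon_single)
  then have "ejac n (\<lambda>f. f :: 'r exterior) - 1 \<in> deg_ge (2 * Suc n)" by (simp add: ederiv_emon_single)
  then have "ejac n (\<lambda>f. f :: 'r exterior) - 1 \<in> deg_ge (Suc n)" by (rule deg_ge_mono) simp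
  moreover have "ejac n (\<lambda>f. f :: 'r exterior) - 1 \<in> Lam n"
    by (intro espan_diff grass_aut.ejac_Lam grass_aut_id Lam_one)
  ultimately show ?thesis using Lam_deg_gt by fastforce
qed


section \<open>The Berezin integral\<close>

text \<open>Since b has positive degree, 1 + b is inverted by successive approximation. Beyond
  existence, the inverse must be even and free of x_k, which is what \<open>berezin_elem_aut\<close>
  relies on.\<close>

lemma even_unit_inverse:
  assumes b: "b \<in> espan {S. S \<subseteq> {1..n} \<and> k \<notin> S \<and> even (card S) \<and> 2 \<le> card S}"
  shows "\<exists>w \<in> espan {S. S \<subseteq> {1..n} \<and> k \<notin> S \<and> even (card S)}. w * (1 + b) = (1 :: 'r::comm_ring_1 exterior)"
proof -
  let ?X = "espan {S. S \<subseteq> {1..n} \<and> k \<notin> S \<and> even (card S)} :: 'r exterior set"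
  have mult: "f * g \<in> ?X" if "f \<in> ?X" "g \<in> ?X" for f g
    by (rule espan_mult[OF that]) (auto simp: card_Un_disjoint)
  have one: "1 \<in> ?X" by (rule espan_one) simp
  have bX: "b \<in> ?X" and b1: "b \<in> deg_ge 1" by (rule espan_mono[OF b], force)+
  have "\<exists>w \<in> ?X. w * (1 + b) - 1 \<in> deg_ge j" for j
  proof (induction j)
    case 0
    show ?case using one by (intro bexI[of _ 1]) simp_all
  next
    case (Suc j)
    then obtain w where w: "w \<in> ?X" "w * (1 + b) - 1 \<in> deg_ge j" by blast
    define e where "e = w * (1 + b) - 1"
    have e: "e \<in> ?X" unfolding e_def by (intro espan_diff espan_add mult w one bX)
    \<comment> \<open>If w (1 + b) = 1 + e, then replacing w by w - e turns the error e into - e b,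
      one degree higher at least.\<close>
    have "(w - e) * (1 + b) - 1 = - (e * b)" by (simp add: e_def algebra_simps)
    moreover have "- (e * b) \<in> deg_ge (Suc j)"
      unfolding Suc_eq_plus1 by (intro espan_uminus deg_ge_mult b1) (use w(2) in \<open>simp add: e_def\<close>)
    ultimately show ?case using espan_diff[OF w(1) e] by (intro bexI[of _ "w - e"]) simp_all
  qed
  then obtain w where w: "w \<in> ?X" "w * (1 + b) - 1 \<in> deg_ge (Suc n)" by blast
  have "w * (1 + b) - 1 \<in> ?X" by (intro espan_diff espan_add mult w one bX)
  then have "w * (1 + b) - 1 \<in> Lam n" by (rule espan_mono) auto
  then have "w * (1 + b) - 1 = 0" using w(2) by (rule Lam_deg_gt)
  then show ?thesis using w(1) by auto
qed

text \<open>The left derivative strips x_k off the front with the sign of bringing it there, and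
  multiplying by x_k on the left restores exactly the monomials containing x_k. This yields f = g +
  x_k h with g and h free of x_k.\<close>

lemma minus_gen_part:
  assumes "0 < k"
  shows "f - emon {k} * ederiv k f \<in> espan {S. k \<notin> S}"
proof (rule espanI)
  fix S assume nz: "ecoeff (f - emon {k} * ederiv k f) S \<noteq> 0"
  then have fin: "finite S" by (metis ecoeff_infinite)
  have "k \<notin> S"
  proof
    assume k: "k \<in> S"
    have "ecoeff (emon {k} * ederiv k f) S = (\<Sum>A\<in>Pow S. if A = {k} then ecoeff f S else 0)"
      unfolding ecoeff_mult
    proof (rule sum.cong)
      fix A assume "A \<in> Pow S"
      show "inv_sign A (S - A) * ecoeff (emon {k}) A * ecoeff (ederiv k f) (S - A) =
        (if A = {k} then ecoeff f S else 0)"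
        using assms k
        by (auto simp: ecoeff_emon ecoeff_ederiv insert_absorb mult.assoc[symmetric])
    qed simp
    then have "ecoeff (emon {k} * ederiv k f) S = ecoeff f S" using fin k by simp
    then show False using nz by simp
  qed
  then show "S \<in> {S. k \<notin> S}" by simp
qed

lemma ederiv_not_in: "ederiv k f \<in> espan {S. k \<notin> S}"
  by (auto simp: espan_def ecoeff_ederiv)

text \<open>Only row k differs from the identity matrix. A permutation other than the identity moves
  two indices, hence some j \<noteq> k, and the factor from row j is 0.\<close>

lemma ejac_elem_aut:
  assumes a: "a \<in> pert n" and k: "k \<in> {1..n}"
  shows "ejac n (elem_aut k a) = 1 + ederiv k a"
proof -
  define m where "m = (\<lambda>i j. ederiv j (elem_aut k a (emon {i})))"
  have m: "m i j = (if i = j then 1 else 0) + (if i = k then ederiv j a else 0)"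
    if "i \<in> {1..n}" for i j
    using that by (auto simp: m_def elem_aut_emon ederiv_emon_single)
  have zero: "prod_list (map (\<lambda>i. m i (p i)) [1..<n+1]) = 0" if p: "p permutes {1..n}" "p \<noteq> id" for p
  proof -
    obtain i where i: "p i \<noteq> i" using p(2) by (metis eq_id_iff)
    have "p (p i) \<noteq> p i" using i permutes_inj[OF p(1)] by (metis injD)
    moreover have i1: "i \<in> {1..n}" using i p(1) by (metis permutes_not_in)
    moreover have "p i \<in> {1..n}" using i1 p(1) by (simp only: permutes_in_image)
    ultimately obtain j where j: "j \<in> {1..n}" "p j \<noteq> j" "j \<noteq> k" using i by metis
    have "m j (p j) = 0" using m[OF j(1)] j by auto
    then have "prod_list (map (\<lambda>i. m i (p i)) xs) = 0" if "j \<in> set xs" for xs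
      using that by (induction xs) auto
    then show ?thesis using j(1) by (simp only: set_upt_from_1)
  qed
  have one: "prod_list (map (\<lambda>i. m i i) xs) = (if k \<in> set xs then 1 + ederiv k a else 1)"
    if "distinct xs" "set xs \<subseteq> {1..n}" for xs
    using that by (induction xs) (auto simp: m)
  have "ejac n (elem_aut k a) = (\<Sum>p | p permutes {1..n}. if p = id then 1 + ederiv k a else 0)"
    unfolding ejac_def ext_det_def m_def[symmetric]
  proof (rule sum.cong)
    fix p assume p: "p \<in> {p. p permutes {1..n}}"
    show "of_int (sign p) * prod_list (map (\<lambda>i. m i (p i)) [1..<n+1]) =
      (if p = id then 1 + ederiv k a else 0)"
    proof (cases "p = id")
      case True
      have "prod_list (map (\<lambda>i. m i i) [1..<n+1]) = (if k \<in> {1..n} then 1 + ederiv k a else 1)"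
        using one[OF distinct_upt, of 1 "n + 1"] by (simp only: set_upt_from_1 order_refl)
      then show ?thesis using True k by simp
    next
      case False
      then show ?thesis using zero[of p] p by simp
    qed
  qed simp
  then show ?thesis by (simp add: finite_permutations permutes_id)
qed

text \<open>Write f = g + x_k h and a = x_k b + c with g, h, b, c free of x_k. The substitution
  gives g + c h + x_k (1 + b) h, and multiplication by w, the inverse of 1 + b, leaves x_k h plus
  terms free of x_k. The top monomial contains x_k, so only x_k h is seen, as in f.\<close>

lemma berezin_elem_aut:
  assumes a: "a \<in> pert n" and k: "k \<in> {1..n}"
    and w: "w \<in> espan {S. S \<subseteq> {1..n} \<and> k \<notin> S \<and> even (card S)}" "w * (1 + ederiv k a) = 1"
  shows "ecoeff (w * elem_aut k a f) {1..n} = ecoeff f {1..n}"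
proof -
  define b c h g where "b = ederiv k a" and "c = a - emon {k} * b"
    and "h = ederiv k f" and "g = f - emon {k} * h"
  have k0: "0 < k" using k by simp
  let ?N = "espan {S. k \<notin> S}"
  have N: "x * y \<in> ?N" if "x \<in> ?N" "y \<in> ?N" for x y :: "'a exterior"
    by (rule espan_mult[OF that]) auto
  have c: "c \<in> ?N" and g: "g \<in> ?N" unfolding c_def b_def g_def h_def
    by (rule minus_gen_part[OF k0])+
  have h: "h \<in> ?N" unfolding h_def by (rule ederiv_not_in)
  have wN: "w \<in> ?N" by (rule espan_mono[OF w(1)]) auto
  have even: "w \<in> evens" by (rule espan_mono[OF w(1)]) auto
  have comm: "w * (emon {k} * x) = emon {k} * (w * x)" for x
    by (metis even_commute[OF even] mult.assoc)
  have f: "f = g + emon {k} * h" and a': "a = emon {k} * b + c"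
    by (simp_all add: g_def c_def)
  have "w * elem_aut k a f = w * (g + emon {k} * h + (emon {k} * b + c) * h)"
    unfolding elem_aut_def h_def[symmetric] by (simp only: f[symmetric] a'[symmetric])
  also have "\<dots> = w * g + w * (emon {k} * h) + w * (emon {k} * (b * h)) + w * (c * h)"
    by (simp only: distrib_left distrib_right mult.assoc add.assoc)
  also have "\<dots> = (w * g + w * (c * h)) + emon {k} * (w * (1 + b) * h)"
    unfolding comm by (simp add: distrib_left distrib_right mult.assoc)
  finally have "w * elem_aut k a f = (w * g + w * (c * h)) + emon {k} * h"
    using w(2) by (simp add: b_def)
  moreover have "ecoeff (w * g + w * (c * h)) {1..n} = 0"
    by (rule espanD[of _ "{S. k \<notin> S}"]) (use N wN g c h k in \<open>auto intro!: espan_add\<close>)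
  moreover have "ecoeff g {1..n} = 0" by (rule espanD[OF g]) (use k in auto)
  ultimately show ?thesis by (subst (2) f) simp
qed

text \<open>Change of variables in the Berezin integral, which sends \<open>f\<close> to the coefficient of
  \<open>x\<^sub>1 \<cdots> x\<^sub>n\<close>. It is a cocycle condition, so it suffices to check it on elementary automorphisms.\<close>

lemma berezin_change_of_variables:
  assumes "grass_aut n s"
  shows "\<exists>u \<in> Lam n. u * ejac n s = 1 \<and> (\<forall>f \<in> Lam n. ecoeff (u * s f) {1..n} = ecoeff f {1..n})"
  using assms
proof (induction rule: grass_aut_induct)
  case (cong s t)
  have "ejac n s = ejac n t" by (rule ejac_cong, rule cong, rule Lam_emon) auto
  then show ?case using cong by (auto intro: bexI)
next
  case id
  show ?case by (intro bexI[of _ 1]) (auto simp: ejac_id)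
next
  case (elem s k a)
  interpret s: grass_aut n s by fact
  let ?e = "elem_aut k a"
  interpret e: grass_aut n ?e by (rule grass_aut_elem) fact
  obtain u where u: "u \<in> Lam n" "u * ejac n s = 1"
    "\<And>f. f \<in> Lam n \<Longrightarrow> ecoeff (u * s f) {1..n} = ecoeff f {1..n}" using elem by blast
  have b: "ederiv k a \<in> espan {S. S \<subseteq> {1..n} \<and> k \<notin> S \<and> even (card S) \<and> 2 \<le> card S}"
    using espan_Int[OF ederiv_pert_Lam[OF elem.hyps(3)] ederiv_not_in, of k] by (rule espan_mono) auto
  obtain w where w: "w \<in> espan {S. S \<subseteq> {1..n} \<and> k \<notin> S \<and> even (card S)}"
    "w * (1 + ederiv k a) = 1" using even_unit_inverse[OF b] by blast
  have wL: "w \<in> Lam n" by (rule espan_mono[OF w(1)]) auto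
  have bL: "1 + ederiv k a \<in> Lam n"
    by (intro espan_add Lam_one) (rule espan_mono[OF b], auto)
  have J: "ejac n (\<lambda>f. s (?e f)) = ejac n s * s (1 + ederiv k a)"
    unfolding ejac_comp[OF s.grass_aut_axioms e.grass_aut_axioms]
      ejac_elem_aut[OF elem.hyps(3,2)] ..
  show ?case
  \<comment> \<open>By the cocycle identity the Jacobian of the composite is J(s) s(1 + b), so its
    inverse is u * s w. The coefficients are then compared through s (w * e(f)), with the hypothesis
    for s and the elementary case in turn.\<close>
  proof (intro bexI[of _ "u * s w"] conjI ballI)
    have "u * s w * ejac n (\<lambda>f. s (?e f)) = (u * ejac n s) * (s w * s (1 + ederiv k a))"
      unfolding J mult.assoc
      by (simp only: mult.assoc[symmetric] even_commute[OF s.ejac_evens, of "s w"])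
    also have "\<dots> = 1" using u(2) w(2) by (simp add: s.hom_mult[OF wL bL, symmetric] s.hom_one)
    finally show "u * s w * ejac n (\<lambda>f. s (?e f)) = 1" .
    show "u * s w \<in> Lam n" by (intro Lam_mult u s.closed wL)
    fix f :: "'a exterior" assume f: "f \<in> Lam n"
    have "u * s w * s (?e f) = u * s (w * ?e f)"
      by (simp add: s.hom_mult wL e.closed f mult.assoc)
    then show "ecoeff (u * s w * s (?e f)) {1..n} = ecoeff f {1..n}"
      using u(3)[OF Lam_mult[OF wL e.closed[OF f]]] berezin_elem_aut[OF elem.hyps(3,2) w] by simp
  qed
qed

text \<open>Take the integrand 1: the top monomial squares to 0, so the inverse of the Jacobian is 1
  - c x_1 ... x_n with top coefficient -c, whereas the top coefficient of 1 is 0 as n > 0.\<close>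

lemma ejac_top_trivial:
  assumes s: "grass_aut n s" and "0 < n" and J: "ejac n s = 1 + econst c * emon {1..n}"
  shows "c = 0"
proof -
  let ?t = "econst c * emon {1..n}"
  obtain u where u: "u * (1 + ?t) = 1" and top: "ecoeff (u * s 1) {1..n} = ecoeff 1 {1..n}"
    using berezin_change_of_variables[OF s] unfolding J by blast
  have "emon {1..n} * emon {1..n} = (0 :: 'a exterior)" using assms(2) by (simp add: emon_mult)
  then have tt: "?t * ?t = 0" by (simp add: mult.assoc econst_mult_left_commute)
  have "(1 + ?t) * (1 - ?t) = 1" using tt by (simp add: algebra_simps)
  then have "u = u * (1 + ?t) * (1 - ?t)" by (simp only: mult.assoc mult_1_right)
  then have "u = 1 - ?t" using u by simp
  then have "ecoeff (u * s 1) {1..n} = - c"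
    using assms(2) by (simp add: grass_aut.hom_one[OF s] ecoeff_one ecoeff_emon)
  then show ?thesis using top assms(2) by (simp add: ecoeff_one)
qed

section \<open>Automorphisms of the Grassmann algebra of rank n\<close>

lemma carrier_ecoeff [simp]: "ecoeff u \<in> carrier (Grassmann n) \<longleftrightarrow> u \<in> Lam n"
  by (simp add: carrier_Grassmann_iff espan_def)

lemma degrees_ecoeff: "ecoeff u \<in> degrees n P \<longleftrightarrow> u \<in> espan {S. S \<subseteq> {1..n} \<and> P (card S)}"
  by (auto simp: degrees_def espan_def)

lemma carrier_cases:
  assumes "f \<in> carrier (Grassmann n)"
  obtains u where "f = ecoeff u" "u \<in> Lam n"
proof -
  have e: "ecoeff (Exterior f) = f" using assms by (intro Exterior_inverse) auto
  then have "Exterior f \<in> Lam n" using assms carrier_ecoeff[of "Exterior f" n] by simp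
  then show thesis using that[of "Exterior f"] e by simp
qed

lemma degrees_cases:
  assumes "f \<in> degrees n P"
  obtains u where "f = ecoeff u" "u \<in> espan {S. S \<subseteq> {1..n} \<and> P (card S)}"
proof -
  obtain u where u: "f = ecoeff u" "u \<in> Lam n"
    using assms carrier_cases[of f n] by (auto simp: degrees_def)
  then show thesis using assms that[of u] by (simp add: degrees_ecoeff)
qed

lemma gen_ecoeff: "i \<in> {1..n} \<Longrightarrow> gen i = ecoeff (emon {i})"
  by (simp add: gen_def xmon_ecoeff)

lemma a_inv_ecoeff:
  assumes "v \<in> Lam n"
  shows "\<ominus>\<^bsub>Grassmann n\<^esub> ecoeff v = ecoeff (- v)"
proof -
  have "abelian_group (Grassmann n :: 'a grass ring)"
  proof (rule abelian_groupI)
    show "\<exists>y\<in>carrier (Grassmann n). y \<oplus>\<^bsub>Grassmann n\<^esub> x = \<zero>\<^bsub>Grassmann n\<^esub>"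
      if x: "x \<in> carrier (Grassmann n)" for x :: "'a grass"
    proof -
      obtain u where u: "x = ecoeff u" "u \<in> Lam n" using x by (rule carrier_cases)
      have "ecoeff (- u) \<oplus>\<^bsub>Grassmann n\<^esub> x = \<zero>\<^bsub>Grassmann n\<^esub>"
        by (simp add: u Grassmann_ecoeff)
      then show ?thesis using espan_uminus[OF u(2)] by (intro bexI[of _ "ecoeff (- u)"]) simp_all
    qed
  qed (auto elim!: carrier_cases simp: Grassmann_ecoeff algebra_simps)
  then show ?thesis
    by (rule abelian_group.minus_equality)
      (use assms in \<open>simp_all add: Grassmann_ecoeff espan_uminus\<close>)
qed

lemma a_minus_ecoeff:
  assumes "v \<in> Lam n"
  shows "ecoeff u \<ominus>\<^bsub>Grassmann n\<^esub> ecoeff v = ecoeff (u - v)"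
  by (simp add: a_minus_def a_inv_ecoeff assms Grassmann_ecoeff)

lemma emon_split:
  fixes S :: "nat set"
  assumes "finite S" "S \<noteq> {}" "S \<subseteq> {1..n}"
  shows "\<exists>b T. emon S = (emon {b} * emon T :: 'r::comm_ring_1 exterior) \<and>
    b \<in> {1..n} \<and> T \<subseteq> {1..n} \<and> card S = Suc (card T)"
proof -
  define b T where "b = Min S" and "T = S - {b}"
  have b: "b \<in> S" using assms by (simp add: b_def)
  then have S: "S = insert b T" and bT: "b \<notin> T" and T: "finite T" "T \<subseteq> {1..n}"
    using assms by (auto simp: T_def)
  have "b < a" if "a \<in> T" for a
    using Min_le[of S a] that assms(1) by (auto simp: T_def b_def less_le)
  moreover have "0 < b" "0 \<notin> T" "b \<in> {1..n}" using b assms(3) T by auto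
  ultimately show ?thesis
    using T bT by (intro exI[of _ b] exI[of _ T]) (auto simp: S intro: emon_insert_min)
qed

text \<open>Degrees add under products, which gives one inclusion. For the other, a monomial of
  degree at least 3 splits off two generators and leaves a factor that still has positive
  degree.\<close>

lemma cube_max_ideal:
  "ecoeff u \<in> max_ideal n \<cdot>\<^bsub>Grassmann n\<^esub> max_ideal n \<cdot>\<^bsub>Grassmann n\<^esub> max_ideal n \<longleftrightarrow>
    u \<in> espan {S. S \<subseteq> {1..n} \<and> 3 \<le> card S}"
proof
  let ?m = "max_ideal n :: 'a grass set" and ?G = "Grassmann n :: 'a grass ring"
  have times: "\<exists>u. i \<otimes>\<^bsub>?G\<^esub> j = ecoeff u \<and> u \<in> espan {S. S \<subseteq> {1..n} \<and> d + e \<le> card S}"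
    if i: "\<exists>u. i = ecoeff u \<and> u \<in> espan {S. S \<subseteq> {1..n} \<and> d \<le> card S}"
      and j: "\<exists>u. j = ecoeff u \<and> u \<in> espan {S. S \<subseteq> {1..n} \<and> e \<le> card S}" for i j :: "'a grass" and d e
  proof -
    obtain u v where u: "i = ecoeff u" "u \<in> espan {S. S \<subseteq> {1..n} \<and> d \<le> card S}"
      and v: "j = ecoeff v" "v \<in> espan {S. S \<subseteq> {1..n} \<and> e \<le> card S}" 
      using i j by blast
    have "u * v \<in> espan {S. S \<subseteq> {1..n} \<and> d + e \<le> card S}"
      by (rule espan_mult[OF u(2) v(2)]) (auto simp: card_Un_disjoint)
    then show ?thesis using u v by (auto simp: Grassmann_ecoeff)
  qed
  have plus: "\<exists>u. i \<oplus>\<^bsub>?G\<^esub> j = ecoeff u \<and> u \<in> espan A"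
    if "\<exists>u. i = ecoeff u \<and> u \<in> espan A" "\<exists>u. j = ecoeff u \<and> u \<in> espan A" for i j :: "'a grass" and A
    using that by (auto simp: Grassmann_ecoeff intro: espan_add)
  have m: "\<exists>u. i = ecoeff u \<and> u \<in> espan {S. S \<subseteq> {1..n} \<and> 1 \<le> card S}" if "i \<in> ?m" for i
    using that by (auto elim: degrees_cases)
  have 2: "\<exists>u. i = ecoeff u \<and> u \<in> espan {S. S \<subseteq> {1..n} \<and> 1 + 1 \<le> card S}" if "i \<in> ?m \<cdot>\<^bsub>?G\<^esub> ?m" for i
    using that
  proof (induction rule: ideal_prod.induct)
    case (prod i j)
    then show ?case by (intro times m)
  qed (rule plus)
  have 3: "\<exists>u. i = ecoeff u \<and> u \<in> espan {S. S \<subseteq> {1..n} \<and> 1 + 1 + 1 \<le> card S}"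
    if "i \<in> ?m \<cdot>\<^bsub>?G\<^esub> ?m \<cdot>\<^bsub>?G\<^esub> ?m" for i
    using that
  proof (induction rule: ideal_prod.induct)
    case (prod i j)
    then show ?case by (intro times[OF 2 m])
  qed (rule plus)
  assume "ecoeff u \<in> ?m \<cdot>\<^bsub>?G\<^esub> ?m \<cdot>\<^bsub>?G\<^esub> ?m"
  from 3[OF this] obtain v where v: "ecoeff u = ecoeff v"
    "v \<in> espan {S. S \<subseteq> {1..n} \<and> 1 + 1 + 1 \<le> card S}" by blast
  have "1 + 1 + 1 = (3 :: nat)" by simp
  with v show "u \<in> espan {S. S \<subseteq> {1..n} \<and> 3 \<le> card S}" by (simp only: ecoeff_inject)
next
  let ?m = "max_ideal n :: 'a grass set" and ?G = "Grassmann n :: 'a grass ring"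
  assume "u \<in> espan {S. S \<subseteq> {1..n} \<and> 3 \<le> card S}"
  then show "ecoeff u \<in> ?m \<cdot>\<^bsub>?G\<^esub> ?m \<cdot>\<^bsub>?G\<^esub> ?m"
  proof (induction rule: espan_induct)
    case zero
    have 0: "ecoeff 0 \<in> ?m" by (simp add: degrees_ecoeff)
    have "ecoeff 0 \<otimes>\<^bsub>?G\<^esub> ecoeff 0 \<otimes>\<^bsub>?G\<^esub> ecoeff 0 \<in> ?m \<cdot>\<^bsub>?G\<^esub> ?m \<cdot>\<^bsub>?G\<^esub> ?m"
      by (intro ideal_prod.prod 0)
    then show ?case by (simp only: Grassmann_ecoeff mult_zero_right)
  next
    case (add f g)
    then have "ecoeff f \<oplus>\<^bsub>?G\<^esub> ecoeff g \<in> ?m \<cdot>\<^bsub>?G\<^esub> ?m \<cdot>\<^bsub>?G\<^esub> ?m"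
      by (intro ideal_prod.sum)
    then show ?case by (simp only: Grassmann_ecoeff)
  next
    case (mon S c)
    obtain b T where b: "emon S = (emon {b} * emon T :: 'a exterior)" "b \<in> {1..n}" "T \<subseteq> {1..n}" "card S = Suc (card T)"
      
      using emon_split[of S n] mon by fastforce
    have "finite T" "T \<noteq> {}" using b mon by (auto dest: finite_subset)
    then obtain b' T' where b': "emon T = (emon {b'} * emon T' :: 'a exterior)" "b' \<in> {1..n}" "T' \<subseteq> {1..n}"
      "card T = Suc (card T')" using emon_split[of T n] b by blast
    have "econst c * emon {b} \<in> espan {S. S \<subseteq> {1..n} \<and> 1 \<le> card S}"
      "emon {b'} \<in> espan {S. S \<subseteq> {1..n} \<and> 1 \<le> card S}"
      "emon T' \<in> espan {S. S \<subseteq> {1..n} \<and> 1 \<le> card S}"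
      using b b' mon by (auto intro!: espan_econst_mult espan_emon)
    \<comment> \<open>The scalar is attached to the first factor, so that the whole term is a single
      triple product.\<close>
    then have "ecoeff (econst c * emon {b}) \<otimes>\<^bsub>?G\<^esub> ecoeff (emon {b'}) \<otimes>\<^bsub>?G\<^esub> ecoeff (emon T')
        \<in> ?m \<cdot>\<^bsub>?G\<^esub> ?m \<cdot>\<^bsub>?G\<^esub> ?m"
      by (intro ideal_prod.prod) (simp_all only: degrees_ecoeff)
    moreover have "ecoeff (econst c * emon {b}) \<otimes>\<^bsub>?G\<^esub> ecoeff (emon {b'}) \<otimes>\<^bsub>?G\<^esub> ecoeff (emon T') =
      ecoeff (econst c * emon S)"
      by (simp only: Grassmann_ecoeff b(1) b'(1) mult.assoc)
    ultimately show ?case by (simp only:)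
  qed
qed

section \<open>Elements of \<open>Gamma n\<close> as unipotent automorphisms\<close>

definition ext_of :: "'r::comm_ring_1 endo \<Rightarrow> 'r exterior \<Rightarrow> 'r exterior" where
  "ext_of \<sigma> u = Exterior (\<sigma> (ecoeff u))"

text \<open>Restricting to the carrier makes the result extensional, as \<open>Bij\<close> demands;
  hence an element of \<open>Gamma n\<close> is determined by its values on the carrier.\<close>

definition endo_of :: "nat \<Rightarrow> ('r::comm_ring_1 exterior \<Rightarrow> 'r exterior) \<Rightarrow> 'r endo" where
  "endo_of n s = (\<lambda>f\<in>carrier (Grassmann n). ecoeff (s (Exterior f)))"

lemma ecoeff_Exterior: "f \<in> carrier (Grassmann n) \<Longrightarrow> ecoeff (Exterior f) = f"
  by (rule Exterior_inverse) auto

lemma endo_of_ecoeff: "u \<in> Lam n \<Longrightarrow> endo_of n s (ecoeff u) = ecoeff (s u)"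
  by (simp add: endo_of_def ecoeff_inverse)

lemma ext_of_endo_of: "u \<in> Lam n \<Longrightarrow> ext_of (endo_of n s) u = s u"
  by (simp add: ext_of_def endo_of_ecoeff ecoeff_inverse)

lemma endo_of_Gamma:
  assumes "grass_aut n s"
  shows "endo_of n s \<in> Gamma n"
proof -
  interpret s: grass_aut n s by fact
  let ?C = "carrier (Grassmann n) :: 'a grass set"
  have bij: "bij_betw (endo_of n s) ?C ?C"
  proof (rule bij_betwI')
    fix x y assume "x \<in> ?C" "y \<in> ?C"
    then show "(endo_of n s x = endo_of n s y) = (x = y)"
      by (auto elim!: carrier_cases simp: endo_of_ecoeff ecoeff_inject dest: s.injective)
  next
    fix x assume "x \<in> ?C"
    then show "endo_of n s x \<in> ?C" by (auto elim!: carrier_cases simp: endo_of_ecoeff s.closed)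
  next
    fix y assume "y \<in> ?C"
    then obtain u where u: "y = ecoeff u" "u \<in> Lam n" by (rule carrier_cases)
    then obtain v where "v \<in> Lam n" "s v = u" using s.surjective by blast
    then show "\<exists>x\<in>?C. y = endo_of n s x"
      using u by (intro bexI[of _ "ecoeff v"]) (simp_all add: endo_of_ecoeff)
  qed
  moreover have "endo_of n s \<in> Ring.ring_hom (Grassmann n) (Grassmann n)"
    by (rule ring_hom_memI)
      (auto elim!: carrier_cases simp: endo_of_ecoeff s.closed s.hom_add s.hom_mult s.hom_one
        Grassmann_ecoeff Lam_mult espan_add)
  moreover have "endo_of n s \<in> extensional ?C" by (simp add: endo_of_def)
  moreover have "endo_of n s (scale c a) = scale c (endo_of n s a)" if "a \<in> ?C" for c a
    using that by (auto elim!: carrier_cases simp: scale_ecoeff endo_of_ecoeff espan_econst_mult s.hom_econst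
        simp del: ecoeff_econst_mult)
  moreover have "endo_of n s (gen i) \<ominus>\<^bsub>Grassmann n\<^esub> gen i \<in> degrees n odd \<inter>
    (max_ideal n \<cdot>\<^bsub>Grassmann n\<^esub> max_ideal n \<cdot>\<^bsub>Grassmann n\<^esub> max_ideal n)" if i: "i \<in> {1..n}" for i
  proof -
    have L: "(emon {i} :: 'a exterior) \<in> Lam n" by (rule Lam_emon) (use i in simp)
    have "s (emon {i}) - emon {i} \<in> pert n" by (rule s.gen[OF i])
    then show ?thesis using L
      by (auto simp: gen_ecoeff[OF i] endo_of_ecoeff a_minus_ecoeff degrees_ecoeff cube_max_ideal
          intro: espan_mono)
  qed
  ultimately show ?thesis by (auto simp: Gamma_def ring_iso_def Bij_def)
qed

lemma
  assumes "\<sigma> \<in> Gamma n"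
  shows Gamma_grass_aut: "grass_aut n (ext_of \<sigma>)"
    and Gamma_ecoeff: "u \<in> Lam n \<Longrightarrow> \<sigma> (ecoeff u) = ecoeff (ext_of \<sigma> u)"
    and Gamma_Bij: "\<sigma> \<in> Bij (carrier (Grassmann n))"
proof -
  let ?C = "carrier (Grassmann n) :: 'a grass set"
  have hom: "\<sigma> \<in> Ring.ring_hom (Grassmann n) (Grassmann n)"
    and Bij: "\<sigma> \<in> Bij ?C"
    and scal: "\<And>c a. a \<in> ?C \<Longrightarrow> \<sigma> (scale c a) = scale c (\<sigma> a)"
    and gen: "\<And>i. i \<in> {1..n} \<Longrightarrow> \<sigma> (gen i) \<ominus>\<^bsub>Grassmann n\<^esub> gen i \<in> degrees n odd \<inter>
      (max_ideal n \<cdot>\<^bsub>Grassmann n\<^esub> max_ideal n \<cdot>\<^bsub>Grassmann n\<^esub> max_ideal n)"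
    using assms by (auto simp: Gamma_def ring_iso_def)
  show "\<sigma> \<in> Bij ?C" by (rule Bij)
  have ec: "\<sigma> (ecoeff u) = ecoeff (ext_of \<sigma> u)" if "u \<in> Lam n" for u
    using that ring_hom_closed[OF hom, of "ecoeff u"] by (simp add: ext_of_def ecoeff_Exterior)
  then show "u \<in> Lam n \<Longrightarrow> \<sigma> (ecoeff u) = ecoeff (ext_of \<sigma> u)" .
  show "grass_aut n (ext_of \<sigma>)"
  proof
    fix f g :: "'a exterior" and c assume f: "f \<in> Lam n"
    show fc: "ext_of \<sigma> f \<in> Lam n"
      using ring_hom_closed[OF hom, of "ecoeff f"] f by (simp add: ec[OF f])
    show "ext_of \<sigma> (econst c * f) = econst c * ext_of \<sigma> f"
      using scal[of "ecoeff f" c] f by (simp add: scale_ecoeff ec espan_econst_mult ecoeff_inject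
          del: ecoeff_econst_mult)
    assume g: "g \<in> Lam n"
    show "ext_of \<sigma> (f + g) = ext_of \<sigma> f + ext_of \<sigma> g"
      using ring_hom_add[OF hom, of "ecoeff f" "ecoeff g"] f g
      by (simp add: Grassmann_ecoeff ec espan_add ecoeff_inject)
    show "ext_of \<sigma> (f * g) = ext_of \<sigma> f * ext_of \<sigma> g"
      using ring_hom_mult[OF hom, of "ecoeff f" "ecoeff g"] f g
      by (simp add: Grassmann_ecoeff ec Lam_mult ecoeff_inject)
  next
    show "ext_of \<sigma> 1 = 1"
      using ring_hom_one[OF hom] by (simp add: Grassmann_ecoeff ec ecoeff_inject)
  next
    fix i assume i: "i \<in> {1..n}"
    have L: "(emon {i} :: 'a exterior) \<in> Lam n" by (rule Lam_emon) (use i in simp)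
    have "ecoeff (ext_of \<sigma> (emon {i}) - emon {i}) \<in> degrees n odd \<inter>
      (max_ideal n \<cdot>\<^bsub>Grassmann n\<^esub> max_ideal n \<cdot>\<^bsub>Grassmann n\<^esub> max_ideal n)"
      using gen[OF i] by (simp add: gen_ecoeff[OF i] ec[OF L] a_minus_ecoeff[OF L])
    then show "ext_of \<sigma> (emon {i}) - emon {i} \<in> pert n"
      by (auto simp: degrees_ecoeff cube_max_ideal espan_def)
  qed
qed

lemma Gamma_eqI:
  assumes "\<sigma> \<in> Gamma n" "\<tau> \<in> Gamma n"
    and "\<And>u. u \<in> Lam n \<Longrightarrow> ext_of \<sigma> u = ext_of \<tau> u"
  shows "\<sigma> = \<tau>"
proof (rule extensionalityI)
  show "\<sigma> \<in> extensional (carrier (Grassmann n))" "\<tau> \<in> extensional (carrier (Grassmann n))"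
    using Gamma_Bij[OF assms(1)] Gamma_Bij[OF assms(2)] by (simp_all add: Bij_imp_extensional)
  fix f :: "'a grass" assume "f \<in> carrier (Grassmann n)"
  then obtain u where "f = ecoeff u" "u \<in> Lam n" by (rule carrier_cases)
  then show "\<sigma> f = \<tau> f" using assms by (simp add: Gamma_ecoeff)
qed

lemma Gamma_eq_gens:
  assumes "\<sigma> \<in> Gamma n" "\<tau> \<in> Gamma n"
    and "\<And>i. i \<in> {1..n} \<Longrightarrow> ext_of \<sigma> (emon {i}) = ext_of \<tau> (emon {i})"
  shows "\<sigma> = \<tau>"
  by (rule Gamma_eqI[OF assms(1,2)])
    (rule grass_aut_eqI[OF Gamma_grass_aut[OF assms(1)] Gamma_grass_aut[OF assms(2)] assms(3)])

lemma Gamma_mult: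
  assumes "\<sigma> \<in> Gamma n" "\<tau> \<in> Gamma n"
  shows "\<sigma> \<otimes>\<^bsub>Gamma_group n\<^esub> \<tau> = endo_of n (\<lambda>u. ext_of \<sigma> (ext_of \<tau> u))"
proof -
  have "\<sigma> \<otimes>\<^bsub>Gamma_group n\<^esub> \<tau> = compose (carrier (Grassmann n)) \<sigma> \<tau>"
    using Gamma_Bij[OF assms(1)] Gamma_Bij[OF assms(2)] by (simp add: Gamma_group_def BijGroup_def)
  also have "\<dots> = endo_of n (\<lambda>u. ext_of \<sigma> (ext_of \<tau> u))"
  proof (rule extensionalityI)
    show "compose (carrier (Grassmann n)) \<sigma> \<tau> \<in> extensional (carrier (Grassmann n))"
      by (rule compose_extensional)
    show "endo_of n (\<lambda>u. ext_of \<sigma> (ext_of \<tau> u)) \<in> extensional (carrier (Grassmann n))"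
      by (simp add: endo_of_def)
    fix f :: "'a grass" assume f: "f \<in> carrier (Grassmann n)"
    then obtain u where u: "f = ecoeff u" "u \<in> Lam n" by (rule carrier_cases)
    then have "ext_of \<tau> u \<in> Lam n" by (intro grass_aut.closed[OF Gamma_grass_aut[OF assms(2)]])
    then show "compose (carrier (Grassmann n)) \<sigma> \<tau> f = endo_of n (\<lambda>u. ext_of \<sigma> (ext_of \<tau> u)) f"
      using f u assms by (simp add: compose_eq endo_of_ecoeff Gamma_ecoeff)
  qed
  finally show ?thesis .
qed

lemma
  assumes "\<sigma> \<in> Gamma n" "\<tau> \<in> Gamma n"
  shows Gamma_mult_closed: "\<sigma> \<otimes>\<^bsub>Gamma_group n\<^esub> \<tau> \<in> Gamma n"
    and ext_of_mult: "u \<in> Lam n \<Longrightarrow> ext_of (\<sigma> \<otimes>\<^bsub>Gamma_group n\<^esub> \<tau>) u = ext_of \<sigma> (ext_of \<tau> u)"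
  using assms
  by (simp_all add: Gamma_mult ext_of_endo_of endo_of_Gamma grass_aut_comp Gamma_grass_aut)

lemma Gamma_one: "\<one>\<^bsub>Gamma_group n\<^esub> = endo_of n (\<lambda>u. u)"
  by (rule ext) (simp add: Gamma_group_def BijGroup_def endo_of_def restrict_def ecoeff_Exterior)

lemma Gamma_one_closed: "\<one>\<^bsub>Gamma_group n\<^esub> \<in> Gamma n"
  unfolding Gamma_one by (intro endo_of_Gamma grass_aut_id)

lemma ext_of_one: "u \<in> Lam n \<Longrightarrow> ext_of \<one>\<^bsub>Gamma_group n\<^esub> u = u"
  unfolding Gamma_one by (rule ext_of_endo_of)

lemma carrier_Gamma_group [simp]: "carrier (Gamma_group n) = Gamma n"
  by (simp add: Gamma_group_def)

text \<open>The quotient is the composite of the inverse of \<sigma> with \<tau>; both the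
  description of cosets and the comparison of two Jacobians go through it.\<close>

lemma Gamma_divide:
  assumes "\<sigma> \<in> Gamma n" "\<tau> \<in> Gamma n"
  shows "\<exists>\<gamma> \<in> Gamma n. \<sigma> \<otimes>\<^bsub>Gamma_group n\<^esub> \<gamma> = \<tau>"
proof -
  obtain t where t: "grass_aut n t" "\<And>f. f \<in> Lam n \<Longrightarrow> ext_of \<sigma> (t f) = f"
    using grass_aut_inverse[OF Gamma_grass_aut[OF assms(1)]] by blast
  let ?\<gamma> = "endo_of n (\<lambda>u. t (ext_of \<tau> u))"
  have \<gamma>: "?\<gamma> \<in> Gamma n" 
    by (rule endo_of_Gamma[OF grass_aut_comp[OF t(1) Gamma_grass_aut[OF assms(2)]]])
  have "\<sigma> \<otimes>\<^bsub>Gamma_group n\<^esub> ?\<gamma> = \<tau>"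
  proof (rule Gamma_eqI)
    fix u :: "'a exterior" assume u: "u \<in> Lam n"
    then have "ext_of \<tau> u \<in> Lam n" by (intro grass_aut.closed[OF Gamma_grass_aut[OF assms(2)]])
    then show "ext_of (\<sigma> \<otimes>\<^bsub>Gamma_group n\<^esub> ?\<gamma>) u = ext_of \<tau> u"
      using u \<gamma> assms by (simp add: ext_of_mult ext_of_endo_of t)
  qed (use assms \<gamma> in \<open>auto intro: Gamma_mult_closed\<close>)
  then show ?thesis using \<gamma> by blast
qed

section \<open>The cocycle identity in \<Gamma> and the cosets of \<Sigma>\<close>

abbreviation gjac :: "nat \<Rightarrow> 'r::comm_ring_1 endo \<Rightarrow> 'r exterior" where
  "gjac n \<sigma> \<equiv> ejac n (ext_of \<sigma>)"

lemma jacobian_ecoeff: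
  assumes "\<sigma> \<in> Gamma n"
  shows "jacobian n \<sigma> = ecoeff (gjac n \<sigma>)"
proof (rule ext)
  fix S
  let ?d = "\<lambda>p i. ederiv (p i) (ext_of \<sigma> (emon {i}))"
  have f: "foldr (\<lambda>i. (\<otimes>\<^bsub>Grassmann n\<^esub>) (skew_deriv (p i) (\<sigma> (gen i)))) xs \<one>\<^bsub>Grassmann n\<^esub> =
    ecoeff (prod_list (map (?d p) xs))" if "set xs \<subseteq> {1..n}" for p xs
    using that
  proof (induction xs)
    case (Cons i xs)
    then have i: "i \<in> {1..n}" by simp
    then have L: "(emon {i} :: 'a exterior) \<in> Lam n" by (intro Lam_emon) simp
    show ?case using Cons
      by (simp add: gen_ecoeff[OF i] Gamma_ecoeff[OF assms L] skew_deriv_ecoeff Grassmann_ecoeff)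
  qed (simp add: Grassmann_ecoeff)
  have f': "foldr (\<lambda>i. (\<otimes>\<^bsub>Grassmann n\<^esub>) (skew_deriv (p i) (\<sigma> (gen i)))) [1..<n+1] \<one>\<^bsub>Grassmann n\<^esub> =
    ecoeff (prod_list (map (?d p) [1..<n+1]))" for p
    by (rule f) (simp only: set_upt_from_1 order_refl)
  show "jacobian n \<sigma> S = ecoeff (gjac n \<sigma>) S"
    unfolding jacobian_def ejac_def ext_det_def f' of_int_sign_mult by simp
qed

lemma gjac_mult:
  assumes "\<sigma> \<in> Gamma n" "\<tau> \<in> Gamma n"
  shows "gjac n (\<sigma> \<otimes>\<^bsub>Gamma_group n\<^esub> \<tau>) = gjac n \<sigma> * ext_of \<sigma> (gjac n \<tau>)"
proof -
  have "gjac n (\<sigma> \<otimes>\<^bsub>Gamma_group n\<^esub> \<tau>) = ejac n (\<lambda>u. ext_of \<sigma> (ext_of \<tau> u))"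
    by (rule ejac_cong) (simp add: ext_of_mult assms Lam_emon)
  then show ?thesis unfolding ejac_comp[OF Gamma_grass_aut[OF assms(1)] Gamma_grass_aut[OF assms(2)]] .
qed

lemma gjac_unit:
  assumes "\<sigma> \<in> Gamma n"
  shows "\<exists>u. u * gjac n \<sigma> = 1"
  using berezin_change_of_variables[OF Gamma_grass_aut[OF assms]] by blast

text \<open>If \<tau> = \<sigma>\<gamma> has the Jacobian of \<sigma>, then J(\<sigma>) =
  J(\<sigma>) \<sigma>(J(\<gamma>)). The unit J(\<sigma>) cancels, and injectivity of \<sigma> gives
  J(\<gamma>) = 1.\<close>

lemma Sigma_coset:
  assumes "\<sigma> \<in> Gamma n"
  shows "\<sigma> <#\<^bsub>Gamma_group n\<^esub> Sigma_group n = {\<tau> \<in> Gamma n. gjac n \<tau> = gjac n \<sigma>}"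
proof (intro equalityI subsetI)
  interpret s: grass_aut n "ext_of \<sigma>" by (rule Gamma_grass_aut) fact
  fix \<tau>
  {
    assume "\<tau> \<in> \<sigma> <#\<^bsub>Gamma_group n\<^esub> Sigma_group n"
    then obtain \<gamma> where \<gamma>: "\<gamma> \<in> Gamma n" "jacobian n \<gamma> = \<one>\<^bsub>Grassmann n\<^esub>"
      "\<tau> = \<sigma> \<otimes>\<^bsub>Gamma_group n\<^esub> \<gamma>" by (auto simp: l_coset_def Sigma_group_def)
    then have "gjac n \<gamma> = 1" by (simp add: jacobian_ecoeff Grassmann_ecoeff ecoeff_inject)
    then show "\<tau> \<in> {\<tau> \<in> Gamma n. gjac n \<tau> = gjac n \<sigma>}"
      using \<gamma> assms by (simp add: gjac_mult Gamma_mult_closed s.hom_one)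
  }
  {
    assume \<tau>: "\<tau> \<in> {\<tau> \<in> Gamma n. gjac n \<tau> = gjac n \<sigma>}"
    then obtain \<gamma> where \<gamma>: "\<gamma> \<in> Gamma n" "\<sigma> \<otimes>\<^bsub>Gamma_group n\<^esub> \<gamma> = \<tau>" using Gamma_divide[OF assms, of \<tau>] by blast
    obtain u where u: "u * gjac n \<sigma> = 1" using gjac_unit[OF assms] by blast
    have "gjac n \<sigma> * ext_of \<sigma> (gjac n \<gamma>) = gjac n \<sigma>" using gjac_mult[OF assms \<gamma>(1)] \<gamma> \<tau> by simp
    then have "u * gjac n \<sigma> * ext_of \<sigma> (gjac n \<gamma>) = u * gjac n \<sigma>" by (simp only: mult.assoc)
    then have "ext_of \<sigma> (gjac n \<gamma>) = ext_of \<sigma> 1" by (simp add: u s.hom_one)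
    then have "gjac n \<gamma> = 1"
      by (rule s.injective[rotated 2]) (simp_all add: grass_aut.ejac_Lam Gamma_grass_aut \<gamma>)
    then have "\<gamma> \<in> Sigma_group n" using \<gamma> by (simp add: Sigma_group_def jacobian_ecoeff Grassmann_ecoeff)
    then show "\<tau> \<in> \<sigma> <#\<^bsub>Gamma_group n\<^esub> Sigma_group n" using \<gamma> by (auto simp: l_coset_def)
  }
qed

section \<open>The coordinates of a coset\<close>

lift_definition epart :: "nat \<Rightarrow> nat \<Rightarrow> 'r::comm_ring_1 exterior \<Rightarrow> 'r exterior" is a_part
  unfolding carrier_Grassmann_iff a_part_def by metis

lemma ecoeff_epart: "ecoeff (epart n i u) S = (if i \<notin> S \<and> {i+1..n} \<subseteq> S then ecoeff u S else 0)"
  by transfer (simp add: a_part_def)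

lemma a_part_ecoeff: "a_part n i (ecoeff u) = ecoeff (epart n i u)"
  by transfer simp

abbreviation homog :: "nat \<Rightarrow> nat \<Rightarrow> 'r::comm_ring_1 exterior set" where
  "homog n d \<equiv> espan {S. S \<subseteq> {1..n} \<and> card S = d}"

lemma epart_homog:
  assumes "u \<in> homog n d"
  shows "epart n i u \<in> espan {S. S \<subseteq> {1..n} \<and> card S = d \<and> i \<notin> S}"
  using assms by (auto simp: espan_def ecoeff_epart split: if_splits)

text \<open>A set containing {i+1..n} has at least n - i > d elements. So the generators left fixed
  by \<open>phi\<close> are the ones with a_i = 0, and x_i (1 + a_i) describes all images
  uniformly.\<close>

lemma epart_zero:
  assumes u: "u \<in> homog n d" and i: "i < n - d"
  shows "epart n i u = 0"
proof (rule exterior_eqI)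
  fix S
  have "ecoeff u S = 0" if "{i+1..n} \<subseteq> S"
  proof (rule ccontr)
    assume "ecoeff u S \<noteq> 0"
    then have S: "S \<subseteq> {1..n}" "card S = d" using u by (auto simp: espan_def)
    then have "card {i+1..n} \<le> d" using that card_mono[of S "{i+1..n}"] by (auto dest: finite_subset)
    then show False using i by simp
  qed
  then show "ecoeff (epart n i u) S = ecoeff 0 S" by (simp add: ecoeff_epart)
qed

text \<open>A set of d < n indices misses some index, and its monomial is counted in exactly one
  part, the one belonging to the largest missing index.\<close>

lemma sum_epart:
  assumes u: "u \<in> homog n d" and d: "d < n"
  shows "(\<Sum>i\<in>{1..n}. epart n i u) = u"
proof (rule exterior_eqI)
  fix S
  show "ecoeff (\<Sum>i\<in>{1..n}. epart n i u) S = ecoeff u S"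
  proof (cases "ecoeff u S = 0")
    case False
    then have S: "S \<subseteq> {1..n}" "card S = d" using u by (auto simp: espan_def)
    define M where "M = {1..n} - S"
    have "M \<noteq> {}"
    proof
      assume "M = {}"
      then have "S = {1..n}" using S by (auto simp: M_def)
      then show False using S d by simp
    qed
    have fin: "finite M" by (simp add: M_def)
    have max: "Max M \<in> M" by (rule Max_in[OF fin \<open>M \<noteq> {}\<close>])
    have "(i \<notin> S \<and> {i+1..n} \<subseteq> S) = (i = Max M)" if i: "i \<in> {1..n}" for i
    proof
      assume *: "i \<notin> S \<and> {i+1..n} \<subseteq> S"
      have "y \<le> i" if "y \<in> M" for y
      proof (rule ccontr)
        assume "\<not> y \<le> i"
        then have "y \<in> {i+1..n}" using that by (auto simp: M_def)
        then show False using * that by (auto simp: M_def)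
      qed
      then show "i = Max M" using * i by (intro Max_eqI[symmetric] fin) (auto simp: M_def)
    next
      assume "i = Max M"
      then have "i \<notin> S" using max by (simp add: M_def)
      moreover have "y \<in> S" if "y \<in> {i+1..n}" for y
      proof (rule ccontr)
        assume "y \<notin> S"
        then have "y \<in> M" using that by (simp add: M_def)
        then have "y \<le> Max M" by (rule Max_ge[OF fin])
        then show False using that \<open>i = Max M\<close> by simp
      qed
      ultimately show "i \<notin> S \<and> {i+1..n} \<subseteq> S" by blast
    qed
    then have "ecoeff (\<Sum>i\<in>{1..n}. epart n i u) S = (\<Sum>i\<in>{1..n}. if i = Max M then ecoeff u S else 0)"
      unfolding ecoeff_sum ecoeff_epart by (intro sum.cong) simp_all
    also have "\<dots> = ecoeff u S" using max by (simp add: M_def)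
    finally show ?thesis .
  qed (auto simp: ecoeff_epart intro!: sum.neutral)
qed

text \<open>The definite description in \<open>phi_def\<close> is proper: the displacements x_i a_i
  are odd of degree 2s + 1 \<ge> 3, so an automorphism with these images exists, and its values on
  generators determine it.\<close>

lemma
  assumes u: "u \<in> homog n (2 * s)" and s: "1 \<le> s" "s \<le> (n - 1) div 2"
  shows phi_Gamma: "phi n s (ecoeff u) \<in> Gamma n"
    and phi_gen: "i \<in> {1..n} \<Longrightarrow> ext_of (phi n s (ecoeff u)) (emon {i}) = emon {i} * (1 + epart n i u)"
proof -
  let ?img = "\<lambda>i. emon {i} * (1 + epart n i u)"
  define y where "y = (\<lambda>i. emon {i} * epart n i u)"
  have y: "y i \<in> pert n" if i: "i \<in> {1..n}" for i
  proof -
    have "(emon {i} :: 'a exterior) \<in> espan {{i}}" by (rule espan_emon) simp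
    then show ?thesis unfolding y_def
      by (rule espan_mult[OF _ epart_homog[OF u]]) (use i s(1) in auto)
  qed
  obtain t where t: "grass_aut n t" "\<And>i. i \<in> {1..n} \<Longrightarrow> t (emon {i}) = emon {i} + y i"
    using grass_aut_exists[of n y, OF y] by blast
  define C where "C = (\<lambda>\<sigma>. \<sigma> \<in> Gamma n \<and> (\<forall>i \<in> {1..n}. \<sigma> (gen i) = (if i < n - 2 * s then gen i
      else gen i \<otimes>\<^bsub>Grassmann n\<^esub> (\<one>\<^bsub>Grassmann n\<^esub> \<oplus>\<^bsub>Grassmann n\<^esub> a_part n i (ecoeff u)))))"
  have C_iff: "C \<sigma> \<longleftrightarrow> \<sigma> \<in> Gamma n \<and> (\<forall>i \<in> {1..n}. ext_of \<sigma> (emon {i}) = ?img i)" for \<sigma>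
  proof -
    have "\<sigma> (gen i) = (if i < n - 2 * s then gen i
      else gen i \<otimes>\<^bsub>Grassmann n\<^esub> (\<one>\<^bsub>Grassmann n\<^esub> \<oplus>\<^bsub>Grassmann n\<^esub> a_part n i (ecoeff u)))
      \<longleftrightarrow> ext_of \<sigma> (emon {i}) = ?img i" if \<sigma>: "\<sigma> \<in> Gamma n" and i: "i \<in> {1..n}" for i
    proof -
      have L: "(emon {i} :: 'a exterior) \<in> Lam n" by (rule Lam_emon) (use i in simp)
      have "(if i < n - 2 * s then gen i
        else gen i \<otimes>\<^bsub>Grassmann n\<^esub> (\<one>\<^bsub>Grassmann n\<^esub> \<oplus>\<^bsub>Grassmann n\<^esub> a_part n i (ecoeff u)))
        = ecoeff (?img i)"
        using epart_zero[OF u, of i] by (simp add: gen_ecoeff[OF i] a_part_ecoeff Grassmann_ecoeff)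
      then show ?thesis using Gamma_ecoeff[OF \<sigma> L] by (simp only: gen_ecoeff[OF i] ecoeff_inject)
    qed
    then show ?thesis unfolding C_def by blast
  qed
  have "C (endo_of n t)"
    unfolding C_iff
  proof (intro conjI ballI)
    show "endo_of n t \<in> Gamma n" by (rule endo_of_Gamma[OF t(1)])
    fix i assume i: "i \<in> {1..n}"
    then have "(emon {i} :: 'a exterior) \<in> Lam n" by (intro Lam_emon) simp
    then show "ext_of (endo_of n t) (emon {i}) = ?img i"
      by (simp add: ext_of_endo_of t(2)[OF i] y_def distrib_left)
  qed
  moreover have "\<sigma> = endo_of n t" if "C \<sigma>" for \<sigma>
    using that calculation unfolding C_iff by (intro Gamma_eq_gens[of _ n]) simp_all
  ultimately have "C (THE \<sigma>. C \<sigma>)" by (rule theI)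
  moreover have "phi n s (ecoeff u) = (THE \<sigma>. C \<sigma>)" unfolding phi_def C_def ..
  ultimately have "C (phi n s (ecoeff u))" by (simp only:)
  then show "phi n s (ecoeff u) \<in> Gamma n"
    "i \<in> {1..n} \<Longrightarrow> ext_of (phi n s (ecoeff u)) (emon {i}) = ?img i"
    unfolding C_iff by blast+
qed

text \<open>Since a_i is free of x_i, the diagonal entries are 1 + a_i, so the trace term of
  \<open>ext_det_near_one\<close> is the sum of all a_i, that is, the given element. All entries
  differ from the identity matrix in degree at least 2s, whence the error bound 4s.\<close>

lemma gjac_phi:
  assumes u: "u \<in> homog n (2 * s)" and s: "1 \<le> s" "s \<le> (n - 1) div 2"
  shows "gjac n (phi n s (ecoeff u)) - (1 + u) \<in> deg_ge (4 * s)"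
proof -
  define m where "m = (\<lambda>i j. ederiv j (ext_of (phi n s (ecoeff u)) (emon {i})))"
  have m: "m i j = (if i = j then 1 + epart n i u else 0) - emon {i} * ederiv j (epart n i u)"
    if i: "i \<in> {1..n}" for i j
  proof -
    have odd: "(emon {i} :: 'a exterior) \<in> odds" by (rule espan_emon) simp
    show ?thesis using i
      by (simp add: m_def phi_gen[OF u s i] ederiv_mult ebar_odd[OF odd] ederiv_emon_single)
  qed
  have e: "epart n i u \<in> deg_ge (2 * s)" for i
    by (rule espan_mono[OF epart_homog[OF u]]) auto
  have xe: "emon {i} * ederiv j (epart n i u) \<in> deg_ge (2 * s)" for i j
  proof -
    \<comment> \<open>The derivative loses one degree, and the factor x_i restores it.\<close>
    have "ederiv j (epart n i u) \<in> deg_ge (2 * s - 1)" by (rule espan_ederiv[OF e]) auto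
    moreover have "(emon {i} :: 'a exterior) \<in> deg_ge 1" by (rule espan_emon) simp
    ultimately have "emon {i} * ederiv j (epart n i u) \<in> deg_ge (1 + (2 * s - 1))"
      by (intro deg_ge_mult)
    then show ?thesis using s by simp
  qed
  have "ext_det n m - (1 + (\<Sum>i\<in>{1..n}. m i i - 1)) \<in> deg_ge (2 * (2 * s))"
  proof (rule ext_det_near_one)
    fix i j assume "i \<in> {1..n}" "j \<in> {1..n}"
    then have "m i j - (if i = j then 1 else 0) =
      (if i = j then epart n i u else 0) - emon {i} * ederiv j (epart n i u)" by (simp add: m)
    then show "m i j - (if i = j then 1 else 0) \<in> deg_ge (2 * s)" using e xe by (auto intro: espan_diff espan_uminus)
  qed
  moreover have "(\<Sum>i\<in>{1..n}. m i i - 1) = u"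
  proof -
    have "(\<Sum>i\<in>{1..n}. m i i - 1) = (\<Sum>i\<in>{1..n}. epart n i u)"
    proof (rule sum.cong)
      fix i assume i: "i \<in> {1..n}"
      have "ederiv i (epart n i u) = 0"
        by (rule exterior_eqI) (simp add: ecoeff_ederiv ecoeff_epart)
      then show "m i i - 1 = epart n i u" by (simp add: m[OF i])
    qed simp
    also have "\<dots> = u" by (rule sum_epart[OF u]) (use s in linarith)
    finally show ?thesis .
  qed
  ultimately show ?thesis by (simp add: ejac_def m_def)
qed

section \<open>Jacobians of products of the automorphisms \<phi>'\<close>

definition coord_part :: "nat \<Rightarrow> (nat set \<Rightarrow> 'r::comm_ring_1) \<Rightarrow> nat \<Rightarrow> 'r exterior" where
  "coord_part n c d = Exterior (\<lambda>S. if S \<subseteq> {1..n} \<and> card S = d then c S else 0)"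

lemma ecoeff_coord_part: "ecoeff (coord_part n c d) = (\<lambda>S. if S \<subseteq> {1..n} \<and> card S = d then c S else 0)"
  unfolding coord_part_def by (rule ecoeff_Exterior[of _ n]) (simp add: carrier_Grassmann_iff)

lemma coord_part_homog: "coord_part n c d \<in> homog n d"
  by (simp add: espan_def ecoeff_coord_part)

text \<open>The list of indices is arbitrary, so that inductions can run over the tails of the
  product defining the coordinates.\<close>

definition coord_product :: "nat \<Rightarrow> (nat set \<Rightarrow> 'r::comm_ring_1) \<Rightarrow> nat list \<Rightarrow> 'r endo" where
  "coord_product n c xs =
    foldr (\<lambda>s. (\<otimes>\<^bsub>Gamma_group n\<^esub>) (phi n s (ecoeff (coord_part n c (2 * s))))) xs \<one>\<^bsub>Gamma_group n\<^esub>"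

lemma coord_product_simps:
  "coord_product n c [] = \<one>\<^bsub>Gamma_group n\<^esub>"
  "coord_product n c (s # xs) =
    phi n s (ecoeff (coord_part n c (2 * s))) \<otimes>\<^bsub>Gamma_group n\<^esub> coord_product n c xs"
  by (simp_all add: coord_product_def)

lemma phi_product_coord:
  "phi_product n (\<lambda>d S. if S \<subseteq> {1..n} \<and> card S = d then c S else 0) =
    coord_product n c [1..<(n - 1) div 2 + 1]"
  by (simp only: phi_product_def coord_product_def ecoeff_coord_part)

lemma phi_coord_Gamma: "1 \<le> s \<Longrightarrow> s \<le> (n - 1) div 2 \<Longrightarrow> phi n s (ecoeff (coord_part n c (2 * s))) \<in> Gamma n"
  by (rule phi_Gamma[OF coord_part_homog])

lemma coord_product_Gamma:
  assumes "set xs \<subseteq> {1..(n - 1) div 2}"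
  shows "coord_product n c xs \<in> Gamma n"
  using assms
proof (induction xs)
  case (Cons s xs)
  then show ?case unfolding coord_product_simps
    by (intro Gamma_mult_closed phi_coord_Gamma) auto
qed (simp add: coord_product_simps Gamma_one_closed)

lemma gjac_coord_product_Cons:
  assumes "set (s # xs) \<subseteq> {1..(n - 1) div 2}"
  shows "gjac n (coord_product n c (s # xs)) = gjac n (phi n s (ecoeff (coord_part n c (2 * s)))) *
    ext_of (phi n s (ecoeff (coord_part n c (2 * s)))) (gjac n (coord_product n c xs))"
  unfolding coord_product_simps
  by (rule gjac_mult) (use assms in \<open>auto intro: phi_coord_Gamma coord_product_Gamma\<close>)

lemma gjac_one: "gjac n (\<one>\<^bsub>Gamma_group n\<^esub> :: 'r::comm_ring_1 endo) = 1"
proof -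
  have "gjac n (\<one>\<^bsub>Gamma_group n\<^esub> :: 'r endo) = ejac n (\<lambda>f. f)"
    by (rule ejac_cong) (simp add: ext_of_one Lam_emon)
  then show ?thesis by (simp add: ejac_id)
qed

text \<open>A factor with index s \<ge> t has Jacobian 1 modulo degree 2t, and unipotent
  automorphisms preserve degree bounds; the cocycle identity combines the two.\<close>

lemma gjac_coord_product_near_one:
  assumes "set xs \<subseteq> {t..(n - 1) div 2}" "1 \<le> t"
  shows "gjac n (coord_product n c xs) - 1 \<in> deg_ge (2 * t)"
  using assms(1)
proof (induction xs)
  case Nil
  show ?case by (simp add: coord_product_simps gjac_one)
next
  case (Cons s xs)
  let ?\<phi> = "phi n s (ecoeff (coord_part n c (2 * s)))" and ?R = "coord_product n c xs"
  have s: "1 \<le> s" "s \<le> (n - 1) div 2" "t \<le> s" using Cons assms(2) by auto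
  have xs: "set (s # xs) \<subseteq> {1..(n - 1) div 2}" using Cons.prems assms(2) by fastforce
  interpret p: grass_aut n "ext_of ?\<phi>" by (rule Gamma_grass_aut[OF phi_coord_Gamma[OF s(1,2)]])
  have R: "?R \<in> Gamma n" by (rule coord_product_Gamma) (use xs in simp)
  have RL: "gjac n ?R \<in> Lam n" by (rule grass_aut.ejac_Lam[OF Gamma_grass_aut[OF R]])
  have IH: "gjac n ?R - 1 \<in> deg_ge (2 * t)" using Cons by simp
  have "ext_of ?\<phi> (gjac n ?R - 1) \<in> deg_ge (2 * t)"
    by (rule p.deg_ge_closed[OF espan_diff[OF RL Lam_one] IH])
  then have Q: "ext_of ?\<phi> (gjac n ?R) - 1 \<in> deg_ge (2 * t)"
    by (simp add: p.hom_diff RL p.hom_one)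
  have "gjac n ?\<phi> - (1 + coord_part n c (2 * s)) \<in> deg_ge (2 * t)"
    by (rule deg_ge_mono[OF gjac_phi[OF coord_part_homog s(1,2)]]) (use s in simp)
  moreover have "coord_part n c (2 * s) \<in> deg_ge (2 * t)"
    by (rule espan_mono[OF coord_part_homog]) (use s in auto)
  ultimately have "gjac n ?\<phi> - (1 + coord_part n c (2 * s)) + coord_part n c (2 * s) \<in> deg_ge (2 * t)"
    by (rule espan_add)
  then have P: "gjac n ?\<phi> - 1 \<in> deg_ge (2 * t)" by simp
  have PQ: "(gjac n ?\<phi> - 1) * (ext_of ?\<phi> (gjac n ?R) - 1) \<in> deg_ge (2 * t)"
    by (rule deg_ge_mono[OF deg_ge_mult[OF P Q]]) simp
  have "gjac n (coord_product n c (s # xs)) - 1 =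
    (gjac n ?\<phi> - 1) * (ext_of ?\<phi> (gjac n ?R) - 1) + (gjac n ?\<phi> - 1) + (ext_of ?\<phi> (gjac n ?R) - 1)"
    unfolding gjac_coord_product_Cons[OF xs] by (simp add: algebra_simps)
  then show ?case using espan_add[OF espan_add[OF PQ P] Q] by (simp only:)
qed

text \<open>Descent in t from s. At t = s only the leading factor reaches degree 2s. Below s both
  products begin with the same factor \<phi>, so their Jacobians differ by J(\<phi>) \<phi>(X),
  where X is the difference for the tails. X starts in degree 2s, and since J(\<phi>) is 1 modulo
  degree 2 and \<phi> is unipotent, its component there is unchanged.\<close>

lemma gjac_triangular:
  fixes c c' :: "nat set \<Rightarrow> 'r::comm_ring_1"
  assumes "1 \<le> t" "t \<le> s" "s \<le> (n - 1) div 2"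
    and eq: "\<And>r. t \<le> r \<Longrightarrow> r < s \<Longrightarrow> coord_part n c (2 * r) = coord_part n c' (2 * r)"
  shows "gjac n (coord_product n c [t..<(n - 1) div 2 + 1]) -
    gjac n (coord_product n c' [t..<(n - 1) div 2 + 1]) -
    (coord_part n c (2 * s) - coord_part n c' (2 * s)) \<in> deg_ge (2 * s + 1)"
  using assms(2,1,3) eq
proof (induction t rule: inc_induct)
  case base
  let ?m = "(n - 1) div 2"
  have list: "[s..<?m + 1] = s # [Suc s..<?m + 1]" using base by (simp add: upt_conv_Cons)
  have set: "set (s # [Suc s..<?m + 1]) \<subseteq> {1..?m}" using base by auto
  have "gjac n (coord_product n d [s..<?m + 1]) - (1 + coord_part n d (2 * s)) \<in> deg_ge (2 * s + 1)"
    for d :: "nat set \<Rightarrow> 'r"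
  proof -
    let ?\<phi> = "phi n s (ecoeff (coord_part n d (2 * s)))" and ?R = "coord_product n d [Suc s..<?m + 1]"
    interpret p: grass_aut n "ext_of ?\<phi>" by (rule Gamma_grass_aut[OF phi_coord_Gamma[OF base(1,2)]])
    have R: "?R \<in> Gamma n" by (rule coord_product_Gamma) (use set in simp)
    have RL: "gjac n ?R \<in> Lam n" by (rule grass_aut.ejac_Lam[OF Gamma_grass_aut[OF R]])
    have "gjac n ?R - 1 \<in> deg_ge (2 * Suc s)"
      by (rule gjac_coord_product_near_one) auto
    then have "ext_of ?\<phi> (gjac n ?R - 1) \<in> deg_ge (2 * Suc s)"
      by (rule p.deg_ge_closed[OF espan_diff[OF RL Lam_one]])
    then have "ext_of ?\<phi> (gjac n ?R) - 1 \<in> deg_ge (2 * Suc s)"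
      by (simp add: p.hom_diff RL p.hom_one)
    then have Q: "ext_of ?\<phi> (gjac n ?R) - 1 \<in> deg_ge (2 * s + 1)" by (rule deg_ge_mono) simp
    have P: "gjac n ?\<phi> - (1 + coord_part n d (2 * s)) \<in> deg_ge (2 * s + 1)"
      by (rule deg_ge_mono[OF gjac_phi[OF coord_part_homog base(1,2)]]) (use base in simp)
    have PQ: "gjac n ?\<phi> * (ext_of ?\<phi> (gjac n ?R) - 1) \<in> deg_ge (2 * s + 1)"
      using deg_ge_mult[OF deg_ge_0 Q] by simp
    have "gjac n (coord_product n d [s..<?m + 1]) - (1 + coord_part n d (2 * s)) =
      gjac n ?\<phi> * (ext_of ?\<phi> (gjac n ?R) - 1) + (gjac n ?\<phi> - (1 + coord_part n d (2 * s)))"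
      unfolding list gjac_coord_product_Cons[OF set] by (simp add: algebra_simps)
    then show ?thesis using espan_add[OF PQ P] by (simp only:)
  qed
  from espan_diff[OF this[of c] this[of c']] show ?case by (simp add: algebra_simps)
next
  case (step t)
  let ?m = "(n - 1) div 2"
  have tm: "1 \<le> t" "t \<le> ?m" using step by auto
  have list: "[t..<?m + 1] = t # [Suc t..<?m + 1]" using tm by (simp add: upt_conv_Cons)
  have set: "set (t # [Suc t..<?m + 1]) \<subseteq> {1..?m}" using tm by auto
  define \<phi> where "\<phi> = phi n t (ecoeff (coord_part n c (2 * t)))"
  have \<phi>': "phi n t (ecoeff (coord_part n c' (2 * t))) = \<phi>"
    unfolding \<phi>_def using step.prems(3)[of t] step.hyps by simp
  have \<phi>: "\<phi> \<in> Gamma n" unfolding \<phi>_def by (rule phi_coord_Gamma[OF tm])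
  interpret p: grass_aut n "ext_of \<phi>" by (rule Gamma_grass_aut[OF \<phi>])
  define J where "J = (\<lambda>d. gjac n (coord_product n d [Suc t..<?m + 1]) :: 'r exterior)"
  have JE: "gjac n (coord_product n d [Suc t..<?m + 1]) = J d" for d by (simp add: J_def)
  have JL: "J d \<in> Lam n" for d
    unfolding J_def
    by (intro grass_aut.ejac_Lam Gamma_grass_aut coord_product_Gamma) (use set in simp)
  define X D where "X = J c - J c'" and "D = coord_part n c (2 * s) - coord_part n c' (2 * s)"
  have IH: "X - D \<in> deg_ge (2 * s + 1)"
    unfolding X_def D_def J_def by (rule step.IH) (use step.prems in auto)
  have D: "D \<in> deg_ge (2 * s)"
    unfolding D_def by (intro espan_diff; rule espan_mono[OF coord_part_homog]; auto)
  have "X - D + D \<in> deg_ge (2 * s)" by (intro espan_add D deg_ge_mono[OF IH]) simp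
  then have X: "X \<in> deg_ge (2 * s)" by simp
  have XL: "X \<in> Lam n" unfolding X_def by (intro espan_diff JL)
  have A: "ext_of \<phi> X - X \<in> deg_ge (2 * s + 1)" using p.deg_ge_diff[OF XL X] by (simp only: Suc_eq_plus1)
  have "(gjac n \<phi> - 1) * ext_of \<phi> X \<in> deg_ge (2 + 2 * s)"
    by (intro deg_ge_mult p.ejac_near_one p.deg_ge_closed XL X)
  then have B: "(gjac n \<phi> - 1) * ext_of \<phi> X \<in> deg_ge (2 * s + 1)" by (rule deg_ge_mono) simp
  have "gjac n (coord_product n c [t..<?m + 1]) - gjac n (coord_product n c' [t..<?m + 1]) =
    gjac n \<phi> * ext_of \<phi> X"
    unfolding list gjac_coord_product_Cons[OF set] \<phi>' \<phi>_def[symmetric] X_def JE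
      p.hom_diff[OF JL JL] right_diff_distrib ..
  then have "gjac n (coord_product n c [t..<?m + 1]) - gjac n (coord_product n c' [t..<?m + 1]) - D =
    (gjac n \<phi> - 1) * ext_of \<phi> X + (ext_of \<phi> X - X) + (X - D)"
    by (simp add: algebra_simps)
  then show ?case using espan_add[OF espan_add[OF B A] IH] by (simp only: D_def)
qed

section \<open>Base change\<close>

text \<open>The case distinction keeps the support bounded when \<open>h 0 \<noteq> 0\<close>.\<close>

lift_definition emap :: "('r::comm_ring_1 \<Rightarrow> 'q::comm_ring_1) \<Rightarrow> 'r exterior \<Rightarrow> 'q exterior" is
  "\<lambda>h f S. if f S = 0 then 0 else h (f S)"
  unfolding carrier_Grassmann_iff by metis

lemma ecoeff_emap_if: "ecoeff (emap h f) S = (if ecoeff f S = 0 then 0 else h (ecoeff f S))"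
  by transfer simp

context comm_ring_hom
begin

lemma ecoeff_emap [simp]: "ecoeff (emap hom f) S = hom (ecoeff f S)"
  by (simp add: ecoeff_emap_if)

lemma hom_inv_sign [simp]: "hom (inv_sign A B) = inv_sign A B"
  by (simp add: inv_sign_def hom_distribs)

lemma emap_add: "emap hom (f + g) = emap hom f + emap hom g"
  by (rule exterior_eqI) (simp add: hom_distribs)

lemma emap_mult: "emap hom (f * g) = emap hom f * emap hom g"
  by (rule exterior_eqI) (simp add: ecoeff_mult hom_distribs)

lemma emap_zero: "emap hom 0 = 0"
  by (rule exterior_eqI) simp

lemma emap_one: "emap hom 1 = 1"
  by (rule exterior_eqI) (simp add: ecoeff_one)

lemma emap_econst: "emap hom (econst c) = econst (hom c)"
  by (rule exterior_eqI) (simp add: ecoeff_econst)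

lemma emap_emon: "finite S \<Longrightarrow> 0 \<notin> S \<Longrightarrow> emap hom (emon S) = emon S"
  by (rule exterior_eqI) (simp add: ecoeff_emon)

lemma emap_gen: "i \<in> {1..n} \<Longrightarrow> emap hom (emon {i}) = emon {i}"
  by (rule emap_emon) auto

lemma emap_ederiv: "emap hom (ederiv j f) = ederiv j (emap hom f)"
  by (rule exterior_eqI) (simp add: ecoeff_ederiv hom_distribs)

lemma emap_epart: "emap hom (epart n i f) = epart n i (emap hom f)"
  by (rule exterior_eqI) (simp add: ecoeff_epart)

lemma emap_espan: "f \<in> espan A \<Longrightarrow> emap hom f \<in> espan A"
  by (auto simp: espan_iff)

lemma emap_sum: "emap hom (sum f A) = (\<Sum>x\<in>A. emap hom (f x))"
  by (induction A rule: infinite_finite_induct) (simp_all add: emap_zero emap_add)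

lemma emap_coord_part: "emap hom (coord_part n c d) = coord_part n (\<lambda>S. hom (c S)) d"
  by (rule exterior_eqI) (simp add: ecoeff_coord_part)

lemma emap_ext_det: "emap hom (ext_det n m) = ext_det n (\<lambda>i j. emap hom (m i j))"
proof -
  have "emap hom (prod_list (map f xs)) = prod_list (map (\<lambda>i. emap hom (f i)) xs)" for f :: "nat \<Rightarrow> _" and xs
    by (induction xs) (simp_all add: emap_one emap_mult)
  moreover have "hom (of_int (sign p)) = of_int (sign p)" for p :: "nat \<Rightarrow> nat"
    by (simp add: sign_def hom_distribs)
  ultimately show ?thesis
    unfolding ext_det_def of_int_sign_mult by (simp add: emap_sum emap_mult emap_econst)
qed

text \<open>The rings of coefficients of s and t differ. Both maps are multiplicative and linear
  over their own scalars, so compatibility with base change has to be tested on the generators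
  only.\<close>

lemma grass_aut_natural:
  assumes s: "grass_aut n s" and t: "grass_aut n t"
    and eq: "\<And>i. i \<in> {1..n} \<Longrightarrow> emap hom (s (emon {i})) = t (emon {i})" and f: "f \<in> Lam n"
  shows "emap hom (s f) = t (emap hom f)"
proof -
  have on_emon: "emap hom (s (emon S)) = t (emon S)" if "finite S" "S \<subseteq> {1..n}" for S
    using that
  proof (induction S rule: finite_linorder_min_induct)
    case empty
    show ?case by (simp add: grass_aut.hom_one[OF s] grass_aut.hom_one[OF t] emap_one)
  next
    case (insert b S)
    have b: "0 \<notin> S" "0 < b" "b \<in> {1..n}" "\<forall>a\<in>S. b < a" "S \<subseteq> {1..n}" using insert by auto
    have L: "(emon {b} :: 'a exterior) \<in> Lam n" "(emon S :: 'a exterior) \<in> Lam n"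
      using b by (auto intro: Lam_emon)
    have "(emon {b} :: 'b exterior) \<in> Lam n" "(emon S :: 'b exterior) \<in> Lam n"
      using b by (auto intro: Lam_emon)
    then show ?case
      unfolding emon_insert_min[OF insert.hyps(1) b(1,2,4)]
      using L b insert.IH
      by (simp add: grass_aut.hom_mult[OF s] grass_aut.hom_mult[OF t] emap_mult eq)
  qed
  from f show ?thesis
  proof (induction rule: espan_induct)
    case zero
    show ?case by (simp add: grass_aut.hom_zero[OF s] grass_aut.hom_zero[OF t] emap_zero)
  next
    case (mon S c)
    then have "(emon S :: 'a exterior) \<in> Lam n" "(emon S :: 'b exterior) \<in> Lam n"
      by (auto intro: Lam_emon)
    then show ?case using mon on_emon[of S]
      by (simp add: grass_aut.hom_econst[OF s] grass_aut.hom_econst[OF t] emap_mult emap_econst emap_emon)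
  next
    case (add f g)
    then show ?case
      by (simp add: grass_aut.hom_add[OF s] grass_aut.hom_add[OF t] emap_add emap_espan)
  qed
qed

text \<open>The images x_i (1 + a_i) are assembled from the coordinates by selecting coefficients,
  with no other constants than 0 and 1, so a ring homomorphism carries each factor to the factor
  with the mapped coordinates.\<close>

lemma coord_product_natural:
  assumes "set xs \<subseteq> {1..(n - 1) div 2}" "f \<in> Lam n"
  shows "emap hom (ext_of (coord_product n c xs) f) =
    ext_of (coord_product n (\<lambda>S. hom (c S)) xs) (emap hom f)"
  using assms
proof (induction xs arbitrary: f)
  case Nil
  then show ?case by (simp add: coord_product_simps ext_of_one emap_espan)
next
  case (Cons s xs)
  let ?\<phi> = "phi n s (ecoeff (coord_part n c (2 * s)))" and ?R = "coord_product n c xs"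
  let ?\<phi>' = "phi n s (ecoeff (coord_part n (\<lambda>S. hom (c S)) (2 * s)))"
    and ?R' = "coord_product n (\<lambda>S. hom (c S)) xs"
  have s: "1 \<le> s" "s \<le> (n - 1) div 2" and xs: "set xs \<subseteq> {1..(n - 1) div 2}" using Cons by auto
  have \<Gamma>: "?\<phi> \<in> Gamma n" "?\<phi>' \<in> Gamma n" "?R \<in> Gamma n" "?R' \<in> Gamma n"
    by (rule phi_coord_Gamma[OF s] coord_product_Gamma[OF xs])+
  have Rf: "ext_of ?R f \<in> Lam n" by (rule grass_aut.closed[OF Gamma_grass_aut[OF \<Gamma>(3)] Cons.prems(2)])
  have "emap hom (ext_of ?\<phi> (ext_of ?R f)) = ext_of ?\<phi>' (emap hom (ext_of ?R f))"
  proof (rule grass_aut_natural[OF Gamma_grass_aut[OF \<Gamma>(1)] Gamma_grass_aut[OF \<Gamma>(2)] _ Rf])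
    fix i assume i: "i \<in> {1..n}"
    then show "emap hom (ext_of ?\<phi> (emon {i})) = ext_of ?\<phi>' (emon {i})"
      by (simp add: phi_gen[OF coord_part_homog s] emap_mult emap_add emap_one emap_epart
          emap_coord_part emap_gen[OF i])
  qed
  also have "emap hom (ext_of ?R f) = ext_of ?R' (emap hom f)" by (rule Cons.IH[OF xs Cons.prems(2)])
  finally show ?case
    using Cons.prems by (simp add: coord_product_simps ext_of_mult \<Gamma> emap_espan)
qed

lemma gjac_natural:
  assumes xs: "set xs \<subseteq> {1..(n - 1) div 2}"
  shows "emap hom (gjac n (coord_product n c xs)) = gjac n (coord_product n (\<lambda>S. hom (c S)) xs)"
  unfolding ejac_def emap_ext_det
proof (rule ext_det_cong)
  fix i j assume i: "i \<in> {1..n}"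
  then have "(emon {i} :: 'a exterior) \<in> Lam n" by (intro Lam_emon) simp
  from coord_product_natural[OF xs this, of c]
  show "emap hom (ederiv j (ext_of (coord_product n c xs) (emon {i}))) =
    ederiv j (ext_of (coord_product n (\<lambda>S. hom (c S)) xs) (emon {i}))"
    by (simp add: emap_ederiv emap_gen[OF i])
qed

end

section \<open>Polynomial algebras\<close>

abbreviation monval :: "('i \<Rightarrow> 'r::comm_ring_1) \<Rightarrow> ('i \<Rightarrow>\<^sub>0 nat) \<Rightarrow> 'r" where
  "monval v m \<equiv> (\<Prod>i\<in>Poly_Mapping.keys m. v i ^ Poly_Mapping.lookup m i)"

lemma monval_superset:
  assumes "finite A" "Poly_Mapping.keys m \<subseteq> A"
  shows "monval v m = (\<Prod>i\<in>A. v i ^ Poly_Mapping.lookup m i)"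
  by (rule prod.mono_neutral_left[OF assms]) (simp add: in_keys_iff)

lemma monval_add: "monval v (a + b) = monval v a * monval v b"
proof -
  let ?A = "Poly_Mapping.keys a \<union> Poly_Mapping.keys b"
  have "monval v (a + b) = (\<Prod>i\<in>?A. v i ^ Poly_Mapping.lookup (a + b) i)"
    by (rule monval_superset) (simp_all add: keys_add)
  also have "\<dots> = (\<Prod>i\<in>?A. v i ^ Poly_Mapping.lookup a i) * (\<Prod>i\<in>?A. v i ^ Poly_Mapping.lookup b i)"
    by (simp add: lookup_add power_add prod.distrib)
  also have "\<dots> = monval v a * monval v b"
    by (simp add: monval_superset[of ?A a] monval_superset[of ?A b])
  finally show ?thesis .
qed

lemma sum_single: "p = (\<Sum>m\<in>Poly_Mapping.keys p. Poly_Mapping.single m (Poly_Mapping.lookup p m))"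
proof (rule poly_mapping_eqI)
  fix k
  have "(\<Sum>m\<in>Poly_Mapping.keys p. Poly_Mapping.lookup (Poly_Mapping.single m (Poly_Mapping.lookup p m)) k) =
    (\<Sum>m\<in>Poly_Mapping.keys p. if m = k then Poly_Mapping.lookup p k else 0)"
    by (rule sum.cong) (auto simp: lookup_single when_def)
  also have "\<dots> = Poly_Mapping.lookup p k" by (simp add: in_keys_iff)
  finally show "Poly_Mapping.lookup p k = Poly_Mapping.lookup
    (\<Sum>m\<in>Poly_Mapping.keys p. Poly_Mapping.single m (Poly_Mapping.lookup p m)) k"
    by (simp add: lookup_sum)
qed

context comm_ring_hom
begin

lemma peval_superset:
  assumes "finite A" "Poly_Mapping.keys p \<subseteq> A"
  shows "peval hom v p = (\<Sum>m\<in>A. hom (Poly_Mapping.lookup p m) * monval v m)"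
  unfolding peval_def by (rule sum.mono_neutral_left[OF assms]) (simp add: in_keys_iff)

lemma peval_single: "peval hom v (Poly_Mapping.single m c) = hom c * monval v m"
  by (cases "c = 0") (simp_all add: peval_def)

lemma peval_add: "peval hom v (p + q) = peval hom v p + peval hom v q"
proof -
  let ?A = "Poly_Mapping.keys p \<union> Poly_Mapping.keys q"
  have "peval hom v (p + q) = (\<Sum>m\<in>?A. hom (Poly_Mapping.lookup (p + q) m) * monval v m)"
    by (rule peval_superset) (simp_all add: keys_add)
  also have "\<dots> = peval hom v p + peval hom v q"
    by (simp add: peval_superset[of ?A p] peval_superset[of ?A q] lookup_add hom_distribs
        distrib_right sum.distrib)
  finally show ?thesis .
qed

lemma peval_sum: "peval hom v (sum f A) = (\<Sum>x\<in>A. peval hom v (f x))"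
proof -
  have "peval hom v 0 = 0" by (simp add: peval_def)
  then show ?thesis by (induction A rule: infinite_finite_induct) (simp_all add: peval_add)
qed

lemma peval_mult: "peval hom v (p * q) = peval hom v p * peval hom v q"
proof -
  have "p * q = (\<Sum>a\<in>Poly_Mapping.keys p. \<Sum>b\<in>Poly_Mapping.keys q.
    Poly_Mapping.single (a + b) (Poly_Mapping.lookup p a * Poly_Mapping.lookup q b))"
    unfolding mult_single[symmetric] sum_product[symmetric] by (simp only: sum_single[symmetric])
  then have "peval hom v (p * q) = (\<Sum>a\<in>Poly_Mapping.keys p. \<Sum>b\<in>Poly_Mapping.keys q.
    (hom (Poly_Mapping.lookup p a) * monval v a) * (hom (Poly_Mapping.lookup q b) * monval v b))"
    by (simp add: peval_sum peval_single monval_add hom_distribs mult_ac)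
  also have "\<dots> = peval hom v p * peval hom v q"
    by (simp add: peval_def sum_product)
  finally show ?thesis .
qed

lemma peval_hom: "comm_ring_hom (peval hom v)"
proof
  show "peval hom v 0 = 0" by (simp add: peval_def)
  show "peval hom v 1 = 1" using peval_single[of v 0 1] by simp
qed (simp_all add: peval_add peval_mult)

lemma peval_pvar [simp]: "peval hom v (pvar i) = v i"
  by (simp add: pvar_def peval_single)

lemma peval_pconst [simp]: "peval hom v (pconst c) = hom c"
  by (simp add: pconst_def peval_single)

lemma hom_peval: "hom (peval h v p) = peval (\<lambda>c. hom (h c)) (\<lambda>i. hom (v i)) p"
  by (simp add: peval_def hom_distribs)

end

lemma pconst_hom: "comm_ring_hom (pconst :: 'k::comm_ring_1 \<Rightarrow> ('i, 'k) mpol)"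
  by unfold_locales (simp_all add: pconst_def single_add mult_single)

lemma id_hom: "comm_ring_hom (id :: 'k::comm_ring_1 \<Rightarrow> 'k)"
  by unfold_locales simp_all

lemma peval_cong:
  assumes "p \<in> carrier (poly_alg I)" "\<And>i. i \<in> I \<Longrightarrow> v i = w i"
  shows "peval h v p = peval h w p"
  unfolding peval_def using assms
  by (intro sum.cong refl arg_cong2[of _ _ _ _ "(*)"] prod.cong arg_cong2[of _ _ _ _ power])
    (auto simp: poly_alg_def)

text \<open>Substituting each variable for itself rebuilds every monomial. This identifies a
  substitution that fixes the variables with the identity.\<close>

lemma peval_self:
  fixes p :: "('i, 'k::comm_ring_1) mpol"
  shows "peval pconst pvar p = p"
proof -
  have pow: "pvar i ^ k = Poly_Mapping.single (Poly_Mapping.single i k) (1 :: 'k)" for i :: 'i and k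
    by (induction k) (simp_all add: pvar_def mult_single single_add[symmetric] plus_1_eq_Suc)
  have prod: "(\<Prod>i\<in>A. Poly_Mapping.single (f i) (1 :: 'k)) = Poly_Mapping.single (\<Sum>i\<in>A. f i) 1"
    for A :: "'i set" and f :: "'i \<Rightarrow> 'i \<Rightarrow>\<^sub>0 nat"
    by (induction A rule: infinite_finite_induct) (simp_all add: mult_single)
  have "pconst c * monval pvar m = Poly_Mapping.single m c" for m :: "'i \<Rightarrow>\<^sub>0 nat" and c :: 'k
    unfolding pow prod sum_single[symmetric] by (simp add: pconst_def mult_single)
  then show ?thesis by (simp add: peval_def sum_single[symmetric])
qed

lemma poly_alg_closed:
  "0 \<in> carrier (poly_alg I)"
  "p \<in> carrier (poly_alg I) \<Longrightarrow> q \<in> carrier (poly_alg I) \<Longrightarrow> p + q \<in> carrier (poly_alg I)"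
  "p \<in> carrier (poly_alg I) \<Longrightarrow> q \<in> carrier (poly_alg I) \<Longrightarrow> p * q \<in> carrier (poly_alg I)"
  "1 \<in> carrier (poly_alg I)" "pconst c \<in> carrier (poly_alg I)"
  "i \<in> I \<Longrightarrow> pvar i \<in> carrier (poly_alg I)"
proof -
  assume pq: "p \<in> carrier (poly_alg I)" "q \<in> carrier (poly_alg I)"
  show "p + q \<in> carrier (poly_alg I)"
    using pq keys_add[of p q] by (fastforce simp: poly_alg_def)
  show "p * q \<in> carrier (poly_alg I)"
    unfolding poly_alg_def
  proof (simp, intro ballI)
    fix m assume "m \<in> Poly_Mapping.keys (p * q)"
    then obtain a b where "m = a + b" "a \<in> Poly_Mapping.keys p" "b \<in> Poly_Mapping.keys q"
      using keys_mult[of p q] by blast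
    moreover from this have "Poly_Mapping.keys a \<subseteq> I" "Poly_Mapping.keys b \<subseteq> I"
      using pq by (simp_all add: poly_alg_def)
    ultimately show "Poly_Mapping.keys m \<subseteq> I" using keys_add[of a b] by blast
  qed
qed (auto simp: poly_alg_def pconst_def pvar_def)

lemma poly_alg_simps [simp]:
  "x \<otimes>\<^bsub>poly_alg I\<^esub> y = x * y" "x \<oplus>\<^bsub>poly_alg I\<^esub> y = x + y" "\<one>\<^bsub>poly_alg I\<^esub> = 1"
  by (simp_all add: poly_alg_def)

lemma peval_closed:
  fixes v :: "'i \<Rightarrow> ('j, 'k::comm_ring_1) mpol"
  assumes v: "\<And>i. i \<in> I \<Longrightarrow> v i \<in> carrier (poly_alg J)" and p: "p \<in> carrier (poly_alg I)"
  shows "peval pconst v p \<in> carrier (poly_alg J)"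
proof -
  have power: "q ^ k \<in> carrier (poly_alg J)" if "q \<in> carrier (poly_alg J)" for q :: "('j, 'k) mpol" and k
    using that by (induction k) (simp_all add: poly_alg_closed)
  have prod: "prod f A \<in> carrier (poly_alg J)" if "\<And>i. i \<in> A \<Longrightarrow> f i \<in> carrier (poly_alg J)"
    for A and f :: "'i \<Rightarrow> ('j, 'k) mpol"
    using that by (induction A rule: infinite_finite_induct) (simp_all add: poly_alg_closed)
  have sum: "sum f A \<in> carrier (poly_alg J)" if "\<And>i. i \<in> A \<Longrightarrow> f i \<in> carrier (poly_alg J)"
    for A and f :: "('i \<Rightarrow>\<^sub>0 nat) \<Rightarrow> ('j, 'k) mpol"
    using that by (induction A rule: infinite_finite_induct) (simp_all add: poly_alg_closed)
  show ?thesis unfolding peval_def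
    by (intro sum poly_alg_closed prod power v) (use p in \<open>auto simp: poly_alg_def\<close>)
qed

text \<open>A composite of two substitutions is again a substitution, so both composites are the
  identity as soon as they fix the variables.\<close>

lemma alg_isosI:
  fixes v :: "'i \<Rightarrow> ('j, 'k::comm_ring_1) mpol" and w :: "'j \<Rightarrow> ('i, 'k) mpol"
  assumes v: "\<And>i. i \<in> I \<Longrightarrow> v i \<in> carrier (poly_alg J)"
    and w: "\<And>j. j \<in> J \<Longrightarrow> w j \<in> carrier (poly_alg I)"
    and wv: "\<And>i. i \<in> I \<Longrightarrow> peval pconst w (v i) = pvar i"
    and vw: "\<And>j. j \<in> J \<Longrightarrow> peval pconst v (w j) = pvar j"
  shows "peval pconst v \<in> alg_isos (poly_alg I) (poly_alg J)"
proof -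
  interpret V: comm_ring_hom "peval pconst v :: ('i, 'k) mpol \<Rightarrow> ('j, 'k) mpol"
    by (rule comm_ring_hom.peval_hom[OF pconst_hom])
  interpret W: comm_ring_hom "peval pconst w :: ('j, 'k) mpol \<Rightarrow> ('i, 'k) mpol"
    by (rule comm_ring_hom.peval_hom[OF pconst_hom])
  note const = comm_ring_hom.peval_pconst[OF pconst_hom]
  have wvp: "peval pconst w (peval pconst v p) = p" if p: "p \<in> carrier (poly_alg I)" for p
  proof -
    have "peval pconst w (peval pconst v p) =
      peval (\<lambda>c. peval pconst w (pconst c)) (\<lambda>i. peval pconst w (v i)) p" by (rule W.hom_peval)
    also have "\<dots> = peval pconst (\<lambda>i. peval pconst w (v i)) p" by (simp only: const)
    also have "\<dots> = peval pconst pvar p" by (rule peval_cong[OF p wv])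
    finally show ?thesis by (simp only: peval_self)
  qed
  have vwp: "peval pconst v (peval pconst w p) = p" if p: "p \<in> carrier (poly_alg J)" for p
  proof -
    have "peval pconst v (peval pconst w p) =
      peval (\<lambda>c. peval pconst v (pconst c)) (\<lambda>j. peval pconst v (w j)) p" by (rule V.hom_peval)
    also have "\<dots> = peval pconst (\<lambda>j. peval pconst v (w j)) p" by (simp only: const)
    also have "\<dots> = peval pconst pvar p" by (rule peval_cong[OF p vw])
    finally show ?thesis by (simp only: peval_self)
  qed
  have "bij_betw (peval pconst v) (carrier (poly_alg I)) (carrier (poly_alg J))"
  proof (rule bij_betw_byWitness[where f' = "peval pconst w"])
    show "peval pconst v ` carrier (poly_alg I) \<subseteq> carrier (poly_alg J)"
      by (rule image_subsetI) (rule peval_closed[OF v])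
    show "peval pconst w ` carrier (poly_alg J) \<subseteq> carrier (poly_alg I)"
      by (rule image_subsetI) (rule peval_closed[OF w])
  qed (simp_all add: wvp vwp)
  moreover have "peval pconst v \<in> Ring.ring_hom (poly_alg I) (poly_alg J)"
    by (rule ring_hom_memI) (simp_all add: peval_closed[OF v] V.hom_mult V.hom_add)
  ultimately show ?thesis by (simp add: alg_isos_def ring_iso_def const)
qed

lemma poly_alg_rename:
  assumes "bij_betw b I J"
  shows "alg_isos (poly_alg I :: ('i, 'k::comm_ring_1) mpol ring) (poly_alg J) \<noteq> {}"
proof -
  note var = comm_ring_hom.peval_pvar[OF pconst_hom]
  have "peval pconst (\<lambda>i. pvar (b i)) \<in>
    alg_isos (poly_alg I :: ('i, 'k) mpol ring) (poly_alg J)"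
  proof (rule alg_isosI[where w = "\<lambda>j. pvar (inv_into I b j)"])
    fix i assume i: "i \<in> I"
    show "pvar (b i) \<in> carrier (poly_alg J)"
      by (rule poly_alg_closed) (use bij_betwE[OF assms] i in blast)
    show "peval pconst (\<lambda>j. pvar (inv_into I b j)) (pvar (b i)) = pvar i"
      using bij_betw_inv_into_left[OF assms i] by (simp add: var)
  next
    fix j assume j: "j \<in> J"
    show "pvar (inv_into I b j) \<in> carrier (poly_alg I)"
      by (rule poly_alg_closed) (use bij_betwE[OF bij_betw_inv_into[OF assms]] j in blast)
    show "peval pconst (\<lambda>i. pvar (b i)) (pvar (inv_into I b j)) = pvar j"
      using bij_betw_inv_into_right[OF assms j] by (simp add: var)
  qed
  then show ?thesis by blast
qed

section \<open>From natural maps of coordinates to isomorphisms of varieties\<close>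

lemma restrict_eqD: "(\<lambda>i\<in>I. f i) = x \<Longrightarrow> i \<in> I \<Longrightarrow> f i = x i"
  by auto

text \<open>A natural bijection of coordinate spaces is polynomial, by evaluation at the generic point
  \<open>\<lambda>i. pvar i\<close>; its inverse is natural as well, hence also polynomial. Membership in the
  polynomial algebra on \<open>I\<close> is invariance under the retraction that kills the other variables.\<close>

lemma natural_bijection_alg_iso:
  fixes T :: "('i \<Rightarrow> ('i, 'k::comm_ring_1) mpol) \<Rightarrow> 'i \<Rightarrow> ('i, 'k) mpol"
  assumes bij: "bij_betw T (I \<rightarrow>\<^sub>E UNIV) (I \<rightarrow>\<^sub>E UNIV)"
    and nat: "\<And>h c. comm_ring_hom h \<Longrightarrow> c \<in> I \<rightarrow>\<^sub>E UNIV \<Longrightarrow> (\<lambda>i\<in>I. h (T c i)) = T (\<lambda>i\<in>I. h (c i))"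
  shows "peval pconst (T (\<lambda>i\<in>I. pvar i)) \<in> alg_isos (poly_alg I) (poly_alg I)"
proof -
  define g where "g = (\<lambda>i\<in>I. pvar i :: ('i, 'k) mpol)"
  have g: "g \<in> I \<rightarrow>\<^sub>E UNIV" by (simp add: g_def)
  \<comment> \<open>The preimage d of the generic point holds the candidate polynomials for the
    inverse, just as \<open>T g\<close> holds those for T.\<close>
  have "g \<in> T ` (I \<rightarrow>\<^sub>E UNIV)" using bij g by (simp add: bij_betw_def)
  then obtain d where d: "d \<in> I \<rightarrow>\<^sub>E UNIV" "T d = g" by (metis imageE)
  have inj: "c = c'" if "T c = T c'" "c \<in> I \<rightarrow>\<^sub>E UNIV" "c' \<in> I \<rightarrow>\<^sub>E UNIV" for c c'
    using bij that by (auto simp: bij_betw_def dest: inj_onD)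
  have Tg: "T g \<in> I \<rightarrow>\<^sub>E UNIV" using bij_betwE[OF bij] g by blast
  note hom = comm_ring_hom.peval_hom[OF pconst_hom]
  note var = comm_ring_hom.peval_pvar[OF pconst_hom]
  let ?F = "peval pconst (T g) :: ('i, 'k) mpol \<Rightarrow> ('i, 'k) mpol"
    and ?G = "peval pconst d :: ('i, 'k) mpol \<Rightarrow> ('i, 'k) mpol"
  define \<rho> where "\<rho> = (peval pconst (\<lambda>i. if i \<in> I then pvar i else 0) :: ('i, 'k) mpol \<Rightarrow> ('i, 'k) mpol)"
  have \<rho>: "comm_ring_hom \<rho>" unfolding \<rho>_def by (rule hom)
  have \<rho>_closed: "\<rho> p \<in> carrier (poly_alg I)" for p
    unfolding \<rho>_def by (rule peval_closed[of UNIV]) (auto simp: poly_alg_closed poly_alg_def[of UNIV])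
  have \<rho>g: "(\<lambda>i\<in>I. \<rho> (g i)) = g" by (auto simp: \<rho>_def g_def var)
  have "(\<lambda>i\<in>I. \<rho> (T g i)) = T g" using nat[OF \<rho> g] by (simp only: \<rho>g)
  note \<rho>T = restrict_eqD[OF this]
  have v: "T g i \<in> carrier (poly_alg I)" if "i \<in> I" for i
    using \<rho>_closed[of "T g i"] by (simp only: \<rho>T[OF that])
  \<comment> \<open>Naturality gives T (\<rho> d) = \<rho> (T d) = \<rho> g = g = T d, and
    injectivity of T makes d invariant under the retraction.\<close>
  have "T (\<lambda>i\<in>I. \<rho> (d i)) = T d" using nat[OF \<rho> d(1)] by (simp only: d(2) \<rho>g)
  then have "(\<lambda>i\<in>I. \<rho> (d i)) = d" by (rule inj[OF _ _ d(1)]) simp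
  note \<rho>d = restrict_eqD[OF this]
  have w: "d i \<in> carrier (poly_alg I)" if "i \<in> I" for i
    using \<rho>_closed[of "d i"] by (simp only: \<rho>d[OF that])
  have "(\<lambda>i\<in>I. ?F (g i)) = T g"
    by (rule extensionalityI[of _ I]) (use Tg in \<open>simp_all add: g_def var PiE_def\<close>)
  \<comment> \<open>Naturality for the homomorphism \<open>?F\<close> itself: T (F d) = F (T d) = F
    g = T g, so F d = g by injectivity.\<close>
  then have "T (\<lambda>i\<in>I. ?F (d i)) = T g" using nat[OF hom d(1), of "T g"] by (simp only: d(2))
  then have "(\<lambda>i\<in>I. ?F (d i)) = g" by (rule inj[OF _ _ g]) simp
  from restrict_eqD[OF this] have vw: "?F (d i) = pvar i" if "i \<in> I" for i
    using that by (simp add: g_def)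
  have "(\<lambda>i\<in>I. ?G (g i)) = d"
    by (rule extensionalityI[of _ I]) (use d(1) in \<open>simp_all add: g_def var PiE_def\<close>)
  \<comment> \<open>Likewise G (T g) = T (G g) = T d = g.\<close>
  then have "(\<lambda>i\<in>I. ?G (T g i)) = g" using nat[OF hom g, of d] by (simp only: d(2))
  from restrict_eqD[OF this] have wv: "?G (T g i) = pvar i" if "i \<in> I" for i
    using that by (simp add: g_def)
  have "?F \<in> alg_isos (poly_alg I) (poly_alg I)" by (rule alg_isosI[OF v w wv vw])
  then show ?thesis by (simp only: g_def)
qed

lemma coordinates_point:
  assumes "has_coordinates V"
  shows "c \<in> coord_space V \<Longrightarrow> coordinates V (point V c) = c"
    and "x \<in> points V \<Longrightarrow> coordinates V x \<in> coord_space V"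
    and "x \<in> points V \<Longrightarrow> point V (coordinates V x) = x"
proof -
  have b: "bij_betw (point V) (coord_space V) (points V)" using assms by (simp add: has_coordinates_def)
  show "c \<in> coord_space V \<Longrightarrow> coordinates V (point V c) = c"
    unfolding coordinates_def by (rule bij_betw_inv_into_left[OF b])
  show "x \<in> points V \<Longrightarrow> coordinates V x \<in> coord_space V"
    unfolding coordinates_def using bij_betwE[OF bij_betw_inv_into[OF b]] by blast
  show "x \<in> points V \<Longrightarrow> point V (coordinates V x) = x"
    unfolding coordinates_def by (rule bij_betw_inv_into_right[OF b])
qed

text \<open>Evaluation at the coordinates c of a point is a ring homomorphism sending the generic
  point to c. Naturality along it says that the polynomials read off from T' at the generic point
  take the value T c at c.\<close>

lemma comorphism_ofI:
  fixes X :: "('p, 'i, 'r::comm_ring_1) variety" and Y :: "('q, 'i, 'r) variety"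
    and T' :: "('i \<Rightarrow> ('i, 'k::comm_ring_1) mpol) \<Rightarrow> 'i \<Rightarrow> ('i, 'k) mpol"
  assumes h: "comm_ring_hom h"
    and X: "has_coordinates X" "coord_index X = I" and Y: "has_coordinates Y" "coord_index Y = I"
    and T: "\<And>c. c \<in> I \<rightarrow>\<^sub>E UNIV \<Longrightarrow> T c \<in> I \<rightarrow>\<^sub>E UNIV"
    and f: "\<And>c. c \<in> I \<rightarrow>\<^sub>E UNIV \<Longrightarrow> f (point X c) = point Y (T c)"
    and nat: "\<And>g c. comm_ring_hom g \<Longrightarrow> c \<in> I \<rightarrow>\<^sub>E UNIV \<Longrightarrow> (\<lambda>i\<in>I. g (T' c i)) = T (\<lambda>i\<in>I. g (c i))"
  shows "comorphism_of h X Y f (peval pconst (T' (\<lambda>i\<in>I. pvar i)))"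
proof -
  have spaces: "coord_space X = I \<rightarrow>\<^sub>E UNIV" "coord_space Y = I \<rightarrow>\<^sub>E UNIV"
    by (simp_all add: coord_space_def X Y)
  note X' = coordinates_point[OF X(1), unfolded spaces] and Y' = coordinates_point[OF Y(1), unfolded spaces]
  have fx: "f x = point Y (T (coordinates X x))" if "x \<in> points X" for x
    using f[OF X'(2)[OF that]] X'(3)[OF that] by simp
  have bY: "point Y c \<in> points Y" if "c \<in> I \<rightarrow>\<^sub>E UNIV" for c
    using Y(1) that bij_betwE[of "point Y" "coord_space Y" "points Y"]
    by (simp add: has_coordinates_def spaces)
  show ?thesis
    unfolding comorphism_of_def
  proof (intro conjI ballI)
    show "f \<in> points X \<rightarrow> points Y" using fx bY T X'(2) by auto
    fix x j assume x: "x \<in> points X" and "j \<in> coord_index Y"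
    then have j: "j \<in> I" by (simp add: Y)
    define c where "c = coordinates X x"
    have c: "c \<in> I \<rightarrow>\<^sub>E UNIV" using X'(2)[OF x] by (simp add: c_def)
    have "(\<lambda>i\<in>I. peval h c ((\<lambda>i\<in>I. pvar i) i)) = c"
      using c by (intro extensionalityI[of _ I]) (auto simp: comm_ring_hom.peval_pvar[OF h] PiE_def)
    then have "(\<lambda>i\<in>I. peval h c (T' (\<lambda>i\<in>I. pvar i) i)) = T c"
      using nat[OF comm_ring_hom.peval_hom[OF h], of "\<lambda>i\<in>I. pvar i" c] by (simp cong: restrict_cong)
    then have "peval h c (T' (\<lambda>i\<in>I. pvar i) j) = T c j" using j
      by (rule restrict_eqD)
    then show "coordinates Y (f x) j = peval h (coordinates X x) (peval pconst (T' (\<lambda>i\<in>I. pvar i)) (pvar j))"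
      by (simp add: fx[OF x] Y'(1) T c c_def[symmetric] comm_ring_hom.peval_pvar[OF pconst_hom])
  qed
qed

text \<open>T and T' are the same coordinate map over 'k and over the polynomial algebra. The
  comorphism is read off from T'; \<open>nat\<close> specializes it to points over 'k, and
  \<open>nat'\<close> yields both its inverse and its validity over the polynomial algebra.\<close>

lemma variety_isoI:
  fixes X :: "('p, 'i, 'k::comm_ring_1) variety" and Y :: "('q, 'i, 'k) variety"
    and X' :: "('p2, 'i, ('i, 'k) mpol) variety" and Y' :: "('q2, 'i, ('i, 'k) mpol) variety"
  assumes X: "has_coordinates X" "coord_index X = I" and Y: "has_coordinates Y" "coord_index Y = I"
    and X': "has_coordinates X'" "coord_index X' = I" and Y': "has_coordinates Y'" "coord_index Y' = I"
    and T: "bij_betw T (I \<rightarrow>\<^sub>E UNIV) (I \<rightarrow>\<^sub>E UNIV)" and T': "bij_betw T' (I \<rightarrow>\<^sub>E UNIV) (I \<rightarrow>\<^sub>E UNIV)"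
    and f: "\<And>c. c \<in> I \<rightarrow>\<^sub>E UNIV \<Longrightarrow> f (point X c) = point Y (T c)"
    and f': "\<And>c. c \<in> I \<rightarrow>\<^sub>E UNIV \<Longrightarrow> f' (point X' c) = point Y' (T' c)"
    and nat: "\<And>g c. comm_ring_hom g \<Longrightarrow> c \<in> I \<rightarrow>\<^sub>E UNIV \<Longrightarrow> (\<lambda>i\<in>I. g (T' c i)) = T (\<lambda>i\<in>I. g (c i))"
    and nat': "\<And>g c. comm_ring_hom g \<Longrightarrow> c \<in> I \<rightarrow>\<^sub>E UNIV \<Longrightarrow> (\<lambda>i\<in>I. g (T' c i)) = T' (\<lambda>i\<in>I. g (c i))"
  shows "variety_iso X Y f X' Y' f'"
proof -
  have "coord_space X = I \<rightarrow>\<^sub>E UNIV" "coord_space Y = I \<rightarrow>\<^sub>E UNIV"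
    by (simp_all add: coord_space_def X Y)
  then have bX: "bij_betw (point X) (I \<rightarrow>\<^sub>E UNIV) (points X)"
    and bY: "bij_betw (point Y) (I \<rightarrow>\<^sub>E UNIV) (points Y)"
    using X(1) Y(1) by (simp_all add: has_coordinates_def)
  have "bij_betw (point Y \<circ> T) (I \<rightarrow>\<^sub>E UNIV) (points Y)" by (rule bij_betw_trans[OF T bY])
  then have "bij_betw (f \<circ> point X) (I \<rightarrow>\<^sub>E UNIV) (points Y)"
    by (subst bij_betw_cong[of _ _ "point Y \<circ> T"]) (simp_all add: f)
  then have "bij_betw f (points X) (points Y)" using bij_betw_comp_iff[OF bX] by blast
  moreover have "comorphism_of id X Y f (peval pconst (T' (\<lambda>i\<in>I. pvar i)))"
    using bij_betwE[OF T] by (intro comorphism_ofI[where T = T] id_hom X Y f nat) auto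
  moreover have "comorphism_of pconst X' Y' f' (peval pconst (T' (\<lambda>i\<in>I. pvar i)))"
    using bij_betwE[OF T'] by (intro comorphism_ofI[where T = T'] pconst_hom X' Y' f' nat') auto
  moreover have "peval pconst (T' (\<lambda>i\<in>I. pvar i)) \<in> alg_isos (poly_alg I) (poly_alg I)"
    by (rule natural_bijection_alg_iso[OF T' nat'])
  ultimately show ?thesis using X Y X' Y' by (auto simp: variety_iso_def regular_functions_def)
qed

section \<open>The Jacobian in coordinates\<close>

text \<open>The difference T c i - c i depends only on coordinates of smaller degree, so T c = e can
  be solved degree by degree, uniquely and without division.\<close>

lemma triangular_bij:
  fixes T :: "('i \<Rightarrow> 'r::ab_group_add) \<Rightarrow> 'i \<Rightarrow> 'r" and deg :: "'i \<Rightarrow> nat"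
  assumes closed: "\<And>c. T c \<in> I \<rightarrow>\<^sub>E UNIV"
    and tri: "\<And>c c' i. i \<in> I \<Longrightarrow> (\<And>j. j \<in> I \<Longrightarrow> deg j < deg i \<Longrightarrow> c j = c' j) \<Longrightarrow>
      T c i - T c' i = c i - c' i"
    and bound: "\<And>i. i \<in> I \<Longrightarrow> deg i < N"
  shows "bij_betw T (I \<rightarrow>\<^sub>E UNIV) (I \<rightarrow>\<^sub>E UNIV)"
proof (rule bij_betwI')
  fix c c' :: "'i \<Rightarrow> 'r" assume c: "c \<in> I \<rightarrow>\<^sub>E UNIV" "c' \<in> I \<rightarrow>\<^sub>E UNIV"
  have "c = c'" if eq: "T c = T c'"
  proof (rule PiE_ext[OF c])
    fix i assume "i \<in> I"
    then show "c i = c' i"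
    proof (induction "deg i" arbitrary: i rule: less_induct)
      case less
      then have "T c i - T c' i = c i - c' i" by (intro tri) auto
      then show ?case by (simp add: eq)
    qed
  qed
  then show "(T c = T c') = (c = c')" by auto
next
  fix c :: "'i \<Rightarrow> 'r"
  show "T c \<in> I \<rightarrow>\<^sub>E UNIV" by (rule closed)
next
  fix e :: "'i \<Rightarrow> 'r" assume e: "e \<in> I \<rightarrow>\<^sub>E UNIV"
  have ex: "\<exists>c \<in> I \<rightarrow>\<^sub>E UNIV. \<forall>i \<in> I. deg i < k \<longrightarrow> T c i = e i" for k
  proof (induction k)
    case 0
    show ?case by (rule bexI[of _ "\<lambda>i\<in>I. 0"]) simp_all
  next
    case (Suc k)
    then obtain c where c: "c \<in> I \<rightarrow>\<^sub>E UNIV" "\<And>i. i \<in> I \<Longrightarrow> deg i < k \<Longrightarrow> T c i = e i" by blast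
    \<comment> \<open>Changing the coordinates of degree k leaves T c below degree k unchanged and
      shifts it in degree k by the same amount, so adding the defect e i - T c i removes it.\<close>
    define c' where "c' = (\<lambda>i\<in>I. if deg i = k then c i + e i - T c i else c i)"
    have same: "c' j = c j" if "j \<in> I" "deg j < k" for j using that by (simp add: c'_def)
    have "T c' i = e i" if i: "i \<in> I" "deg i < Suc k" for i
    proof -
      have "T c' i - T c i = c' i - c i" by (rule tri[OF i(1)]) (use i same in auto)
      then have "T c' i = T c i + (c' i - c i)" by (simp add: algebra_simps)
      then show ?thesis using i c(2)[OF i(1)] by (cases "deg i = k") (auto simp: c'_def)
    qed
    moreover have "c' \<in> I \<rightarrow>\<^sub>E UNIV" by (simp add: c'_def)
    ultimately show ?case by blast
  qed
  obtain c where c: "c \<in> I \<rightarrow>\<^sub>E UNIV" "\<forall>i \<in> I. deg i < N \<longrightarrow> T c i = e i" using ex[of N] by blast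
  have "e = T c" by (rule PiE_ext[OF e closed]) (use c bound in simp)
  then show "\<exists>c \<in> I \<rightarrow>\<^sub>E UNIV. e = T c" using c by blast
qed

abbreviation idx :: "nat \<Rightarrow> nat set set" where
  "idx n \<equiv> {S. S \<subseteq> {1..n} \<and> (\<exists>s\<in>{1..(n - 1) div 2}. card S = 2 * s)}"

abbreviation cprod :: "nat \<Rightarrow> (nat set \<Rightarrow> 'r::comm_ring_1) \<Rightarrow> 'r endo" where
  "cprod n c \<equiv> coord_product n c [1..<(n - 1) div 2 + 1]"

text \<open>Only degrees below n are recorded. For odd n these are all the even degrees; for even n
  the omitted top coefficient is the one killed in the quotient by \<open>E_top n\<close>.\<close>

definition jac_coord :: "nat \<Rightarrow> (nat set \<Rightarrow> 'r::comm_ring_1) \<Rightarrow> nat set \<Rightarrow> 'r" where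
  "jac_coord n c = (\<lambda>S\<in>idx n. ecoeff (gjac n (cprod n c)) S)"

lemma set_cprod: "set [1..<(n - 1) div 2 + 1] \<subseteq> {1..(n - 1) div 2}"
  by (simp only: set_upt_from_1 order_refl)

lemma cprod_Gamma: "cprod n c \<in> Gamma n"
  by (rule coord_product_Gamma[OF set_cprod])

lemma bij_jac_coord: "bij_betw (jac_coord n) (idx n \<rightarrow>\<^sub>E UNIV) (idx n \<rightarrow>\<^sub>E (UNIV :: 'r::comm_ring_1 set))"
proof (rule triangular_bij[where deg = card and N = "n + 1"])
  show "jac_coord n c \<in> idx n \<rightarrow>\<^sub>E UNIV" for c :: "nat set \<Rightarrow> 'r" by (simp add: jac_coord_def)
  show "card S < n + 1" if "S \<in> idx n" for S
    using that card_mono[of "{1..n}" S] by auto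
  fix c c' :: "nat set \<Rightarrow> 'r" and S
  assume S: "S \<in> idx n" and eq: "\<And>S'. S' \<in> idx n \<Longrightarrow> card S' < card S \<Longrightarrow> c S' = c' S'"
  obtain s where s: "1 \<le> s" "s \<le> (n - 1) div 2" "card S = 2 * s" "S \<subseteq> {1..n}" using S by auto
  have "gjac n (cprod n c) - gjac n (cprod n c') -
    (coord_part n c (2 * s) - coord_part n c' (2 * s)) \<in> deg_ge (2 * s + 1)"
  proof (rule gjac_triangular)
    fix r assume r: "1 \<le> r" "r < s"
    show "coord_part n c (2 * r) = coord_part n c' (2 * r)"
    proof (rule exterior_eqI)
      fix S'
      have "c S' = c' S'" if "S' \<subseteq> {1..n}" "card S' = 2 * r" using that r s by (intro eq) auto
      then show "ecoeff (coord_part n c (2 * r)) S' = ecoeff (coord_part n c' (2 * r)) S'"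
        by (simp add: ecoeff_coord_part)
    qed
  qed (use s in auto)
  then have "ecoeff (gjac n (cprod n c) - gjac n (cprod n c') -
    (coord_part n c (2 * s) - coord_part n c' (2 * s))) S = 0"
    by (rule espanD) (simp add: s)
  then show "jac_coord n c S - jac_coord n c' S = c S - c' S"
    using S s by (simp add: jac_coord_def ecoeff_coord_part)
qed

lemma coord_product_cong:
  assumes "\<And>s. s \<in> set xs \<Longrightarrow> coord_part n c (2 * s) = coord_part n c' (2 * s)"
  shows "coord_product n c xs = coord_product n c' xs"
  using assms by (induction xs) (simp_all add: coord_product_simps)

lemma jac_coord_natural:
  assumes "comm_ring_hom h"
  shows "(\<lambda>S\<in>idx n. h (jac_coord n c S)) = jac_coord n (\<lambda>S\<in>idx n. h (c S))"
proof -
  interpret comm_ring_hom h by fact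
  \<comment> \<open>Outside \<open>idx n\<close> the restricted function is
    \<open>undefined\<close>, but the product reads coordinates only at indices in
    \<open>idx n\<close>.\<close>
  have "cprod n (\<lambda>S\<in>idx n. h (c S)) = cprod n (\<lambda>S. h (c S))"
  proof (rule coord_product_cong)
    fix s assume "s \<in> set [1..<(n - 1) div 2 + 1]"
    then have "s \<in> {1..(n - 1) div 2}" using set_cprod by blast
    then show "coord_part n (\<lambda>S\<in>idx n. h (c S)) (2 * s) = coord_part n (\<lambda>S. h (c S)) (2 * s)"
      by (intro exterior_eqI) (auto simp: ecoeff_coord_part)
  qed
  then show ?thesis
    by (auto simp: jac_coord_def gjac_natural[OF set_cprod, symmetric] cong: restrict_cong)
qed

section \<open>Jacobians are determined below degree n\<close>

lemma gjac_support:
  assumes "\<sigma> \<in> Gamma n"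
  shows "gjac n \<sigma> - 1 \<in> espan {S. S \<subseteq> {1..n} \<and> even (card S) \<and> 2 \<le> card S}"
proof -
  interpret grass_aut n "ext_of \<sigma>" by (rule Gamma_grass_aut) fact
  have "gjac n \<sigma> - 1 \<in> Lam n" "gjac n \<sigma> - 1 \<in> evens" "gjac n \<sigma> - 1 \<in> deg_ge 2"
    by (intro espan_diff ejac_Lam ejac_evens Lam_one evens_one ejac_near_one)+
  then show ?thesis by (auto simp: espan_def)
qed

text \<open>An even number is less than n exactly if its half is at most [(n-1)/2].\<close>

lemma idx_alt:
  "idx n = {S. S \<subseteq> {1..n} \<and> even (card S) \<and> 2 \<le> card S \<and> card S < n}"
proof (intro equalityI subsetI)
  fix S assume S: "S \<in> {S. S \<subseteq> {1..n} \<and> even (card S) \<and> 2 \<le> card S \<and> card S < n}"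
  then obtain s where s: "card S = 2 * s" by auto
  then have "s \<in> {1..(n - 1) div 2}" using S by auto
  then show "S \<in> idx n" using S s by auto
qed auto

text \<open>For the quotient \<gamma> with \<tau> = \<sigma>\<gamma>, agreement below degree n
  forces J(\<gamma>) - 1 into degree n, so J(\<gamma>) = 1 + c x_1 ... x_n, and
  \<open>ejac_top_trivial\<close> removes c.\<close>

lemma gjac_determined:
  assumes n: "0 < n" and \<sigma>: "\<sigma> \<in> Gamma n" and \<tau>: "\<tau> \<in> Gamma n"
    and eq: "\<And>S. S \<in> idx n \<Longrightarrow> ecoeff (gjac n \<sigma>) S = ecoeff (gjac n \<tau>) S"
  shows "gjac n \<sigma> = gjac n \<tau>"
proof -
  interpret s: grass_aut n "ext_of \<sigma>" by (rule Gamma_grass_aut[OF \<sigma>])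
  have diff: "gjac n \<tau> - gjac n \<sigma> \<in> deg_ge n"
  proof (rule espanI)
    fix S assume nz: "ecoeff (gjac n \<tau> - gjac n \<sigma>) S \<noteq> 0"
    have "(gjac n \<tau> - 1) - (gjac n \<sigma> - 1) \<in> espan {S. S \<subseteq> {1..n} \<and> even (card S) \<and> 2 \<le> card S}"
      by (intro espan_diff gjac_support \<sigma> \<tau>)
    then have "S \<subseteq> {1..n} \<and> even (card S) \<and> 2 \<le> card S" using nz by (auto simp: espan_def)
    moreover have "S \<notin> idx n" using nz eq by auto
    ultimately show "S \<in> {S. n \<le> card S}" unfolding idx_alt by auto
  qed
  obtain \<gamma> where \<gamma>: "\<gamma> \<in> Gamma n" "\<sigma> \<otimes>\<^bsub>Gamma_group n\<^esub> \<gamma> = \<tau>" using Gamma_divide[OF \<sigma> \<tau>] by blast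
  interpret g: grass_aut n "ext_of \<gamma>" by (rule Gamma_grass_aut[OF \<gamma>(1)])
  obtain u where u: "u * gjac n \<sigma> = 1" using gjac_unit[OF \<sigma>] by blast
  have \<tau>J: "gjac n \<tau> = gjac n \<sigma> * ext_of \<sigma> (gjac n \<gamma>)" using gjac_mult[OF \<sigma> \<gamma>(1)] \<gamma>(2) by simp
  \<comment> \<open>After cancelling the unit J(\<sigma>), the difference becomes
    \<sigma>(J(\<gamma>) - 1), and \<sigma> reflects degree bounds.\<close>
  have "u * (gjac n \<tau> - gjac n \<sigma>) = u * gjac n \<sigma> * (ext_of \<sigma> (gjac n \<gamma>) - 1)"
    by (simp add: \<tau>J algebra_simps)
  then have "u * (gjac n \<tau> - gjac n \<sigma>) = ext_of \<sigma> (gjac n \<gamma> - 1)"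
    by (simp add: u s.hom_diff g.ejac_Lam s.hom_one)
  moreover have "u * (gjac n \<tau> - gjac n \<sigma>) \<in> deg_ge (0 + n)" by (intro deg_ge_mult deg_ge_0 diff)
  ultimately have "ext_of \<sigma> (gjac n \<gamma> - 1) \<in> deg_ge n" by simp
  then have "gjac n \<gamma> - 1 \<in> deg_ge n"
    by (rule s.deg_ge_reflect[rotated]) (intro espan_diff g.ejac_Lam Lam_one)
  moreover have "gjac n \<gamma> - 1 \<in> Lam n" by (intro espan_diff g.ejac_Lam Lam_one)
  ultimately have in_top: "S = {1..n}" if "ecoeff (gjac n \<gamma> - 1) S \<noteq> 0" for S
    using that card_seteq[of "{1..n}" S] unfolding espan_def by auto
  have "gjac n \<gamma> - 1 \<in> espan {{1..n}}"
    by (rule espanI) (use in_top in simp)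
  then have "gjac n \<gamma> - 1 = (\<Sum>S\<in>{{1..n}}. econst (ecoeff (gjac n \<gamma> - 1) S) * emon S)"
    by (rule espan_expand) auto
  then have top: "gjac n \<gamma> = 1 + econst (ecoeff (gjac n \<gamma> - 1) {1..n}) * emon {1..n}"
    by (simp add: algebra_simps)
  then have "ecoeff (gjac n \<gamma> - 1) {1..n} = 0"
    by (rule ejac_top_trivial[OF g.grass_aut_axioms n])
  with top have "gjac n \<gamma> = 1" by simp
  then show ?thesis by (simp add: \<tau>J s.hom_one)
qed

text \<open>Surjectivity of \<open>jac_coord\<close> supplies coordinates matching J(\<sigma>) below
  degree n, and \<open>gjac_determined\<close> extends the match to the whole Jacobian. This is the
  existence of the factorization of \<sigma> modulo \<Sigma>.\<close>

lemma exists_cprod: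
  assumes "0 < n" "\<sigma> \<in> Gamma n"
  shows "\<exists>c \<in> idx n \<rightarrow>\<^sub>E UNIV. gjac n (cprod n c) = gjac n \<sigma>"
proof -
  define e where "e = (\<lambda>S\<in>idx n. ecoeff (gjac n \<sigma>) S)"
  have "e \<in> idx n \<rightarrow>\<^sub>E UNIV" unfolding e_def restrict_PiE_iff by blast
  then have "e \<in> jac_coord n ` (idx n \<rightarrow>\<^sub>E UNIV)"
    by (subst bij_betw_imp_surj_on[OF bij_jac_coord])
  then obtain c where c: "c \<in> idx n \<rightarrow>\<^sub>E UNIV" "e = jac_coord n c"
    by (elim imageE)
  have "gjac n (cprod n c) = gjac n \<sigma>"
  proof (rule gjac_determined[OF assms(1) cprod_Gamma assms(2)])
    fix S assume "S \<in> idx n"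
    then show "ecoeff (gjac n (cprod n c)) S = ecoeff (gjac n \<sigma>) S"
      using fun_cong[OF c(2), of S] by (simp add: jac_coord_def e_def)
  qed
  then show ?thesis using c by blast
qed

section \<open>Coordinates on \<Gamma>/\<Sigma> and maps induced on it\<close>

lemma coord_space_Gamma: "coord_space (Gamma_mod_Sigma n) = idx n \<rightarrow>\<^sub>E UNIV"
  by (simp add: coord_space_def Gamma_mod_Sigma_def)

lemma coord_index_Gamma: "coord_index (Gamma_mod_Sigma n) = idx n"
  by (simp add: Gamma_mod_Sigma_def)

lemma point_Gamma: "point (Gamma_mod_Sigma n) c = {\<tau> \<in> Gamma n. gjac n \<tau> = gjac n (cprod n c)}"
  unfolding Gamma_mod_Sigma_def variety.simps phi_product_coord by (rule Sigma_coset[OF cprod_Gamma])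

lemma has_coordinates_Gamma:
  assumes "0 < n"
  shows "has_coordinates (Gamma_mod_Sigma n :: ('r::comm_ring_1 endo set, nat set, 'r) variety)"
proof -
  let ?V = "Gamma_mod_Sigma n :: ('r endo set, nat set, 'r) variety"
  have points: "points ?V = {{\<tau> \<in> Gamma n. gjac n \<tau> = gjac n \<sigma>} | \<sigma>. \<sigma> \<in> Gamma n}"
    by (auto simp: Gamma_mod_Sigma_def LCOSETS_def Sigma_coset)
  have "bij_betw (point ?V) (idx n \<rightarrow>\<^sub>E UNIV) (points ?V)"
  proof (rule bij_betwI')
    fix c c' :: "nat set \<Rightarrow> 'r" assume c: "c \<in> idx n \<rightarrow>\<^sub>E UNIV" "c' \<in> idx n \<rightarrow>\<^sub>E UNIV"
    have "c = c'" if "point ?V c = point ?V c'"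
    proof -
      have "cprod n c \<in> point ?V c" by (simp add: point_Gamma cprod_Gamma)
      then have "cprod n c \<in> point ?V c'" by (simp only: that)
      then have "gjac n (cprod n c) = gjac n (cprod n c')" unfolding point_Gamma by blast
      then have "jac_coord n c = jac_coord n c'" by (simp add: jac_coord_def)
      then show "c = c'" by (rule inj_onD[OF bij_betw_imp_inj_on[OF bij_jac_coord] _ c])
    qed
    then show "(point ?V c = point ?V c') = (c = c')" by auto
  next
    fix c :: "nat set \<Rightarrow> 'r"
    show "point ?V c \<in> points ?V" unfolding points point_Gamma using cprod_Gamma by blast
  next
    fix x assume "x \<in> points ?V"
    then obtain \<sigma> where \<sigma>: "\<sigma> \<in> Gamma n" "x = {\<tau> \<in> Gamma n. gjac n \<tau> = gjac n \<sigma>}" by (auto simp: points)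
    then obtain c where "c \<in> idx n \<rightarrow>\<^sub>E UNIV" "gjac n (cprod n c) = gjac n \<sigma>" using exists_cprod[OF assms] by blast
    then show "\<exists>c \<in> idx n \<rightarrow>\<^sub>E UNIV. x = point ?V c" using \<sigma> by (intro bexI[of _ c]) (simp_all add: point_Gamma)
  qed
  then show ?thesis unfolding has_coordinates_def coord_space_Gamma .
qed

lemma the_elem_const:
  assumes "x \<in> C" "\<And>y. y \<in> C \<Longrightarrow> g y = g x"
  shows "coset_map g C = g x"
proof -
  have "g ` C = (\<lambda>_. g x) ` C" by (rule image_cong[OF refl assms(2)])
  then have "g ` C = {g x}" using assms(1) by auto
  then show ?thesis by (simp add: coset_map_def)
qed

text \<open>A coset is a fibre of the Jacobian, so any function g that factors through the Jacobian
  is constant on it. Here g' is the identity for odd n and passage to a coset of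
  \<open>E_top n\<close> for even n.\<close>

lemma coset_map_Gamma:
  assumes "\<sigma> \<in> Gamma n" "\<And>\<tau>. \<tau> \<in> Gamma n \<Longrightarrow> g \<tau> = g' (jacobian n \<tau>)"
  shows "coset_map g {\<tau> \<in> Gamma n. gjac n \<tau> = gjac n \<sigma>} = g' (jacobian n \<sigma>)"
proof -
  have "coset_map g {\<tau> \<in> Gamma n. gjac n \<tau> = gjac n \<sigma>} = g \<sigma>"
    by (rule the_elem_const) (use assms in \<open>auto simp: jacobian_ecoeff\<close>)
  then show ?thesis using assms by simp
qed

section \<open>The target varieties\<close>

abbreviation evidx :: "nat \<Rightarrow> nat set set" where
  "evidx n \<equiv> {S. S \<subseteq> {1..n} \<and> even (card S) \<and> 2 \<le> card S}"

lemma idx_odd: "odd n \<Longrightarrow> idx n = evidx n"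
proof -
  assume "odd n"
  have "card S < n" if "S \<in> evidx n" for S
  proof -
    have "card S \<le> n" using that card_mono[of "{1..n}" S] by auto
    then show ?thesis using that \<open>odd n\<close> by (cases "card S = n") auto
  qed
  then show "idx n = evidx n" unfolding idx_alt by blast
qed

lemma E_carrier_ecoeff: "f \<in> carrier (E_group n) \<longleftrightarrow> (\<exists>u. f = ecoeff (1 + u) \<and> u \<in> espan (evidx n))"
proof
  assume "f \<in> carrier (E_group n)"
  then obtain g where g: "f = \<one>\<^bsub>Grassmann n\<^esub> \<oplus>\<^bsub>Grassmann n\<^esub> g" "g \<in> degrees n (\<lambda>d. even d \<and> 2 \<le> d)"
    by (auto simp: E_group_def)
  from g(2) obtain u where "g = ecoeff u" "u \<in> espan (evidx n)" by (rule degrees_cases)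
  then show "\<exists>u. f = ecoeff (1 + u) \<and> u \<in> espan (evidx n)" using g by (auto simp: Grassmann_ecoeff)
next
  assume "\<exists>u. f = ecoeff (1 + u) \<and> u \<in> espan (evidx n)"
  then obtain u where u: "f = ecoeff (1 + u)" "u \<in> espan (evidx n)" by blast
  then have "f = \<one>\<^bsub>Grassmann n\<^esub> \<oplus>\<^bsub>Grassmann n\<^esub> ecoeff u" "ecoeff u \<in> degrees n (\<lambda>d. even d \<and> 2 \<le> d)"
    by (simp_all only: Grassmann_ecoeff degrees_ecoeff)
  then show "f \<in> carrier (E_group n)" unfolding E_group_def by (simp, blast)
qed

lemma E_carrier_iff: "f \<in> carrier (E_group n) \<longleftrightarrow> (\<forall>S. S \<notin> evidx n \<longrightarrow> f S = xmon {} S)"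
proof
  assume "f \<in> carrier (E_group n)"
  then obtain u where "f = ecoeff (1 + u)" "u \<in> espan (evidx n)" unfolding E_carrier_ecoeff by blast
  then show "\<forall>S. S \<notin> evidx n \<longrightarrow> f S = xmon {} S" by (simp add: espan_iff ecoeff_one xmon_def)
next
  assume f: "\<forall>S. S \<notin> evidx n \<longrightarrow> f S = xmon {} S"
  define u where "u = Exterior (\<lambda>S. f S - xmon {} S)"
  have eu: "ecoeff u = (\<lambda>S. f S - xmon {} S)"
    unfolding u_def by (rule ecoeff_Exterior[of _ n]) (use f in \<open>auto simp: carrier_Grassmann_iff\<close>)
  have "f = ecoeff (1 + u)" by (rule ext) (simp add: eu ecoeff_one xmon_def)
  moreover have "u \<in> espan (evidx n)" using f by (simp add: espan_iff eu)
  ultimately show "f \<in> carrier (E_group n)" unfolding E_carrier_ecoeff by blast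
qed

lemma jacobian_E_group:
  assumes "\<sigma> \<in> Gamma n"
  shows "jacobian n \<sigma> \<in> carrier (E_group n)"
  unfolding E_carrier_ecoeff
  by (rule exI[of _ "gjac n \<sigma> - 1"]) (use gjac_support[OF assms] in \<open>simp add: jacobian_ecoeff[OF assms]\<close>)

lemma E_point_carrier: "I \<subseteq> evidx n \<Longrightarrow> E_point I c \<in> carrier (E_group n)"
  unfolding E_carrier_iff by (auto simp: E_point_def)

lemma E_variety_simps:
  "coord_index (E_variety n) = evidx n" "points (E_variety n) = carrier (E_group n)"
  "point (E_variety n) = E_point (evidx n)"
  by (simp_all add: E_variety_def Let_def)

lemma E_mod_top_simps:
  "coord_index (E_mod_top n) = idx n" "points (E_mod_top n) = lcosets\<^bsub>E_group n\<^esub> (E_top n)"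
  "point (E_mod_top n) = (\<lambda>c. E_point (idx n) c <#\<^bsub>E_group n\<^esub> E_top n)"
  unfolding idx_alt by (simp_all add: E_mod_top_def Let_def)

lemma has_coordinates_E: "has_coordinates (E_variety n :: ('r::comm_ring_1 grass, nat set, 'r) variety)"
proof -
  have "bij_betw (E_point (evidx n)) (evidx n \<rightarrow>\<^sub>E UNIV) (carrier (E_group n) :: 'r grass set)"
  proof (rule bij_betwI')
    fix c c' :: "nat set \<Rightarrow> 'r" assume c: "c \<in> evidx n \<rightarrow>\<^sub>E UNIV" "c' \<in> evidx n \<rightarrow>\<^sub>E UNIV"
    have "c = c'" if "E_point (evidx n) c = E_point (evidx n) c'"
    proof (rule PiE_ext[OF c])
      fix S assume "S \<in> evidx n"
      then show "c S = c' S" using fun_cong[OF that, of S] by (simp add: E_point_def)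
    qed
    then show "(E_point (evidx n) c = E_point (evidx n) c') = (c = c')" by auto
  next
    fix c :: "nat set \<Rightarrow> 'r"
    show "E_point (evidx n) c \<in> carrier (E_group n)" by (rule E_point_carrier) simp
  next
    fix f :: "'r grass" assume f: "f \<in> carrier (E_group n)"
    have "f = E_point (evidx n) (restrict f (evidx n))"
      using f unfolding E_carrier_iff by (intro ext) (simp add: E_point_def)
    then show "\<exists>c \<in> evidx n \<rightarrow>\<^sub>E UNIV. f = E_point (evidx n) c"
      by (rule bexI[of _ "restrict f (evidx n)"]) (unfold restrict_PiE_iff, blast)
  qed
  then show ?thesis by (simp add: has_coordinates_def coord_space_def E_variety_simps)
qed

text \<open>The product of x_1 ... x_n with an element of positive degree is 0, so multiplying f by
  1 + c x_1 ... x_n only adds c to the top coefficient.\<close>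

lemma E_top_coset:
  assumes n: "even n" "2 \<le> n" and f: "f \<in> carrier (E_group n)"
  shows "f <#\<^bsub>E_group n\<^esub> E_top n = {g \<in> carrier (E_group n). \<forall>S \<in> idx n. g S = f S}"
proof -
  obtain u where u: "f = ecoeff (1 + u)" "u \<in> espan (evidx n)" using f unfolding E_carrier_ecoeff by blast
  have mult: "f \<otimes>\<^bsub>E_group n\<^esub> (\<one>\<^bsub>Grassmann n\<^esub> \<oplus>\<^bsub>Grassmann n\<^esub> scale c (xmon {1..n})) =
    (\<lambda>S. f S + (if S = {1..n} then c else 0))" for c
  proof -
    define t where "t = econst c * emon {1..n}"
    have uL: "u \<in> Lam n" and u2: "u \<in> deg_ge 2" by (rule espan_mono[OF u(2)], auto)+
    have tL: "t \<in> Lam n" and tn: "t \<in> deg_ge n"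
      unfolding t_def by (intro espan_econst_mult espan_emon, simp)+
    have "u * t \<in> deg_ge (Suc n)" by (rule deg_ge_mono[OF deg_ge_mult[OF u2 tn]]) simp
    then have "u * t = 0" using Lam_mult[OF uL tL] by (intro Lam_deg_gt)
    then have "(1 + u) * (1 + t) = 1 + u + t" by (simp add: distrib_left distrib_right add.assoc)
    moreover have "f \<otimes>\<^bsub>E_group n\<^esub> (\<one>\<^bsub>Grassmann n\<^esub> \<oplus>\<^bsub>Grassmann n\<^esub> scale c (xmon {1..n})) =
      ecoeff ((1 + u) * (1 + t))"
      unfolding t_def u(1) using xmon_ecoeff[of "{1..n}", where 'a = 'a]
      by (simp add: E_group_def Grassmann_ecoeff scale_ecoeff del: ecoeff_econst_mult ecoeff_add)
    ultimately show ?thesis by (simp add: fun_eq_iff u(1) t_def ecoeff_emon)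
  qed
  \<comment> \<open>Evenness of n makes the top monomial an element of \<open>evidx n\<close>, so
    changing its coefficient does not leave the group.\<close>
  have top: "{1..n} \<notin> idx n" "{1..n} \<in> evidx n" using n unfolding idx_alt by auto
  have coset: "f <#\<^bsub>E_group n\<^esub> E_top n = {\<lambda>S. f S + (if S = {1..n} then c else 0) | c. True}"
    unfolding l_coset_def E_top_def by (auto simp: mult)
  show ?thesis
    unfolding coset
  proof (intro equalityI subsetI)
    fix g assume "g \<in> {\<lambda>S. f S + (if S = {1..n} then c else 0) | c. True}"
    then obtain c where g: "g = (\<lambda>S. f S + (if S = {1..n} then c else 0))" by blast
    then show "g \<in> {g \<in> carrier (E_group n). \<forall>S \<in> idx n. g S = f S}"
      using f top unfolding E_carrier_iff by auto
  next
    fix g assume g: "g \<in> {g \<in> carrier (E_group n). \<forall>S \<in> idx n. g S = f S}"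
    have "g S = f S" if "S \<noteq> {1..n}" for S
    proof (cases "S \<in> idx n")
      case False
      have "S \<notin> evidx n"
      proof
        assume S: "S \<in> evidx n"
        then have "n \<le> card S" using False unfolding idx_alt by auto
        then have "S = {1..n}" using S by (intro card_seteq) auto
        then show False using that by simp
      qed
      then show ?thesis using f g unfolding E_carrier_iff by auto
    qed (use g in auto)
    then have "g = (\<lambda>S. f S + (if S = {1..n} then g {1..n} - f {1..n} else 0))" by auto
    then show "g \<in> {\<lambda>S. f S + (if S = {1..n} then c else 0) | c. True}" by blast
  qed
qed

lemma has_coordinates_E_mod_top:
  assumes n: "even n" "2 \<le> n"
  shows "has_coordinates (E_mod_top n :: ('r::comm_ring_1 grass set, nat set, 'r) variety)"
proof -
  have sub: "idx n \<subseteq> evidx n" unfolding idx_alt by blast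
  define pt where "pt = (\<lambda>c :: nat set \<Rightarrow> 'r. E_point (idx n) c <#\<^bsub>E_group n\<^esub> E_top n)"
  have pt: "pt c = {g \<in> carrier (E_group n). \<forall>S \<in> idx n. g S = c S}" for c
    unfolding pt_def by (subst E_top_coset[OF n E_point_carrier[OF sub]]) (simp add: E_point_def)
  have "bij_betw pt (idx n \<rightarrow>\<^sub>E UNIV) (lcosets\<^bsub>E_group n\<^esub> (E_top n))"
  proof (rule bij_betwI')
    fix c c' :: "nat set \<Rightarrow> 'r" assume c: "c \<in> idx n \<rightarrow>\<^sub>E UNIV" "c' \<in> idx n \<rightarrow>\<^sub>E UNIV"
    have "c = c'" if "pt c = pt c'"
    proof (rule PiE_ext[OF c])
      fix S assume S: "S \<in> idx n"
      have "E_point (idx n) c \<in> pt c" using E_point_carrier[OF sub] by (simp add: pt E_point_def)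
      then have "\<forall>S \<in> idx n. E_point (idx n) c S = c' S" unfolding that unfolding pt by blast
      then show "c S = c' S" using S by (simp add: E_point_def)
    qed
    then show "(pt c = pt c') = (c = c')" by auto
  next
    fix c :: "nat set \<Rightarrow> 'r"
    show "pt c \<in> lcosets\<^bsub>E_group n\<^esub> (E_top n)"
      unfolding pt_def LCOSETS_def using E_point_carrier[OF sub] by blast
  next
    fix x :: "'r grass set" assume "x \<in> lcosets\<^bsub>E_group n\<^esub> (E_top n)"
    then obtain f where f: "f \<in> carrier (E_group n)" "x = f <#\<^bsub>E_group n\<^esub> E_top n" by (auto simp: LCOSETS_def)
    then have "x = pt (restrict f (idx n))" by (simp only: E_top_coset[OF n]) (simp add: pt cong: ball_cong)
    then show "\<exists>c \<in> idx n \<rightarrow>\<^sub>E UNIV. x = pt c"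
      by (rule bexI[of _ "restrict f (idx n)"]) (unfold restrict_PiE_iff, blast)
  qed
  then show ?thesis unfolding has_coordinates_def coord_space_def E_mod_top_simps pt_def .
qed

section \<open>Dimension\<close>

text \<open>The subset of {1..n-1} can be chosen freely; membership of n is then forced by
  parity.\<close>

lemma card_even_subsets:
  assumes "0 < n"
  shows "card {S. S \<subseteq> {1..n} \<and> even (card S)} = 2 ^ (n - 1)"
proof -
  let ?X = "{1..n - 1}"
  let ?f = "\<lambda>A. if even (card A) then A else insert n A"
  have n: "{1..n} = insert n ?X" "n \<notin> ?X" using assms by auto
  have "bij_betw ?f (Pow ?X) {S. S \<subseteq> {1..n} \<and> even (card S)}"
  proof (rule bij_betw_byWitness[where f' = "\<lambda>S. S - {n}"])
    show "\<forall>A\<in>Pow ?X. ?f A - {n} = A" using n by auto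
    show "\<forall>S\<in>{S. S \<subseteq> {1..n} \<and> even (card S)}. ?f (S - {n}) = S"
    proof
      fix S assume S: "S \<in> {S. S \<subseteq> {1..n} \<and> even (card S)}"
      then have "finite S" by (auto dest: finite_subset)
      then show "?f (S - {n}) = S"
        using S by (cases "n \<in> S") (auto simp: card_Diff_singleton_if card_gt_0_iff insert_absorb)
    qed
    show "?f ` Pow ?X \<subseteq> {S. S \<subseteq> {1..n} \<and> even (card S)}"
    proof
      fix S assume "S \<in> ?f ` Pow ?X"
      then obtain A where A: "A \<subseteq> ?X" "S = ?f A" by auto
      then have "finite A" "n \<notin> A" using n by (auto dest: finite_subset)
      then show "S \<in> {S. S \<subseteq> {1..n} \<and> even (card S)}" using A n by auto
    qed
    show "(\<lambda>S. S - {n}) ` {S. S \<subseteq> {1..n} \<and> even (card S)} \<subseteq> Pow ?X" using n by auto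
  qed
  from bij_betw_same_card[OF this] show ?thesis by (simp add: card_Pow)
qed

lemma card_idx:
  assumes "2 \<le> n"
  shows "card (idx n) = 2 ^ (n - 1) - (if odd n then 1 else 2)"
proof -
  \<comment> \<open>The set ?D collects the even subsets that index no coordinate: the empty set,
    whose coefficient is fixed to 1, and for even n also the top set.\<close>
  let ?E = "{S. S \<subseteq> {1..n} \<and> even (card S)}" and ?D = "if odd n then {{}} else {{}, {1..n}}"
  have "idx n = ?E - ?D"
  proof (intro equalityI subsetI)
    fix S assume "S \<in> idx n"
    then show "S \<in> ?E - ?D" unfolding idx_alt by (auto split: if_splits)
  next
    fix S assume S: "S \<in> ?E - ?D"
    then have fin: "finite S" "S \<noteq> {}" by (auto dest: finite_subset split: if_splits)
    then have "card S \<noteq> 0" by simp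
    then have "2 \<le> card S" using S by (cases "card S = 1") auto
    moreover have "card S < n"
    proof -
      have "card S \<le> n" using S card_mono[of "{1..n}" S] by auto
      moreover have "card S \<noteq> n"
      proof
        assume "card S = n"
        then have "S = {1..n}" using S by (intro card_seteq) auto
        then show False using S \<open>card S = n\<close> by (auto split: if_splits)
      qed
      ultimately show ?thesis by simp
    qed
    ultimately show "S \<in> idx n" using S unfolding idx_alt by auto
  qed
  moreover have "?D \<subseteq> ?E" by auto
  moreover have "card ?D = (if odd n then 1 else 2)" using assms by auto
  ultimately show ?thesis
    using card_even_subsets[of n] assms by (simp add: card_Diff_subset)
qed

lemma affine_Gamma:
  assumes "2 \<le> n"
  shows "affine_of_dim (Gamma_mod_Sigma n :: ('r::comm_ring_1 endo set, nat set, 'r) variety)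
    (2 ^ (n - 1) - (if odd n then 1 else 2))"
proof -
  have "finite (idx n)" by (rule finite_subset[of _ "Pow {1..n}"]) auto
  then obtain b where b: "bij_betw b (idx n) {..<card (idx n)}"
    using ex_bij_betw_finite_nat[of "idx n"] by (auto simp: atLeast0LessThan)
  show ?thesis
    unfolding affine_of_dim_def regular_functions_def coord_index_Gamma card_idx[OF assms, symmetric]
    by (intro conjI has_coordinates_Gamma poly_alg_rename[OF b]) (use assms in simp)
qed

section \<open>The Jacobian map as an isomorphism of varieties\<close>

lemma variety_iso_odd:
  assumes n: "odd n"
  shows "variety_iso (Gamma_mod_Sigma n) (E_variety n) (jac_odd n :: 'k::comm_ring_1 endo set \<Rightarrow> _)
    (Gamma_mod_Sigma n) (E_variety n) (jac_odd n)"
proof -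
  have n0: "0 < n" using n by (cases n) auto
  \<comment> \<open>The type 'r stays general, because this fact serves both for points over 'k and
    for points over the polynomial algebra.\<close>
  have f: "jac_odd n (point (Gamma_mod_Sigma n) c) = point (E_variety n) (jac_coord n c)"
    for c :: "nat set \<Rightarrow> 'r::comm_ring_1"
  proof -
    have J: "jacobian n (cprod n c) \<in> carrier (E_group n)" by (rule jacobian_E_group[OF cprod_Gamma])
    have "jac_odd n (point (Gamma_mod_Sigma n) c) = jacobian n (cprod n c)"
      unfolding jac_odd_def point_Gamma by (rule coset_map_Gamma[where g' = "\<lambda>x. x"]) (simp_all add: cprod_Gamma)
    also have "\<dots> = E_point (idx n) (jac_coord n c)"
      using J unfolding E_carrier_iff idx_odd[OF n, symmetric]
      by (intro ext) (simp add: E_point_def jac_coord_def jacobian_ecoeff[OF cprod_Gamma])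
    finally show ?thesis by (simp only: E_variety_simps idx_odd[OF n])
  qed
  show ?thesis
    by (rule variety_isoI[where I = "idx n" and T = "jac_coord n" and T' = "jac_coord n"])
      (simp_all only: has_coordinates_Gamma[OF n0] has_coordinates_E coord_index_Gamma
        E_variety_simps(1) idx_odd[OF n] bij_jac_coord[of n, unfolded idx_odd[OF n]] f
        jac_coord_natural[of _ n, unfolded idx_odd[OF n]])
qed

lemma variety_iso_even:
  assumes n: "even n" "2 \<le> n"
  shows "variety_iso (Gamma_mod_Sigma n) (E_mod_top n) (jac_even n :: 'k::comm_ring_1 endo set \<Rightarrow> _)
    (Gamma_mod_Sigma n) (E_mod_top n) (jac_even n)"
proof -
  have n0: "0 < n" using n by simp
  have sub: "idx n \<subseteq> evidx n" unfolding idx_alt by blast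
  have f: "jac_even n (point (Gamma_mod_Sigma n) c) = point (E_mod_top n) (jac_coord n c)"
    for c :: "nat set \<Rightarrow> 'r::comm_ring_1"
  proof -
    have J: "jacobian n (cprod n c) \<in> carrier (E_group n)" by (rule jacobian_E_group[OF cprod_Gamma])
    have "jac_even n (point (Gamma_mod_Sigma n) c) = jacobian n (cprod n c) <#\<^bsub>E_group n\<^esub> E_top n"
      unfolding jac_even_def point_Gamma
      by (rule coset_map_Gamma[where g' = "\<lambda>x. x <#\<^bsub>E_group n\<^esub> E_top n"]) (simp_all add: cprod_Gamma)
    \<comment> \<open>Both sides are the coset of elements with the same prescribed coefficients on
      \<open>idx n\<close>; the representatives may differ in the top coefficient.\<close>
    also have "\<dots> = E_point (idx n) (jac_coord n c) <#\<^bsub>E_group n\<^esub> E_top n"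
      unfolding E_top_coset[OF n J] E_top_coset[OF n E_point_carrier[OF sub]]
      by (simp add: E_point_def jac_coord_def jacobian_ecoeff[OF cprod_Gamma] cong: ball_cong)
    finally show ?thesis by (simp only: E_mod_top_simps)
  qed
  show ?thesis
    by (rule variety_isoI[where I = "idx n" and T = "jac_coord n" and T' = "jac_coord n"])
      (simp_all only: has_coordinates_Gamma[OF n0] has_coordinates_E_mod_top[OF n] coord_index_Gamma
        E_mod_top_simps(1) bij_jac_coord f jac_coord_natural)
qed

theorem corollary7p8:
  fixes n :: nat
  assumes "n \<ge> 4"
  shows
    "(\<exists>d. affine_of_dim (Gamma_mod_Sigma n :: ('k::comm_ring_1 endo set, nat set, 'k) variety) d) \<and>
     (odd n \<longrightarrow>
        (\<forall>\<sigma> \<in> (Gamma n :: 'k endo set).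
           jac_odd n (\<sigma> <#\<^bsub>Gamma_group n\<^esub> Sigma_group n) = jacobian n \<sigma>) \<and>
        variety_iso (Gamma_mod_Sigma n) (E_variety n) (jac_odd n :: 'k endo set \<Rightarrow> _)
          (Gamma_mod_Sigma n) (E_variety n) (jac_odd n) \<and>
        affine_of_dim (Gamma_mod_Sigma n :: ('k endo set, nat set, 'k) variety) (2 ^ (n - 1) - 1)) \<and>
     (even n \<longrightarrow>
        (\<forall>\<sigma> \<in> (Gamma n :: 'k endo set).
           jac_even n (\<sigma> <#\<^bsub>Gamma_group n\<^esub> Sigma_group n) = jacobian n \<sigma> <#\<^bsub>E_group n\<^esub> E_top n) \<and>
        variety_iso (Gamma_mod_Sigma n) (E_mod_top n) (jac_even n :: 'k endo set \<Rightarrow> _)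
          (Gamma_mod_Sigma n) (E_mod_top n) (jac_even n) \<and>
        affine_of_dim (Gamma_mod_Sigma n :: ('k endo set, nat set, 'k) variety) (2 ^ (n - 1) - 2))"
proof (intro conjI impI ballI)
  have affine: "affine_of_dim (Gamma_mod_Sigma n :: ('k endo set, nat set, 'k) variety)
    (2 ^ (n - 1) - (if odd n then 1 else 2))" using assms by (intro affine_Gamma) simp
  then show "\<exists>d. affine_of_dim (Gamma_mod_Sigma n :: ('k endo set, nat set, 'k) variety) d" by blast
  show "affine_of_dim (Gamma_mod_Sigma n :: ('k endo set, nat set, 'k) variety) (2 ^ (n - 1) - 1)"
    if "odd n" using affine that by simp
  show "affine_of_dim (Gamma_mod_Sigma n :: ('k endo set, nat set, 'k) variety) (2 ^ (n - 1) - 2)"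
    if "even n" using affine that by simp
  show "variety_iso (Gamma_mod_Sigma n) (E_variety n) (jac_odd n :: 'k endo set \<Rightarrow> _)
    (Gamma_mod_Sigma n) (E_variety n) (jac_odd n)" if "odd n" by (rule variety_iso_odd[OF that])
  show "variety_iso (Gamma_mod_Sigma n) (E_mod_top n) (jac_even n :: 'k endo set \<Rightarrow> _)
    (Gamma_mod_Sigma n) (E_mod_top n) (jac_even n)" if "even n"
    by (rule variety_iso_even[OF that]) (use assms in simp)
next
  fix \<sigma> :: "'k endo" assume \<sigma>: "\<sigma> \<in> Gamma n"
  show "jac_odd n (\<sigma> <#\<^bsub>Gamma_group n\<^esub> Sigma_group n) = jacobian n \<sigma>"
    unfolding jac_odd_def Sigma_coset[OF \<sigma>] by (rule coset_map_Gamma[OF \<sigma>, where g' = "\<lambda>x. x"]) simp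
  show "jac_even n (\<sigma> <#\<^bsub>Gamma_group n\<^esub> Sigma_group n) = jacobian n \<sigma> <#\<^bsub>E_group n\<^esub> E_top n"
    unfolding jac_even_def Sigma_coset[OF \<sigma>]
    by (rule coset_map_Gamma[OF \<sigma>, where g' = "\<lambda>x. x <#\<^bsub>E_group n\<^esub> E_top n"]) simp
qed

end
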